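(* There is a constant $C>0$, depending only on the shape of $\Omega$, with the following property. Let $\nu,\alpha>0$, and let $v$ and $u$ be solutions of $$v_t+\nu Av+\alpha^2Av_t+B(v,v)=h(t),\quad v(0)=v_0\in V,$$ $$u_t+\nu Au+\alpha^2Au_t+B(u,u)=g(t),\quad u(0)=u_0\in V,$$ where $\|h(t)\|_{-1}\le \mathbf h<\infty$ for all $t\in\mathbb R$. Let $m$ be large enough that $$\lambda_{m+1}>C\,\frac{\mathbf h^4}{\alpha^4\nu^8d_1^2},\qquad d_1=\tfrac12\min\{\alpha^{-2},\lambda_1\}.$$ If $$\lim_{t\to\infty}\|h(t)-g(t)\|_{-1}=0\quad\text{and}\quad \lim_{t\to\infty}\|P_m(v(t)-u(t))\|=0,$$ then $$\lim_{t\to\infty}\|v(t)-u(t)\|_1=0.$$ That is, the first $m$ eigenfunctions of the Stokes operator are asymptotically determining for the 3D Navier-Stokes-Voight equations with homogeneous Dirichlet boundary conditions.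
   Context: $\Omega\subset\mathbb R^3$ is a bounded domain with sufficiently smooth boundary. $\mathcal V=\{v\in (C_0^\infty(\Omega))^3:\nabla\cdot v=0\}$; $H$ is the closure of $\mathcal V$ in $(L^2(\Omega))^3$, with norm $\|\cdot\|$; $P$ is the orthogonal (Helmholtz-Leray) projection of $(L^2(\Omega))^3$ onto $H$; $A=-P\Delta$ is the Stokes operator with homogeneous Dirichlet boundary condition, with orthonormal (in $H$) eigenfunctions $\{w_j\}$ and corresponding eigenvalues $0<\lambda_1\le\lambda_2\le\cdots$ repeated according to multiplicity. $P_m$ is the orthogonal projection of $H$ onto $\mathrm{span}\{w_1,\dots,w_m\}$. $\|v\|_s=\|A^{s/2}v\|$ is the norm of $V_s=D(A^{s/2})$, $s\in\mathbb R$ (for $s<0$, defined as the completion); $V=V_1=(H_0^1(\Omega))^3\cap H$ with $\|v\|_1=\|\nabla v\|$, and $V'=V_{-1}$. $B(u,v)=P((u\cdot\nabla)v)$, extended to a continuous bilinear map $V\times V\to V'$. The forcing terms $h,g$ are (strongly measurable) $V_{-1}$-valued functions of time, $g$ locally square integrable; solutions are functions in $C([0,\infty);V)$, absolutely continuous into $V$, satisfying the equation in $V'$ for almost every $t>0$. "Depending only on the shape of $\Omega$" means: independent of $\nu,\alpha,h,g,v_0,u_0,m$ and unchanged when $\Omega$ is rescaled. *)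

theory Defs
  imports "HOL-Analysis.Analysis"
begin

section \<open>Functions and domains\<close>

type_synonym vec3 = "real ^ 3"
type_synonym field = "vec3 \<Rightarrow> vec3"

abbreviation partial :: "3 \<Rightarrow> (vec3 \<Rightarrow> 'b::real_normed_vector) \<Rightarrow> vec3 \<Rightarrow> 'b" where
  "partial i f x \<equiv> frechet_derivative f (at x) (axis i 1)"

primrec Ck_on :: "nat \<Rightarrow> vec3 set \<Rightarrow> (vec3 \<Rightarrow> 'b::real_normed_vector) \<Rightarrow> bool" where
  "Ck_on 0 S f \<longleftrightarrow> continuous_on S f"
| "Ck_on (Suc k) S f \<longleftrightarrow> f differentiable_on S \<and> (\<forall>i. Ck_on k S (partial i f))"

text \<open>The boundary is of class \<open>C\<^sup>2\<close>: near each of its points \<open>\<Omega>\<close> is the sublevel set of a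
  \<open>C\<^sup>2\<close> function without critical points. This is the regularity under which the Stokes operator
  with domain \<open>H\<^sup>2 \<inter> V\<close> is self-adjoint.\<close>

definition smooth_bounded_domain :: "vec3 set \<Rightarrow> bool" where
  "smooth_bounded_domain \<Omega> \<longleftrightarrow>
     open \<Omega> \<and> connected \<Omega> \<and> bounded \<Omega> \<and> \<Omega> \<noteq> {} \<and>
     (\<forall>p \<in> frontier \<Omega>. \<exists>U (\<rho> :: vec3 \<Rightarrow> real). open U \<and> p \<in> U \<and> Ck_on 2 U \<rho> \<and>
        (\<forall>x\<in>U. \<exists>i. partial i \<rho> x \<noteq> 0) \<and> \<Omega> \<inter> U = {x \<in> U. \<rho> x < 0})"

definition test_functions :: "vec3 set \<Rightarrow> (vec3 \<Rightarrow> 'b::real_normed_vector) set" where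
  "test_functions \<Omega> =
     {\<phi>. (\<forall>k. Ck_on k UNIV \<phi>) \<and> (\<exists>K. compact K \<and> K \<subseteq> \<Omega> \<and> (\<forall>x. x \<notin> K \<longrightarrow> \<phi> x = 0))}"

definition divfree_test_functions :: "vec3 set \<Rightarrow> field set" where
  "divfree_test_functions \<Omega> =
     {\<phi> \<in> test_functions \<Omega>. \<forall>x. (\<Sum>i\<in>UNIV. partial i \<phi> x $ i) = 0}"


section \<open>Lebesgue and Sobolev spaces\<close>

text \<open>Elements of the function spaces are represented by functions on \<open>\<real>\<^sup>3\<close>; only their values
  almost everywhere in \<open>\<Omega>\<close> matter.\<close>

definition L2 :: "vec3 set \<Rightarrow> (vec3 \<Rightarrow> 'b::euclidean_space) set" where
  "L2 \<Omega> = {u. u \<in> borel_measurable (lebesgue_on \<Omega>) \<and>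
              integrable (lebesgue_on \<Omega>) (\<lambda>x. (norm (u x))\<^sup>2)}"

definition l2_inner :: "vec3 set \<Rightarrow> (vec3 \<Rightarrow> 'b::euclidean_space) \<Rightarrow> (vec3 \<Rightarrow> 'b) \<Rightarrow> real" where
  "l2_inner \<Omega> u v = (LINT x|lebesgue_on \<Omega>. u x \<bullet> v x)"

definition l2_norm :: "vec3 set \<Rightarrow> (vec3 \<Rightarrow> 'b::euclidean_space) \<Rightarrow> real" where
  "l2_norm \<Omega> u = sqrt (l2_inner \<Omega> u u)"

definition weak_deriv :: "vec3 set \<Rightarrow> 3 \<Rightarrow> field \<Rightarrow> field \<Rightarrow> bool" where
  "weak_deriv \<Omega> i u g \<longleftrightarrow> u \<in> L2 \<Omega> \<and> g \<in> L2 \<Omega> \<and>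
     (\<forall>\<phi> \<in> (test_functions \<Omega> :: (vec3 \<Rightarrow> real) set).
        (LINT x|lebesgue_on \<Omega>. partial i \<phi> x *\<^sub>R u x) = - (LINT x|lebesgue_on \<Omega>. \<phi> x *\<^sub>R g x))"

definition wpartial :: "vec3 set \<Rightarrow> 3 \<Rightarrow> field \<Rightarrow> field" where
  "wpartial \<Omega> i u = (SOME g. weak_deriv \<Omega> i u g)"

definition H1 :: "vec3 set \<Rightarrow> field set" where
  "H1 \<Omega> = {u \<in> L2 \<Omega>. \<forall>i. \<exists>g. weak_deriv \<Omega> i u g}"

definition H2 :: "vec3 set \<Rightarrow> field set" where
  "H2 \<Omega> = {u \<in> H1 \<Omega>. \<forall>i. wpartial \<Omega> i u \<in> H1 \<Omega>}"

text \<open>The Jacobian matrix: row \<open>k\<close>, column \<open>i\<close> is \<open>\<partial>\<^sub>i u\<^sub>k\<close>.\<close>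

definition wgrad :: "vec3 set \<Rightarrow> field \<Rightarrow> vec3 \<Rightarrow> real ^ 3 ^ 3" where
  "wgrad \<Omega> u x = (\<chi> k i. wpartial \<Omega> i u x $ k)"

definition wlaplacian :: "vec3 set \<Rightarrow> field \<Rightarrow> field" where
  "wlaplacian \<Omega> u x = (\<Sum>i\<in>UNIV. wpartial \<Omega> i (wpartial \<Omega> i u) x)"

definition H10 :: "vec3 set \<Rightarrow> field set" where
  "H10 \<Omega> = {u \<in> H1 \<Omega>. \<forall>\<epsilon>>0. \<exists>\<phi> \<in> test_functions \<Omega>.
     (l2_norm \<Omega> (\<lambda>x. u x - \<phi> x))\<^sup>2 + (l2_norm \<Omega> (wgrad \<Omega> (\<lambda>x. u x - \<phi> x)))\<^sup>2 < \<epsilon>}"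


section \<open>The spaces of hydrodynamics and the Stokes operator\<close>

definition space_H :: "vec3 set \<Rightarrow> field set" where
  "space_H \<Omega> = {u \<in> L2 \<Omega>. \<forall>\<epsilon>>0. \<exists>\<phi> \<in> divfree_test_functions \<Omega>. l2_norm \<Omega> (\<lambda>x. u x - \<phi> x) < \<epsilon>}"

definition space_V :: "vec3 set \<Rightarrow> field set" where
  "space_V \<Omega> = H10 \<Omega> \<inter> space_H \<Omega>"

definition V_norm :: "vec3 set \<Rightarrow> field \<Rightarrow> real" where
  "V_norm \<Omega> u = l2_norm \<Omega> (wgrad \<Omega> u)"

definition is_orth_proj :: "vec3 set \<Rightarrow> field set \<Rightarrow> field \<Rightarrow> field \<Rightarrow> bool" where
  "is_orth_proj \<Omega> S f p \<longleftrightarrow>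
     f \<in> L2 \<Omega> \<and> p \<in> S \<and> (\<forall>\<phi>\<in>S. l2_inner \<Omega> (\<lambda>x. f x - p x) \<phi> = 0)"

definition orth_proj :: "vec3 set \<Rightarrow> field set \<Rightarrow> field \<Rightarrow> field" where
  "orth_proj \<Omega> S f = (SOME p. is_orth_proj \<Omega> S f p)"

text \<open>The graph of \<open>A = -P\<Delta>\<close>, with domain \<open>H\<^sup>2 \<inter> V\<close>; \<open>P\<close> is the orthogonal projection onto \<open>H\<close>.\<close>

definition stokes :: "vec3 set \<Rightarrow> field \<Rightarrow> field \<Rightarrow> bool" where
  "stokes \<Omega> u f \<longleftrightarrow> u \<in> H2 \<Omega> \<inter> space_V \<Omega> \<and>
     is_orth_proj \<Omega> (space_H \<Omega>) (\<lambda>x. - wlaplacian \<Omega> u x) f"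

definition eigenspan :: "(nat \<Rightarrow> field) \<Rightarrow> nat \<Rightarrow> field set" where
  "eigenspan w m = {\<lambda>x. \<Sum>j=1..m. c j *\<^sub>R w j x | c :: nat \<Rightarrow> real. True}"

text \<open>Sequences are indexed from \<open>1\<close>. The condition that the eigenfunctions span a dense subspace
  of \<open>H\<close> says that the list is complete, every eigenvalue occurring according to its multiplicity.\<close>

definition stokes_eigensystem :: "vec3 set \<Rightarrow> (nat \<Rightarrow> field) \<Rightarrow> (nat \<Rightarrow> real) \<Rightarrow> bool" where
  "stokes_eigensystem \<Omega> w lam \<longleftrightarrow>
     (\<forall>j\<ge>1. stokes \<Omega> (w j) (\<lambda>x. lam j *\<^sub>R w j x)) \<and>
     0 < lam 1 \<and> (\<forall>j\<ge>1. lam j \<le> lam (Suc j)) \<and>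
     (\<forall>i\<ge>1. \<forall>j\<ge>1. l2_inner \<Omega> (w i) (w j) = (if i = j then 1 else 0)) \<and>
     (\<forall>u \<in> space_H \<Omega>. \<forall>\<epsilon>>0. \<exists>m. \<exists>p \<in> eigenspan w m. l2_norm \<Omega> (\<lambda>x. u x - p x) < \<epsilon>)"


section \<open>The dual space\<close>

text \<open>\<open>V'\<close> consists of the bounded linear functionals on \<open>V\<close>; the values of a functional outside
  \<open>V\<close> are irrelevant. An element \<open>f\<close> of \<open>H\<close> acts as \<open>l2_inner \<Omega> f\<close>.\<close>

type_synonym functional = "field \<Rightarrow> real"

definition V_dual :: "vec3 set \<Rightarrow> functional set" where
  "V_dual \<Omega> = {f.
     (\<forall>\<phi>\<in>space_V \<Omega>. \<forall>\<psi>\<in>space_V \<Omega>. f (\<lambda>x. \<phi> x + \<psi> x) = f \<phi> + f \<psi>) \<and>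
     (\<forall>\<phi>\<in>space_V \<Omega>. \<forall>c. f (\<lambda>x. c *\<^sub>R \<phi> x) = c * f \<phi>) \<and>
     (\<exists>K. \<forall>\<phi>\<in>space_V \<Omega>. \<bar>f \<phi>\<bar> \<le> K * V_norm \<Omega> \<phi>)}"

text \<open>\<open>\<parallel>A\<^bsup>s/2\<^esup> f\<parallel>\<close> in the spectral representation, where \<open>f (w j)\<close> is the \<open>j\<close>-th Fourier coefficient
  of \<open>f\<close>; it is used for \<open>s = -1\<close>, where the series converges for every \<open>f \<in> V'\<close>.\<close>

definition spectral_norm :: "(nat \<Rightarrow> field) \<Rightarrow> (nat \<Rightarrow> real) \<Rightarrow> real \<Rightarrow> functional \<Rightarrow> real" where
  "spectral_norm w lam s f = sqrt (\<Sum>j. lam (Suc j) powr s * (f (w (Suc j)))\<^sup>2)"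

abbreviation dual_norm :: "(nat \<Rightarrow> field) \<Rightarrow> (nat \<Rightarrow> real) \<Rightarrow> functional \<Rightarrow> real" where
  "dual_norm w lam \<equiv> spectral_norm w lam (-1)"

definition forcing ::
  "vec3 set \<Rightarrow> (nat \<Rightarrow> field) \<Rightarrow> (nat \<Rightarrow> real) \<Rightarrow> (real \<Rightarrow> functional) \<Rightarrow> bool" where
  "forcing \<Omega> w lam h \<longleftrightarrow> (\<forall>t. h t \<in> V_dual \<Omega>) \<and>
     (\<exists>s :: nat \<Rightarrow> real \<Rightarrow> functional.
        (\<forall>n. simple_function lebesgue (s n) \<and> (\<forall>t. s n t \<in> V_dual \<Omega>)) \<and>
        (AE t in lebesgue. (\<lambda>n. dual_norm w lam (\<lambda>\<phi>. s n t \<phi> - h t \<phi>)) \<longlonglongrightarrow> 0))"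

definition locally_square_integrable ::
  "(nat \<Rightarrow> field) \<Rightarrow> (nat \<Rightarrow> real) \<Rightarrow> (real \<Rightarrow> functional) \<Rightarrow> bool" where
  "locally_square_integrable w lam g \<longleftrightarrow>
     (\<forall>a b. integrable (lebesgue_on {a..b}) (\<lambda>t. (dual_norm w lam (g t))\<^sup>2))"

text \<open>The bounded extension of \<open>A\<close> to a map from \<open>V\<close> to \<open>V'\<close>, obtained from
  \<open>(Au, \<phi>) = (-\<Delta>u, \<phi>) = (\<nabla>u, \<nabla>\<phi>)\<close>.\<close>

definition stokes_ext :: "vec3 set \<Rightarrow> field \<Rightarrow> functional" where
  "stokes_ext \<Omega> u = (\<lambda>\<phi>. l2_inner \<Omega> (wgrad \<Omega> u) (wgrad \<Omega> \<phi>))"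

text \<open>The continuous extension of \<open>B(u, v) = P((u \<cdot> \<nabla>)v)\<close> to a map from \<open>V \<times> V\<close> to \<open>V'\<close>: since \<open>P\<close> is
  an orthogonal projection and \<open>\<phi> \<in> V \<subseteq> H\<close>, \<open>(P((u \<cdot> \<nabla>)v), \<phi>) = ((u \<cdot> \<nabla>)v, \<phi>)\<close>, and the integrand on
  the right is integrable for all \<open>u, v, \<phi> \<in> V\<close> even if \<open>(u \<cdot> \<nabla>)v \<notin> L\<^sup>2\<close>.\<close>

definition B_form :: "vec3 set \<Rightarrow> field \<Rightarrow> field \<Rightarrow> functional" where
  "B_form \<Omega> u v = (\<lambda>\<phi>. l2_inner \<Omega> (\<lambda>x. wgrad \<Omega> v x *v u x) \<phi>)"


section \<open>Solutions of the Navier-Stokes-Voight equations\<close>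

definition V_continuous :: "vec3 set \<Rightarrow> (real \<Rightarrow> field) \<Rightarrow> bool" where
  "V_continuous \<Omega> v \<longleftrightarrow>
     (\<forall>t\<ge>0. ((\<lambda>s. V_norm \<Omega> (\<lambda>x. v s x - v t x)) \<longlongrightarrow> 0) (at t within {0..}))"

text \<open>Absolute continuity into \<open>V\<close> on every interval \<open>[0, T]\<close>; the set \<open>I\<close> of pairs \<open>(a, b)\<close> stands for
  a finite family of nonoverlapping intervals \<open>[a, b]\<close>.\<close>

definition V_abs_continuous :: "vec3 set \<Rightarrow> (real \<Rightarrow> field) \<Rightarrow> bool" where
  "V_abs_continuous \<Omega> v \<longleftrightarrow>
     (\<forall>T>0. \<forall>\<epsilon>>0. \<exists>\<delta>>0. \<forall>I :: (real \<times> real) set.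
        finite I \<and> (\<forall>(a, b) \<in> I. 0 \<le> a \<and> a \<le> b \<and> b \<le> T) \<and>
        pairwise (\<lambda>p q. {fst p<..<snd p} \<inter> {fst q<..<snd q} = {}) I \<and>
        (\<Sum>(a, b) \<in> I. b - a) < \<delta>
        \<longrightarrow> (\<Sum>(a, b) \<in> I. V_norm \<Omega> (\<lambda>x. v b x - v a x)) < \<epsilon>)"

definition has_V_derivative :: "vec3 set \<Rightarrow> (real \<Rightarrow> field) \<Rightarrow> field \<Rightarrow> real \<Rightarrow> bool" where
  "has_V_derivative \<Omega> v v' t \<longleftrightarrow> v' \<in> space_V \<Omega> \<and>
     ((\<lambda>s. V_norm \<Omega> (\<lambda>x. (v s x - v t x) /\<^sub>R (s - t) - v' x)) \<longlongrightarrow> 0) (at t)"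

definition nsv_solution ::
  "vec3 set \<Rightarrow> real \<Rightarrow> real \<Rightarrow> (real \<Rightarrow> functional) \<Rightarrow> field \<Rightarrow> (real \<Rightarrow> field) \<Rightarrow> bool" where
  "nsv_solution \<Omega> \<nu> \<alpha> h v0 v \<longleftrightarrow>
     (\<forall>t\<ge>0. v t \<in> space_V \<Omega>) \<and> V_continuous \<Omega> v \<and> V_abs_continuous \<Omega> v \<and>
     (AE x in lebesgue_on \<Omega>. v 0 x = v0 x) \<and>
     (AE t in lebesgue. t > 0 \<longrightarrow> (\<exists>v'. has_V_derivative \<Omega> v v' t \<and>
        (\<forall>\<phi> \<in> space_V \<Omega>.
           l2_inner \<Omega> v' \<phi> + \<nu> * stokes_ext \<Omega> (v t) \<phi> + \<alpha>\<^sup>2 * stokes_ext \<Omega> v' \<phi>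
             + B_form \<Omega> (v t) (v t) \<phi> = h t \<phi>)))"

end

theory Submission
  imports Defs
begin

text \<open>Testing the equation for \<open>z = v - u\<close> with \<open>z\<close> gives, for \<open>E = \<parallel>z\<parallel>\<^sup>2 + \<alpha>\<^sup>2 \<parallel>\<nabla>z\<parallel>\<^sup>2\<close>,
  the identity \<open>E'/2 = (h - g, z) - \<nu> \<parallel>\<nabla>z\<parallel>\<^sup>2 - (B(z, v), z)\<close>, because \<open>(B(u, z), z) = 0\<close>.
  By Ladyzhenskaya's inequality, whose constant does not depend on the domain, the last term is at most
  \<open>\<surd>8 \<parallel>\<nabla>v\<parallel> \<parallel>z\<parallel>\<^sup>1\<^sup>/\<^sup>2 \<parallel>\<nabla>z\<parallel>\<^sup>3\<^sup>/\<^sup>2\<close>, and the energy estimate for \<open>v\<close> alone shows that eventually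
  \<open>\<parallel>\<nabla>v\<parallel>\<^sup>2\<close> is hardly larger than \<open>hb\<^sup>2 / (\<alpha>\<^sup>2 \<nu>\<^sup>2 d\<^sub>1)\<close>.
  Up to its first \<open>m\<close> modes, which tend to zero, \<open>\<parallel>z\<parallel>\<^sup>2\<close> is bounded by \<open>\<parallel>\<nabla>z\<parallel>\<^sup>2 / \<lambda>\<^sub>m\<^sub>+\<^sub>1\<close>. For
  \<open>\<lambda>\<^sub>m\<^sub>+\<^sub>1\<close> above the threshold with \<open>C = 64\<close> the viscous term therefore absorbs the nonlinear one, and
  Gronwall's inequality yields \<open>E \<rightarrow> 0\<close>.\<close>

section \<open>The semi-inner product on square integrable fields\<close>

text \<open>Origin of the threshold: let x be the gradient norm of z and \<open>\<Lambda>\<close>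
  the square root of \<open>lam (m + 1)\<close>. Up to low modes the convective term is at most
  sqrt(8 W / \<Lambda>) x^2, where W lies just above K = hb^2 / (\<alpha>^2 \<nu>^2 d1). Viscosity
  absorbs it if 8 K / \<Lambda> < \<nu>^2; squaring this inequality gives the fourth power of hb and
  C = 64 = 8^2, with the 8 of Ladyzhenskaya's inequality. Only the forcing of v comes with a uniform
  bound, so the difference of the convective terms is arranged to put the gradient on v. Two
  obstacles shape the proof. Fields are functions and weak derivatives are chosen representatives,
  so even linearity of the gradient holds only almost everywhere and rests on the fundamental lemma
  of the calculus of variations. Solutions are only absolutely continuous in time, so energy
  inequalities hold at almost every time; monotonicity is recovered from a gauge argument.\<close>

lemma discriminant_nonpos:
  fixes a b c :: real
  assumes "a \<ge> 0" "c \<ge> 0" and nonneg: "\<And>s. 0 \<le> a + 2 * s * b + s\<^sup>2 * c"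
  shows "b\<^sup>2 \<le> a * c"
proof (cases "c = 0")
  case True
  have "b = 0"
  proof (rule ccontr)
    assume "b \<noteq> 0"
    \<comment> \<open>At this \<open>s\<close> the expression \<open>a + 2 * s * b\<close> takes the
      value -1.\<close>
    then have "2 * (- (a + 1) / (2 * b)) * b = - (a + 1)" by simp
    with nonneg[of "- (a + 1) / (2 * b)"] True show False by simp
  qed
  then show ?thesis using True by simp
next
  case False
  with assms have "c > 0" by simp
  with nonneg[of "- b / c"] show ?thesis
    by (simp add: power2_eq_square field_simps)
qed

lemma L2_D:
  assumes "u \<in> L2 \<Omega>"
  shows L2_measurable: "u \<in> borel_measurable (lebesgue_on \<Omega>)"
    and L2_integrable: "integrable (lebesgue_on \<Omega>) (\<lambda>x. (norm (u x))\<^sup>2)"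
  using assms by (auto simp: L2_def)

lemma L2_I_bound:
  assumes "u \<in> borel_measurable (lebesgue_on \<Omega>)" "integrable (lebesgue_on \<Omega>) f"
    "\<And>x. (norm (u x))\<^sup>2 \<le> f x"
  shows "u \<in> L2 \<Omega>"
  unfolding L2_def using assms
  by (auto intro!: Bochner_Integration.integrable_bound[OF assms(2)] order_trans[OF assms(3) abs_ge_self])

lemma L2_zero [simp]: "(\<lambda>x. 0) \<in> L2 \<Omega>"
  by (simp add: L2_def)

lemma L2_add:
  assumes "u \<in> L2 \<Omega>" "v \<in> L2 \<Omega>"
  shows "(\<lambda>x. u x + v x) \<in> L2 \<Omega>"
proof (rule L2_I_bound)
  show "integrable (lebesgue_on \<Omega>) (\<lambda>x. 2 * (norm (u x))\<^sup>2 + 2 * (norm (v x))\<^sup>2)"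
    using L2_integrable[OF assms(1)] L2_integrable[OF assms(2)] by simp
  fix x
  have "(norm (u x + v x))\<^sup>2 \<le> (norm (u x) + norm (v x))\<^sup>2"
    by (simp add: power_mono norm_triangle_ineq)
  also have "\<dots> \<le> 2 * (norm (u x))\<^sup>2 + 2 * (norm (v x))\<^sup>2"
    using zero_le_power2[of "norm (u x) - norm (v x)"] by (simp add: power2_eq_square algebra_simps)
  finally show "(norm (u x + v x))\<^sup>2 \<le> 2 * (norm (u x))\<^sup>2 + 2 * (norm (v x))\<^sup>2" .
qed (use assms in \<open>auto intro: L2_measurable borel_measurable_add\<close>)

lemma L2_scaleR: "u \<in> L2 \<Omega> \<Longrightarrow> (\<lambda>x. c *\<^sub>R u x) \<in> L2 \<Omega>"
  unfolding L2_def by (auto simp: power_mult_distrib intro: borel_measurable_scaleR)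

lemma L2_minus: "u \<in> L2 \<Omega> \<Longrightarrow> (\<lambda>x. - u x) \<in> L2 \<Omega>"
  using L2_scaleR[of u \<Omega> "-1"] by simp

lemma L2_diff:
  assumes "u \<in> L2 \<Omega>" "v \<in> L2 \<Omega>"
  shows "(\<lambda>x. u x - v x) \<in> L2 \<Omega>"
  using L2_add[OF assms(1) L2_minus[OF assms(2)]] by simp

lemma L2_sum: "(\<And>i. i \<in> I \<Longrightarrow> u i \<in> L2 \<Omega>) \<Longrightarrow> (\<lambda>x. \<Sum>i\<in>I. u i x) \<in> L2 \<Omega>"
  by (induction I rule: infinite_finite_induct) (auto intro: L2_add)

lemmas L2_intros = L2_zero L2_add L2_diff L2_scaleR L2_minus L2_sum

lemma L2_inner_integrable:
  assumes "u \<in> L2 \<Omega>" "v \<in> L2 \<Omega>"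
  shows "integrable (lebesgue_on \<Omega>) (\<lambda>x. u x \<bullet> v x)"
proof (rule Bochner_Integration.integrable_bound)
  show "integrable (lebesgue_on \<Omega>) (\<lambda>x. (norm (u x))\<^sup>2 + (norm (v x))\<^sup>2)"
    using L2_integrable[OF assms(1)] L2_integrable[OF assms(2)] by simp
  show "AE x in lebesgue_on \<Omega>. norm (u x \<bullet> v x) \<le> norm ((norm (u x))\<^sup>2 + (norm (v x))\<^sup>2)"
  proof (rule AE_I2)
    fix x
    have "norm (u x \<bullet> v x) \<le> norm (u x) * norm (v x)"
      by (simp add: Cauchy_Schwarz_ineq2)
    also have "\<dots> \<le> (norm (u x))\<^sup>2 + (norm (v x))\<^sup>2"
      using zero_le_power2[of "norm (u x) - norm (v x)"] mult_nonneg_nonneg[OF norm_ge_zero[of "u x"] norm_ge_zero[of "v x"]]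
      unfolding power2_diff by linarith
    finally show "norm (u x \<bullet> v x) \<le> norm ((norm (u x))\<^sup>2 + (norm (v x))\<^sup>2)" by simp
  qed
qed (use assms in \<open>auto intro: L2_measurable borel_measurable_inner\<close>)

lemma l2_inner_commute: "l2_inner \<Omega> u v = l2_inner \<Omega> v u"
  by (simp add: l2_inner_def inner_commute)

lemma l2_inner_add_left:
  "\<lbrakk>u \<in> L2 \<Omega>; v \<in> L2 \<Omega>; w \<in> L2 \<Omega>\<rbrakk> \<Longrightarrow>
    l2_inner \<Omega> (\<lambda>x. u x + v x) w = l2_inner \<Omega> u w + l2_inner \<Omega> v w"
  by (simp add: l2_inner_def inner_add_left L2_inner_integrable)

lemma l2_inner_diff_left:
  "\<lbrakk>u \<in> L2 \<Omega>; v \<in> L2 \<Omega>; w \<in> L2 \<Omega>\<rbrakk> \<Longrightarrow>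
    l2_inner \<Omega> (\<lambda>x. u x - v x) w = l2_inner \<Omega> u w - l2_inner \<Omega> v w"
  by (simp add: l2_inner_def inner_diff_left L2_inner_integrable)

lemma l2_inner_scaleR_left: "l2_inner \<Omega> (\<lambda>x. c *\<^sub>R u x) w = c * l2_inner \<Omega> u w"
  by (simp add: l2_inner_def)

lemma l2_inner_minus_left: "l2_inner \<Omega> (\<lambda>x. - u x) w = - l2_inner \<Omega> u w"
  by (simp add: l2_inner_def)

lemma l2_inner_sum_left:
  "\<lbrakk>\<And>i. i \<in> I \<Longrightarrow> u i \<in> L2 \<Omega>; w \<in> L2 \<Omega>\<rbrakk> \<Longrightarrow>
    l2_inner \<Omega> (\<lambda>x. \<Sum>i\<in>I. u i x) w = (\<Sum>i\<in>I. l2_inner \<Omega> (u i) w)"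
  by (simp add: l2_inner_def inner_sum_left L2_inner_integrable)

lemma l2_inner_add_right:
  "\<lbrakk>u \<in> L2 \<Omega>; v \<in> L2 \<Omega>; w \<in> L2 \<Omega>\<rbrakk> \<Longrightarrow>
    l2_inner \<Omega> w (\<lambda>x. u x + v x) = l2_inner \<Omega> w u + l2_inner \<Omega> w v"
  by (simp add: l2_inner_commute[of \<Omega> w] l2_inner_add_left)

lemma l2_inner_diff_right:
  "\<lbrakk>u \<in> L2 \<Omega>; v \<in> L2 \<Omega>; w \<in> L2 \<Omega>\<rbrakk> \<Longrightarrow>
    l2_inner \<Omega> w (\<lambda>x. u x - v x) = l2_inner \<Omega> w u - l2_inner \<Omega> w v"
  by (simp add: l2_inner_commute[of \<Omega> w] l2_inner_diff_left)

lemma l2_inner_scaleR_right: "l2_inner \<Omega> w (\<lambda>x. c *\<^sub>R u x) = c * l2_inner \<Omega> w u"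
  by (simp add: l2_inner_def)

lemma l2_inner_sum_right:
  "\<lbrakk>\<And>i. i \<in> I \<Longrightarrow> u i \<in> L2 \<Omega>; w \<in> L2 \<Omega>\<rbrakk> \<Longrightarrow>
    l2_inner \<Omega> w (\<lambda>x. \<Sum>i\<in>I. u i x) = (\<Sum>i\<in>I. l2_inner \<Omega> w (u i))"
  by (simp add: l2_inner_commute[of \<Omega> w] l2_inner_sum_left)

lemma l2_inner_zero [simp]: "l2_inner \<Omega> (\<lambda>x. 0) w = 0" "l2_inner \<Omega> w (\<lambda>x. 0) = 0"
  by (simp_all add: l2_inner_def)

lemma l2_inner_cong_AE:
  assumes "AE x in lebesgue_on \<Omega>. u x = u' x" "AE x in lebesgue_on \<Omega>. v x = v' x"
    "u \<in> L2 \<Omega>" "u' \<in> L2 \<Omega>" "v \<in> L2 \<Omega>" "v' \<in> L2 \<Omega>"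
  shows "l2_inner \<Omega> u v = l2_inner \<Omega> u' v'"
  unfolding l2_inner_def
proof (rule integral_cong_AE)
  show "AE x in lebesgue_on \<Omega>. u x \<bullet> v x = u' x \<bullet> v' x"
    using assms(1,2) by eventually_elim simp
qed (use assms in \<open>auto intro: borel_measurable_inner L2_measurable\<close>)

lemma l2_inner_nonneg [simp]: "0 \<le> l2_inner \<Omega> u u"
  by (simp add: l2_inner_def)

lemma l2_norm_nonneg [simp]: "0 \<le> l2_norm \<Omega> u"
  by (simp add: l2_norm_def)

lemma l2_norm_power2: "(l2_norm \<Omega> u)\<^sup>2 = l2_inner \<Omega> u u"
  by (simp add: l2_norm_def)

lemma l2_norm_zero [simp]: "l2_norm \<Omega> (\<lambda>x. 0) = 0"
  by (simp add: l2_norm_def)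

lemma l2_norm_cong_AE:
  assumes "AE x in lebesgue_on \<Omega>. u x = u' x" "u \<in> L2 \<Omega>" "u' \<in> L2 \<Omega>"
  shows "l2_norm \<Omega> u = l2_norm \<Omega> u'"
  unfolding l2_norm_def using l2_inner_cong_AE[OF assms(1,1) assms(2,3,2,3)] by simp

lemma l2_norm_scaleR: "l2_norm \<Omega> (\<lambda>x. c *\<^sub>R u x) = \<bar>c\<bar> * l2_norm \<Omega> u"
  unfolding l2_norm_def
  by (simp add: l2_inner_scaleR_left l2_inner_scaleR_right real_sqrt_mult
      flip: mult.assoc power2_eq_square)

lemma l2_norm_minus: "l2_norm \<Omega> (\<lambda>x. - u x) = l2_norm \<Omega> u"
  using l2_norm_scaleR[of \<Omega> "-1" u] by simp

lemma l2_norm_diff_commute: "l2_norm \<Omega> (\<lambda>x. u x - v x) = l2_norm \<Omega> (\<lambda>x. v x - u x)"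
  using l2_norm_minus[of \<Omega> "\<lambda>x. u x - v x"] by simp

lemma l2_norm_add_power2:
  assumes "u \<in> L2 \<Omega>" "v \<in> L2 \<Omega>"
  shows "(l2_norm \<Omega> (\<lambda>x. u x + v x))\<^sup>2 = (l2_norm \<Omega> u)\<^sup>2 + 2 * l2_inner \<Omega> u v + (l2_norm \<Omega> v)\<^sup>2"
  unfolding l2_norm_power2 using assms
  by (simp add: l2_inner_add_left l2_inner_add_right L2_intros l2_inner_commute[of \<Omega> v u])

lemma l2_norm_diff_power2:
  assumes "u \<in> L2 \<Omega>" "v \<in> L2 \<Omega>"
  shows "(l2_norm \<Omega> (\<lambda>x. u x - v x))\<^sup>2 = (l2_norm \<Omega> u)\<^sup>2 - 2 * l2_inner \<Omega> u v + (l2_norm \<Omega> v)\<^sup>2"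
  unfolding l2_norm_power2 using assms
  by (simp add: l2_inner_diff_left l2_inner_diff_right L2_intros l2_inner_commute[of \<Omega> v u])

lemma l2_Cauchy_Schwarz:
  assumes "u \<in> L2 \<Omega>" "v \<in> L2 \<Omega>"
  shows "\<bar>l2_inner \<Omega> u v\<bar> \<le> l2_norm \<Omega> u * l2_norm \<Omega> v"
proof -
  have "(l2_inner \<Omega> u v)\<^sup>2 \<le> l2_inner \<Omega> u u * l2_inner \<Omega> v v"
  proof (rule discriminant_nonpos)
    fix s
    have "0 \<le> l2_inner \<Omega> (\<lambda>x. u x + s *\<^sub>R v x) (\<lambda>x. u x + s *\<^sub>R v x)" by simp
    also have "\<dots> = l2_inner \<Omega> u u + 2 * s * l2_inner \<Omega> u v + s\<^sup>2 * l2_inner \<Omega> v v"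
      using assms
      by (simp add: l2_inner_add_left l2_inner_add_right L2_intros l2_inner_scaleR_left
          l2_inner_scaleR_right l2_inner_commute[of \<Omega> v u] power2_eq_square algebra_simps)
    finally show "0 \<le> l2_inner \<Omega> u u + 2 * s * l2_inner \<Omega> u v + s\<^sup>2 * l2_inner \<Omega> v v" .
  qed auto
  then have "(l2_inner \<Omega> u v)\<^sup>2 \<le> (l2_norm \<Omega> u * l2_norm \<Omega> v)\<^sup>2"
    by (simp add: power_mult_distrib l2_norm_power2)
  then show ?thesis by (simp add: abs_le_square_iff[symmetric])
qed

lemma l2_norm_triangle:
  assumes "u \<in> L2 \<Omega>" "v \<in> L2 \<Omega>"
  shows "l2_norm \<Omega> (\<lambda>x. u x + v x) \<le> l2_norm \<Omega> u + l2_norm \<Omega> v"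
proof (rule power2_le_imp_le)
  show "(l2_norm \<Omega> (\<lambda>x. u x + v x))\<^sup>2 \<le> (l2_norm \<Omega> u + l2_norm \<Omega> v)\<^sup>2"
    using l2_Cauchy_Schwarz[OF assms] by (simp add: l2_norm_add_power2[OF assms] power2_sum)
qed simp

lemma l2_norm_triangle_diff:
  assumes "u \<in> L2 \<Omega>" "v \<in> L2 \<Omega>"
  shows "l2_norm \<Omega> (\<lambda>x. u x - v x) \<le> l2_norm \<Omega> u + l2_norm \<Omega> v"
  using l2_norm_triangle[OF assms(1) L2_minus[OF assms(2)]] by (simp add: l2_norm_minus)

lemma l2_norm_triangle_sub:
  assumes "u \<in> L2 \<Omega>" "v \<in> L2 \<Omega>"
  shows "l2_norm \<Omega> u \<le> l2_norm \<Omega> v + l2_norm \<Omega> (\<lambda>x. u x - v x)"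
  using l2_norm_triangle[OF assms(2) L2_diff[OF assms]] by simp


section \<open>Square integrable curves\<close>

text \<open>The difference of squares factors as the inner product of u - v and u + v. In this form
  the increment of a squared norm is controlled by the norm of the increment, which is how absolute
  continuity reaches the energy.\<close>

lemma l2_norm_sq_diff_le:
  assumes "u \<in> L2 \<Omega>" "v \<in> L2 \<Omega>"
  shows "\<bar>(l2_norm \<Omega> u)\<^sup>2 - (l2_norm \<Omega> v)\<^sup>2\<bar>
    \<le> l2_norm \<Omega> (\<lambda>x. u x - v x) * (l2_norm \<Omega> u + l2_norm \<Omega> v)"
proof -
  have "(l2_norm \<Omega> u)\<^sup>2 - (l2_norm \<Omega> v)\<^sup>2 = l2_inner \<Omega> (\<lambda>x. u x - v x) (\<lambda>x. u x + v x)"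
    using assms
    by (simp add: l2_norm_power2 l2_inner_add_right l2_inner_diff_left L2_intros l2_inner_commute[of \<Omega> v u])
  also have "\<bar>\<dots>\<bar> \<le> l2_norm \<Omega> (\<lambda>x. u x - v x) * l2_norm \<Omega> (\<lambda>x. u x + v x)"
    using assms by (intro l2_Cauchy_Schwarz L2_intros)
  also have "\<dots> \<le> l2_norm \<Omega> (\<lambda>x. u x - v x) * (l2_norm \<Omega> u + l2_norm \<Omega> v)"
    using l2_norm_triangle[OF assms] by (simp add: mult_left_mono)
  finally show ?thesis .
qed

text \<open>With q the sum of the remainder \<open>R s\<close> and \<open>f'\<close>,
  \<open>f s\<close> equals \<open>f t\<close> plus (s - t) q as a function, so expanding the square
  gives the difference quotient exactly. The lemma serves both fields and their gradients.\<close>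

lemma l2_norm_sq_has_derivative:
  assumes f: "\<forall>\<^sub>F s in at t. f s \<in> L2 \<Omega>" and ft: "f t \<in> L2 \<Omega>" and f': "f' \<in> L2 \<Omega>"
    and lim: "((\<lambda>s. l2_norm \<Omega> (\<lambda>x. (f s x - f t x) /\<^sub>R (s - t) - f' x)) \<longlongrightarrow> 0) (at t)"
  shows "((\<lambda>s. (l2_norm \<Omega> (f s))\<^sup>2) has_real_derivative 2 * l2_inner \<Omega> f' (f t)) (at t)"
proof -
  define R where "R s = (\<lambda>x. (f s x - f t x) /\<^sub>R (s - t) - f' x)" for s
  have nR: "((\<lambda>s. l2_norm \<Omega> (R s)) \<longlongrightarrow> 0) (at t)" using lim by (simp add: R_def)
  have R: "\<forall>\<^sub>F s in at t. R s \<in> L2 \<Omega>"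
    using f by eventually_elim (auto simp: R_def intro!: L2_intros ft f')
  have "((\<lambda>s. l2_norm \<Omega> (R s) * l2_norm \<Omega> (f t)) \<longlongrightarrow> 0) (at t)"
    using tendsto_mult_right[OF nR, of "l2_norm \<Omega> (f t)"] by simp
  then have lim1: "((\<lambda>s. l2_inner \<Omega> (R s) (f t)) \<longlongrightarrow> 0) (at t)"
    by (rule Lim_null_comparison[rotated]) (use R in eventually_elim, simp add: l2_Cauchy_Schwarz ft)
  \<comment> \<open>The quadratic term of the expansion: s - t times a quantity that stays bounded
    near t.\<close>
  have "((\<lambda>s. \<bar>s - t\<bar> * (l2_norm \<Omega> (R s) + l2_norm \<Omega> f')\<^sup>2) \<longlongrightarrow> \<bar>t - t\<bar> * (0 + l2_norm \<Omega> f')\<^sup>2) (at t)"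
    by (intro tendsto_intros nR)
  then have "((\<lambda>s. \<bar>s - t\<bar> * (l2_norm \<Omega> (R s) + l2_norm \<Omega> f')\<^sup>2) \<longlongrightarrow> 0) (at t)" by simp
  then have lim2: "((\<lambda>s. (s - t) * (l2_norm \<Omega> (\<lambda>x. R s x + f' x))\<^sup>2) \<longlongrightarrow> 0) (at t)"
    by (rule Lim_null_comparison[rotated])
      (use R in eventually_elim, auto simp: abs_mult intro!: mult_left_mono power_mono l2_norm_triangle f')
  have "((\<lambda>s. 2 * l2_inner \<Omega> f' (f t) + 2 * l2_inner \<Omega> (R s) (f t)
      + (s - t) * (l2_norm \<Omega> (\<lambda>x. R s x + f' x))\<^sup>2) \<longlongrightarrow> 2 * l2_inner \<Omega> f' (f t) + 2 * 0 + 0) (at t)"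
    by (intro tendsto_intros lim1 lim2)
  moreover have "\<forall>\<^sub>F s in at t. 2 * l2_inner \<Omega> f' (f t) + 2 * l2_inner \<Omega> (R s) (f t)
      + (s - t) * (l2_norm \<Omega> (\<lambda>x. R s x + f' x))\<^sup>2
      = ((l2_norm \<Omega> (f s))\<^sup>2 - (l2_norm \<Omega> (f t))\<^sup>2) / (s - t)"
    using R eventually_neq_at_within[of t t]
  proof eventually_elim
    case (elim s)
    define q where "q = (\<lambda>x. R s x + f' x)"
    have q: "q \<in> L2 \<Omega>" using elim f' by (auto simp: q_def intro: L2_intros)
    have "f s = (\<lambda>x. f t x + (s - t) *\<^sub>R q x)"
      using elim(2) by (auto simp: q_def R_def fun_eq_iff)
    then have "(l2_norm \<Omega> (f s))\<^sup>2
        = (l2_norm \<Omega> (f t))\<^sup>2 + 2 * (s - t) * l2_inner \<Omega> (f t) q + (s - t)\<^sup>2 * (l2_norm \<Omega> q)\<^sup>2"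
      using l2_norm_add_power2[OF ft L2_scaleR[OF q, of "s - t"]]
      by (simp add: l2_inner_scaleR_right l2_norm_scaleR power_mult_distrib)
    moreover have "l2_inner \<Omega> (f t) q = l2_inner \<Omega> f' (f t) + l2_inner \<Omega> (R s) (f t)"
      unfolding q_def by (simp add: l2_inner_commute[of \<Omega> "f t"] l2_inner_add_left elim ft f')
    ultimately show ?case
      using elim(2) unfolding q_def[symmetric] by (simp add: field_simps power2_eq_square)
  qed
  ultimately show ?thesis
    unfolding has_field_derivative_iff by (simp add: filterlim_cong)
qed


section \<open>Smooth functions and test functions\<close>

text \<open>Coinduction for smoothness: a class of differentiable functions closed under partial
  derivatives consists of smooth functions, so iterated derivatives never have to be
  computed.\<close>

lemma smooth_coinduct:
  assumes "\<And>f. f \<in> S \<Longrightarrow> f differentiable_on UNIV"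
    and "\<And>f i. f \<in> S \<Longrightarrow> partial i f \<in> S" and "f \<in> S"
  shows "Ck_on k UNIV f"
  using assms(3) by (induction k arbitrary: f) (auto simp: assms differentiable_imp_continuous_on)

lemma smooth_has_derivative:
  assumes "\<forall>k. Ck_on k UNIV f"
  shows "(f has_derivative frechet_derivative f (at x)) (at x)"
proof -
  have "Ck_on (Suc 0) UNIV f" using assms by blast
  then have "f differentiable at x"
    by (simp add: differentiable_on_def)
  then show ?thesis by (simp add: frechet_derivative_works)
qed

lemma smooth_partial: "\<forall>k. Ck_on k UNIV f \<Longrightarrow> \<forall>k. Ck_on k UNIV (partial i f)"
  using Ck_on.simps(2) by blast

lemma smooth_continuous_on: "\<forall>k. Ck_on k UNIV f \<Longrightarrow> continuous_on S f"
  by (metis Ck_on.simps(1) continuous_on_subset subset_UNIV)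

lemma has_derivative_imp_differentiable_on_UNIV:
  "(\<And>x. (f has_derivative f' x) (at x)) \<Longrightarrow> f differentiable_on UNIV"
  by (auto simp: differentiable_on_def differentiable_def intro: has_derivative_at_withinI)

lemma has_derivative_imp_partial:
  "(\<And>x. (f has_derivative f' x) (at x)) \<Longrightarrow> partial i f = (\<lambda>x. f' x (axis i 1))"
  by (metis frechet_derivative_at)

text \<open>A bounded linear \<open>L\<close> commutes with partial derivatives, so the class of all
  compositions of \<open>L\<close> with smooth maps is closed under them. It is applied to scalar
  multiples and to coordinate projections.\<close>

lemma smooth_linear_image:
  assumes L: "bounded_linear L" and f: "\<forall>k. Ck_on k UNIV f"
  shows "Ck_on k UNIV (\<lambda>x. L (f x))" and "partial i (\<lambda>x. L (f x)) = (\<lambda>x. L (partial i f x))"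
proof -
  have D: "((\<lambda>x. L (g x)) has_derivative (\<lambda>y. L (frechet_derivative g (at x) y))) (at x)"
    if "\<forall>k. Ck_on k UNIV g" for g x
    by (rule bounded_linear.has_derivative[OF L smooth_has_derivative[OF that]])
  show "partial i (\<lambda>x. L (f x)) = (\<lambda>x. L (partial i f x))"
    by (rule has_derivative_imp_partial[OF D[OF f]])
  show "Ck_on k UNIV (\<lambda>x. L (f x))"
  proof (rule smooth_coinduct[where S = "{\<lambda>x. L (g x) | g. \<forall>k. Ck_on k UNIV g}"])
    fix h i assume "h \<in> {\<lambda>x. L (g x) | g. \<forall>k. Ck_on k UNIV g}"
    then obtain g where g: "h = (\<lambda>x. L (g x))" "\<forall>k. Ck_on k UNIV g" by blast
    show "h differentiable_on UNIV"
      unfolding g by (rule has_derivative_imp_differentiable_on_UNIV[OF D[OF g(2)]])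
    have "partial i h = (\<lambda>x. L (partial i g x))"
      unfolding g by (rule has_derivative_imp_partial[OF D[OF g(2)]])
    then show "partial i h \<in> {\<lambda>x. L (g x) | g. \<forall>k. Ck_on k UNIV g}"
      using smooth_partial[OF g(2), of i] by (auto intro!: exI[of _ "partial i g"])
  qed (use f in \<open>auto intro: exI[of _ f]\<close>)
qed

lemma smooth_add:
  fixes f g :: "vec3 \<Rightarrow> 'a::real_normed_vector"
  assumes "\<forall>k. Ck_on k UNIV f" "\<forall>k. Ck_on k UNIV g"
  shows "Ck_on k UNIV (\<lambda>x. f x + g x)" and "partial i (\<lambda>x. f x + g x) = (\<lambda>x. partial i f x + partial i g x)"
proof -
  let ?S = "{\<lambda>x. f x + g x | f g :: vec3 \<Rightarrow> 'a. (\<forall>k. Ck_on k UNIV f) \<and> (\<forall>k. Ck_on k UNIV g)}"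
  have mem: "h \<in> ?S" if "h = (\<lambda>x. f x + g x)" "\<forall>k. Ck_on k UNIV f" "\<forall>k. Ck_on k UNIV g" for f g h
    using that by blast
  have D: "((\<lambda>x. f x + g x) has_derivative
      (\<lambda>y. frechet_derivative f (at x) y + frechet_derivative g (at x) y)) (at x)"
    if "\<forall>k. Ck_on k UNIV f" "\<forall>k. Ck_on k UNIV g" for f g :: "vec3 \<Rightarrow> 'a" and x
    by (rule has_derivative_add[OF that[THEN smooth_has_derivative]])
  show "partial i (\<lambda>x. f x + g x) = (\<lambda>x. partial i f x + partial i g x)"
    by (rule has_derivative_imp_partial[OF D[OF assms]])
  show "Ck_on k UNIV (\<lambda>x. f x + g x)"
  proof (rule smooth_coinduct[where S = ?S])
    fix h i assume "h \<in> ?S"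
    then obtain f g where h: "h = (\<lambda>x. f x + g x)" "\<forall>k. Ck_on k UNIV f" "\<forall>k. Ck_on k UNIV g" by blast
    show "h differentiable_on UNIV"
      unfolding h by (rule has_derivative_imp_differentiable_on_UNIV[OF D[OF h(2,3)]])
    have "partial i h = (\<lambda>x. partial i f x + partial i g x)"
      unfolding h by (rule has_derivative_imp_partial[OF D[OF h(2,3)]])
    then show "partial i h \<in> ?S"
      using mem[OF _ smooth_partial[OF h(2), of i] smooth_partial[OF h(3), of i]] by blast
  qed (use mem[OF refl assms] in blast)
qed

lemma test_functionsE:
  assumes "\<phi> \<in> test_functions \<Omega>"
  obtains K where "\<forall>k. Ck_on k UNIV \<phi>" "compact K" "K \<subseteq> \<Omega>" "\<And>x. x \<notin> K \<Longrightarrow> \<phi> x = 0"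
  using assms by (auto simp: test_functions_def)

lemma test_functions_smooth: "\<phi> \<in> test_functions \<Omega> \<Longrightarrow> \<forall>k. Ck_on k UNIV \<phi>"
  by (simp add: test_functions_def)

lemma test_functions_zero_outside: "\<phi> \<in> test_functions \<Omega> \<Longrightarrow> x \<notin> \<Omega> \<Longrightarrow> \<phi> x = 0"
  by (auto simp: test_functions_def)

lemma test_functions_linear_image:
  assumes "bounded_linear L" "\<phi> \<in> test_functions \<Omega>"
  shows "(\<lambda>x. L (\<phi> x)) \<in> test_functions \<Omega>"
proof -
  interpret bounded_linear L by fact
  obtain K where "\<forall>k. Ck_on k UNIV \<phi>" "compact K" "K \<subseteq> \<Omega>" "\<And>x. x \<notin> K \<Longrightarrow> \<phi> x = 0"
    by (rule test_functionsE[OF assms(2)]) blast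
  then show ?thesis
    unfolding test_functions_def using smooth_linear_image(1)[OF assms(1)] zero
    by (auto intro!: exI[of _ K])
qed

lemma test_functions_add:
  assumes "\<phi> \<in> test_functions \<Omega>" "\<psi> \<in> test_functions \<Omega>"
  shows "(\<lambda>x. \<phi> x + \<psi> x) \<in> test_functions \<Omega>"
proof -
  obtain K where K: "\<forall>k. Ck_on k UNIV \<phi>" "compact K" "K \<subseteq> \<Omega>" "\<And>x. x \<notin> K \<Longrightarrow> \<phi> x = 0"
    by (rule test_functionsE[OF assms(1)]) blast
  obtain K' where K': "\<forall>k. Ck_on k UNIV \<psi>" "compact K'" "K' \<subseteq> \<Omega>" "\<And>x. x \<notin> K' \<Longrightarrow> \<psi> x = 0"
    by (rule test_functionsE[OF assms(2)]) blast
  show ?thesis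
    unfolding test_functions_def using smooth_add(1)[OF K(1) K'(1)] K K'
    by (force intro!: exI[of _ "K \<union> K'"])
qed

lemma test_functions_zero [simp]: "(\<lambda>x. 0) \<in> test_functions \<Omega>"
proof -
  have "Ck_on k UNIV (\<lambda>x::vec3. 0 :: 'a)" for k
    by (rule smooth_coinduct[where S = "{\<lambda>x. 0}"])
      (auto simp: has_derivative_imp_partial[of "\<lambda>x. 0" "\<lambda>x y. 0"])
  then show ?thesis unfolding test_functions_def by (auto intro!: exI[of _ "{}"])
qed

lemma partial_zero_outside:
  assumes "compact K" "\<And>x. x \<notin> K \<Longrightarrow> f x = 0" "x \<notin> K"
  shows "partial i f x = 0"
proof -
  have "(f has_derivative (\<lambda>_. 0)) (at x)"
  proof (rule has_derivative_transform_within_open)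
    show "((\<lambda>_. 0) has_derivative (\<lambda>_. 0)) (at x)" by simp
    show "open (- K)" using assms(1) by (simp add: compact_imp_closed open_Compl)
  qed (use assms in auto)
  then show ?thesis by (metis frechet_derivative_at)
qed

lemma test_functions_partial:
  assumes "\<phi> \<in> test_functions \<Omega>"
  shows "partial i \<phi> \<in> test_functions \<Omega>"
proof -
  obtain K where K: "\<forall>k. Ck_on k UNIV \<phi>" "compact K" "K \<subseteq> \<Omega>" "\<And>x. x \<notin> K \<Longrightarrow> \<phi> x = 0"
    by (rule test_functionsE[OF assms]) blast
  have "\<forall>k. Ck_on k UNIV (partial i \<phi>)" by (rule smooth_partial[OF K(1)])
  with K partial_zero_outside[OF K(2,4)] show ?thesis
    unfolding test_functions_def by (auto intro!: exI[of _ K])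
qed

section \<open>Integrals of compactly supported functions\<close>

lemma compact_support_bounded:
  fixes f :: "'a::topological_space \<Rightarrow> 'b::real_normed_vector"
  assumes "continuous_on UNIV f" "compact K" "\<And>x. x \<notin> K \<Longrightarrow> f x = 0"
  obtains B where "B > 0" "\<And>x. norm (f x) \<le> B"
proof -
  have "compact (f ` K)"
    using assms by (intro compact_continuous_image) (auto intro: continuous_on_subset)
  then obtain B where "\<forall>y\<in>f ` K. norm y \<le> B" using compact_imp_bounded bounded_iff by blast
  then have "norm (f x) \<le> max B 1" for x
    using assms(3)[of x] by (cases "x \<in> K") force+
  then show ?thesis using that[of "max B 1"] by auto
qed

lemma integrable_compact_support:
  fixes f :: "'a::euclidean_space \<Rightarrow> 'b::euclidean_space"
  assumes "continuous_on UNIV f" "compact K" "\<And>x. x \<notin> K \<Longrightarrow> f x = 0"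
  shows "integrable lborel f"
proof -
  have "set_integrable lborel K f"
    by (rule borel_integrable_compact[OF assms(2) continuous_on_subset[OF assms(1) subset_UNIV],
          unfolded set_integrable_def[symmetric]])
  moreover have "(\<lambda>x. indicator K x *\<^sub>R f x) = f" using assms(3) by (auto simp: indicator_def)
  ultimately show ?thesis by (simp add: set_integrable_def)
qed

text \<open>Bridge between two measures: the function spaces live on
  \<open>lebesgue_on \<Omega>\<close>, while translation arguments are carried out on
  \<open>lborel\<close>.\<close>

lemma lebesgue_on_eq_lborel:
  fixes f :: "'a::euclidean_space \<Rightarrow> 'b::euclidean_space"
  assumes "\<Omega> \<in> sets lebesgue" "f \<in> borel_measurable borel" "\<And>x. x \<notin> \<Omega> \<Longrightarrow> f x = 0"
  shows "integral\<^sup>L (lebesgue_on \<Omega>) f = integral\<^sup>L lborel f"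
    and "integrable (lebesgue_on \<Omega>) f \<longleftrightarrow> integrable lborel f"
proof -
  have eq: "(\<lambda>x. indicator \<Omega> x *\<^sub>R f x) = f" using assms(3) by (auto simp: indicator_def)
  show "integral\<^sup>L (lebesgue_on \<Omega>) f = integral\<^sup>L lborel f"
    using assms by (subst integral_restrict_space) (simp_all add: eq integral_completion)
  show "integrable (lebesgue_on \<Omega>) f \<longleftrightarrow> integrable lborel f"
    using assms by (subst integrable_restrict_space) (simp_all add: eq integrable_completion)
qed

lemma measurable_lebesgue_on_borel:
  "f \<in> borel_measurable borel \<Longrightarrow> f \<in> borel_measurable (lebesgue_on \<Omega>)"
  by (simp add: measurable_completion measurable_restrict_space1)

lemma test_functions_measurable:
  "\<phi> \<in> test_functions \<Omega> \<Longrightarrow> \<phi> \<in> borel_measurable borel"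
  using smooth_continuous_on[OF test_functions_smooth]
  by (auto intro: borel_measurable_continuous_onI)

lemma test_functions_L2:
  fixes \<phi> :: "vec3 \<Rightarrow> 'b::euclidean_space"
  assumes "\<phi> \<in> test_functions \<Omega>" "\<Omega> \<in> sets lebesgue"
  shows "\<phi> \<in> L2 \<Omega>"
proof -
  obtain K where K: "\<forall>k. Ck_on k UNIV \<phi>" "compact K" "K \<subseteq> \<Omega>" "\<And>x. x \<notin> K \<Longrightarrow> \<phi> x = 0"
    by (rule test_functionsE[OF assms(1)]) blast
  have "integrable lborel (\<lambda>x. (norm (\<phi> x))\<^sup>2)"
    using K by (intro integrable_compact_support[of _ K] continuous_intros smooth_continuous_on) auto
  then have "integrable (lebesgue_on \<Omega>) (\<lambda>x. (norm (\<phi> x))\<^sup>2)"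
    using K assms test_functions_measurable[OF assms(1)]
    by (subst lebesgue_on_eq_lborel(2)) (auto intro!: borel_measurable_power)
  then show ?thesis
    unfolding L2_def using test_functions_measurable[OF assms(1)]
    by (auto intro: measurable_lebesgue_on_borel)
qed

text \<open>By translation invariance each difference quotient of \<open>f\<close> in direction
  \<open>i\<close> integrates to zero, and the quotients converge dominatedly to the derivative.
  Applied to products, this gives the integration by parts for test functions.\<close>

lemma integral_partial_eq_0:
  fixes f :: "vec3 \<Rightarrow> 'b::euclidean_space"
  assumes diff: "\<And>x. f differentiable (at x)" and cont: "continuous_on UNIV (partial i f)"
    and K: "compact K" "\<And>x. x \<notin> K \<Longrightarrow> f x = 0"
  shows "integral\<^sup>L lborel (partial i f) = 0"
proof -
  define e :: vec3 where "e = axis i 1"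
  have pz: "partial i f x = 0" if "x \<notin> K" for x by (rule partial_zero_outside[OF K that])
  obtain B where B: "B > 0" "\<And>x. norm (partial i f x) \<le> B"
    using compact_support_bounded[OF cont K(1) pz] by blast
  have fc: "continuous_on UNIV f"
    using diff by (simp add: continuous_at_imp_continuous_on differentiable_imp_continuous_within)
  have fint: "integrable lborel f" by (rule integrable_compact_support[OF fc K])
  obtain r where r: "r > 0" "\<And>x. x \<in> K \<Longrightarrow> norm x \<le> r"
    using compact_imp_bounded[OF K(1)] bounded_pos by blast
  have fd: "(f has_derivative frechet_derivative f (at x)) (at x)" for x
    using diff frechet_derivative_works by blast
  have line: "((\<lambda>s. f (x + s *\<^sub>R e)) has_derivative (\<lambda>s. s *\<^sub>R partial i f (x + t *\<^sub>R e))) (at t within S)"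
    for x t S
  proof -
    have "((\<lambda>s. f (x + s *\<^sub>R e)) has_derivative
        (\<lambda>s. frechet_derivative f (at (x + t *\<^sub>R e)) (s *\<^sub>R e))) (at t within S)"
      by (rule has_derivative_compose[OF _ fd]) (auto intro!: derivative_eq_intros)
    moreover have "linear (frechet_derivative f (at y))" for y
      using fd has_derivative_linear by blast
    ultimately show ?thesis by (simp add: linear_scale e_def)
  qed
  define q where "q n x = (f (x + (1 / Suc n) *\<^sub>R e) - f x) /\<^sub>R (1 / Suc n)" for n :: nat and x
  have transl: "integral\<^sup>L lborel (\<lambda>x. f (x + c)) = integral\<^sup>L lborel f"
      "integrable lborel (\<lambda>x. f (x + c))" for c
  proof -
    have m: "f \<in> borel_measurable borel" using fc borel_measurable_continuous_onI by blast
    show "integral\<^sup>L lborel (\<lambda>x. f (x + c)) = integral\<^sup>L lborel f"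
      using integral_distr[of "(+) c" lborel borel f] m by (simp add: lborel_distr_plus add.commute)
    show "integrable lborel (\<lambda>x. f (x + c))"
      using integrable_distr_eq[of "(+) c" lborel borel f] m fint
      by (simp add: lborel_distr_plus add.commute)
  qed
  have "(\<lambda>n. integral\<^sup>L lborel (q n)) \<longlonglongrightarrow> integral\<^sup>L lborel (partial i f)"
  \<comment> \<open>The increments \<open>1 / Suc n\<close> are at most 1, so all quotients are
    supported in the ball of radius \<open>r + 1\<close>, and the mean value inequality bounds them
    there by \<open>B\<close>.\<close>
  proof (rule integral_dominated_convergence[where w = "\<lambda>x. B * indicator (cball 0 (r + 1)) x"])
    show "partial i f \<in> borel_measurable lborel"
      using cont borel_measurable_continuous_onI by auto
    show "q n \<in> borel_measurable lborel" for n
      unfolding q_def[abs_def] using fint transl(2) by (intro borel_measurable_integrable) auto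
    show "integrable lborel (\<lambda>x. B * indicator (cball 0 (r + 1) :: vec3 set) x)"
      using emeasure_compact_finite[of "cball 0 (r + 1) :: vec3 set"]
      by (auto intro!: integrable_mult_right integrable_real_indicator)
    show "AE x in lborel. (\<lambda>n. q n x) \<longlonglongrightarrow> partial i f x"
    proof (rule AE_I2)
      fix x
      have "((\<lambda>s. f (x + s *\<^sub>R e)) has_vector_derivative partial i f x) (at 0)"
        using line[of x 0] by (simp add: has_vector_derivative_def)
      then have "((\<lambda>h. norm (f (x + h *\<^sub>R e) - f x - h *\<^sub>R partial i f x) / norm h) \<longlongrightarrow> 0) (at 0)"
        by (simp add: has_vector_derivative_def has_derivative_at)
      moreover have "\<forall>\<^sub>F h in at 0. norm (f (x + h *\<^sub>R e) - f x - h *\<^sub>R partial i f x) / norm h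
          = norm ((f (x + h *\<^sub>R e) - f x) /\<^sub>R h - partial i f x)"
        using eventually_neq_at_within[of 0 0]
      proof eventually_elim
        case (elim h)
        then have "(f (x + h *\<^sub>R e) - f x) /\<^sub>R h - partial i f x
            = (f (x + h *\<^sub>R e) - f x - h *\<^sub>R partial i f x) /\<^sub>R h"
          by (simp add: scaleR_diff_right)
        then show ?case by (simp add: divide_inverse mult.commute)
      qed
      ultimately have "((\<lambda>h. norm ((f (x + h *\<^sub>R e) - f x) /\<^sub>R h - partial i f x)) \<longlongrightarrow> 0) (at 0)"
        by (rule Lim_transform_eventually)
      then have "((\<lambda>h. (f (x + h *\<^sub>R e) - f x) /\<^sub>R h) \<longlongrightarrow> partial i f x) (at 0)"
        by (simp add: tendsto_norm_zero_iff LIM_zero_iff)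
      moreover have "filterlim (\<lambda>n. 1 / real (Suc n)) (at 0) sequentially"
        using LIMSEQ_inverse_real_of_nat by (intro filterlim_atI) (auto simp: inverse_eq_divide)
      ultimately show "(\<lambda>n. q n x) \<longlonglongrightarrow> partial i f x"
        unfolding q_def by (rule filterlim_compose)
    qed
    fix n
    show "AE x in lborel. norm (q n x) \<le> B * indicator (cball 0 (r + 1)) x"
    proof (rule AE_I2)
      fix x :: vec3
      show "norm (q n x) \<le> B * indicator (cball 0 (r + 1)) x"
      proof (cases "x \<in> cball 0 (r + 1)")
        case True
        have "norm (f (x + (1 / Suc n) *\<^sub>R e) - f (x + 0 *\<^sub>R e)) \<le> B * norm (1 / real (Suc n) - 0)"
        proof (rule differentiable_bound[OF convex_UNIV line])
          show "onorm (\<lambda>s. s *\<^sub>R partial i f (x + t *\<^sub>R e)) \<le> B" for t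
            by (rule onorm_le) (simp add: mult.commute[of B] mult_left_mono B(2))
        qed auto
        then have "real (Suc n) * norm (f (x + (1 / Suc n) *\<^sub>R e) - f x) \<le> real (Suc n) * (B * (1 / Suc n))"
          by (intro mult_left_mono) auto
        then have "norm (q n x) \<le> B"
          by (simp add: q_def del: of_nat_Suc)
        then show ?thesis using True by simp
      next
        case False
        then have x: "norm x > r + 1" by simp
        have "norm ((1 / real (Suc n)) *\<^sub>R e) \<le> 1" by (simp add: e_def)
        then have "norm (x + (1 / real (Suc n)) *\<^sub>R e) > r"
          using x norm_triangle_ineq4[of "x + (1 / real (Suc n)) *\<^sub>R e" "(1 / real (Suc n)) *\<^sub>R e"]
          unfolding add_diff_cancel_right' by linarith
        then have "x + (1 / real (Suc n)) *\<^sub>R e \<notin> K" "x \<notin> K" using r x by force+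
        then show ?thesis using B(1) K(2) by (simp add: q_def)
      qed
    qed
  qed
  moreover have "integral\<^sup>L lborel (q n) = 0" for n
    unfolding q_def using transl fint by simp
  ultimately show ?thesis by (simp add: tendsto_const_iff)
qed

text \<open>The functions \<open>t\<^sup>-\<^sup>k exp (-1/t)\<close>, extended by zero to \<open>t \<le> 0\<close>, are closed under
  differentiation up to linear combinations.\<close>

definition flat :: "nat \<Rightarrow> real \<Rightarrow> real" where
  "flat k t = (if t > 0 then exp (- (1 / t)) * (1 / t) ^ k else 0)"

text \<open>Substituting the reciprocal of \<open>t\<close> turns the claim into the growth of exp
  beyond every power.\<close>

lemma flat_tendsto_0: "((\<lambda>t. flat k t) \<longlongrightarrow> 0) (at_right 0)"
proof -
  have "((\<lambda>x. x ^ k / exp x) \<longlongrightarrow> 0) (at_top :: real filter)" by (rule tendsto_power_div_exp_0)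
  then have "((\<lambda>x. flat k (inverse x)) \<longlongrightarrow> 0) at_top"
  proof (rule Lim_transform_eventually)
    show "\<forall>\<^sub>F x in at_top. x ^ k / exp x = flat k (inverse x)"
      using eventually_gt_at_top[of 0]
      by eventually_elim (simp add: flat_def exp_minus field_simps)
  qed
  then show ?thesis by (simp add: filterlim_at_right_to_top)
qed

lemma flat_has_derivative: "(flat k has_real_derivative flat (k + 2) t - real k * flat (k + 1) t) (at t)"
proof -
  consider "t < 0" | "t = 0" | "t > 0" by linarith
  then show ?thesis
  proof cases
    case 1
    have "((\<lambda>_. 0) has_real_derivative 0) (at t)" by simp
    then have "(flat k has_real_derivative 0) (at t)"
      by (rule has_field_derivative_transform_within_open[of _ _ _ "{..<0}"]) (use 1 in \<open>auto simp: flat_def\<close>)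
    then show ?thesis using 1 by (simp add: flat_def)
  next
    case 3
    have inv: "((\<lambda>t. 1 / t) has_real_derivative - ((1 / t)\<^sup>2)) (at t)"
      using 3 by (auto intro!: derivative_eq_intros simp: power2_eq_square)
    have D: "((\<lambda>t. exp (- (1 / t)) * (1 / t) ^ k) has_real_derivative
        exp (- (1 / t)) * - (- ((1 / t)\<^sup>2)) * (1 / t) ^ k
        + real k * (- ((1 / t)\<^sup>2) * (1 / t) ^ (k - Suc 0)) * exp (- (1 / t))) (at t)"
      by (intro DERIV_mult DERIV_power inv DERIV_fun_exp DERIV_minus)
    \<comment> \<open>For \<open>k = 0\<close> the truncated exponent \<open>k - Suc 0\<close> does
      no harm, because the factor \<open>real k\<close> vanishes.\<close>
    have eq: "real k * (- ((1 / t)\<^sup>2) * (1 / t) ^ (k - Suc 0)) = - (real k * (1 / t) ^ (k + 1))"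
      by (cases k) (simp_all add: power2_eq_square)
    have "((\<lambda>t. exp (- (1 / t)) * (1 / t) ^ k) has_real_derivative
        flat (k + 2) t - real k * flat (k + 1) t) (at t)"
      by (rule DERIV_cong[OF D], unfold eq) (use 3 in \<open>simp add: flat_def power_add power2_eq_square\<close>)
    then show ?thesis
      by (rule has_field_derivative_transform_within_open[of _ _ _ "{0<..}"]) (use 3 in \<open>auto simp: flat_def\<close>)
  next
    case 2
    \<comment> \<open>To the right of 0 the difference quotient of \<open>flat k\<close> is
      \<open>flat (k + 1)\<close> itself, so the previous limit gives the derivative at the
      junction.\<close>
    have r: "((\<lambda>h. flat k h / h) \<longlongrightarrow> 0) (at_right 0)"
      by (rule Lim_transform_eventually[OF flat_tendsto_0[of "k + 1"]])
        (auto simp: eventually_at_right_less flat_def eventually_at_filter)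
    have l: "((\<lambda>h. flat k h / h) \<longlongrightarrow> 0) (at_left 0)"
      by (rule Lim_transform_eventually[OF tendsto_const])
        (auto simp: flat_def eventually_at_filter)
    have "((\<lambda>h. flat k h / h) \<longlongrightarrow> 0) (at 0)"
      using l r by (simp add: filterlim_split_at)
    then show ?thesis
      using 2 by (simp add: has_field_derivative_iff flat_def)
  qed
qed

text \<open>Designed to contain the bumps below and to be closed under partial derivatives: the
  amplitude \<open>a\<close> and the affine substitution in the base case absorb the factors of the
  chain rule, and products are there for the product over coordinates.\<close>

inductive_set flat_algebra :: "(vec3 \<Rightarrow> real) set" where
  base: "(\<lambda>x. a * flat k (c * x $ i + d)) \<in> flat_algebra"
| add: "f \<in> flat_algebra \<Longrightarrow> g \<in> flat_algebra \<Longrightarrow> (\<lambda>x. f x + g x) \<in> flat_algebra"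
| mult: "f \<in> flat_algebra \<Longrightarrow> g \<in> flat_algebra \<Longrightarrow> (\<lambda>x. f x * g x) \<in> flat_algebra"

lemma flat_algebra_derivative:
  assumes "f \<in> flat_algebra"
  obtains f' where "\<And>x. (f has_derivative f' x) (at x)"
    "\<And>i. (\<lambda>x. f' x (axis i 1)) \<in> flat_algebra"
  using assms
proof (induction arbitrary: thesis)
  case (base a k c i d)
  define f' where "f' x h = a * (c * h $ i * (flat (k + 2) (c * x $ i + d) - real k * flat (k + 1) (c * x $ i + d)))"
    for x h :: vec3
  show ?case
  proof (rule base)
    show "((\<lambda>x. a * flat k (c * x $ i + d)) has_derivative f' x) (at x)" for x
      unfolding f'_def
      by (intro has_derivative_mult_right DERIV_compose_FDERIV[OF flat_has_derivative])
        (auto intro!: derivative_eq_intros bounded_linear.has_derivative[OF bounded_linear_vec_nth])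
    fix j
    have "(\<lambda>x. f' x (axis j 1)) = (\<lambda>x. (a * c * axis j 1 $ i) * flat (k + 2) (c * x $ i + d)
        + (- a * c * axis j 1 $ i * real k) * flat (k + 1) (c * x $ i + d))"
      by (auto simp: f'_def fun_eq_iff algebra_simps)
    also have "\<dots> \<in> flat_algebra" by (intro flat_algebra.intros)
    finally show "(\<lambda>x. f' x (axis j 1)) \<in> flat_algebra" .
  qed
next
  case (add f g)
  from add.IH obtain f' g' where
    "\<And>x. (f has_derivative f' x) (at x)" "\<And>i. (\<lambda>x. f' x (axis i 1)) \<in> flat_algebra"
    "\<And>x. (g has_derivative g' x) (at x)" "\<And>i. (\<lambda>x. g' x (axis i 1)) \<in> flat_algebra" by metis
  then show ?case
    by (intro add.prems[of "\<lambda>x h. f' x h + g' x h"] has_derivative_add flat_algebra.intros) auto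
next
  case (mult f g)
  from mult.IH obtain f' g' where
    "\<And>x. (f has_derivative f' x) (at x)" "\<And>i. (\<lambda>x. f' x (axis i 1)) \<in> flat_algebra"
    "\<And>x. (g has_derivative g' x) (at x)" "\<And>i. (\<lambda>x. g' x (axis i 1)) \<in> flat_algebra" by metis
  then show ?case
    using mult.hyps
    by (intro mult.prems[of "\<lambda>x h. f x * g' x h + f' x h * g x"] has_derivative_mult flat_algebra.intros) auto
qed

lemma flat_algebra_smooth:
  assumes "f \<in> flat_algebra"
  shows "Ck_on k UNIV f"
proof (rule smooth_coinduct[OF _ _ assms])
  fix f i assume "f \<in> flat_algebra"
  then obtain f' where f': "\<And>x. (f has_derivative f' x) (at x)"
    "\<And>i. (\<lambda>x. f' x (axis i 1)) \<in> flat_algebra"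
    by (rule flat_algebra_derivative) blast
  show "f differentiable_on UNIV" by (rule has_derivative_imp_differentiable_on_UNIV[OF f'(1)])
  show "partial i f \<in> flat_algebra"
    unfolding has_derivative_imp_partial[OF f'(1)] by (rule f'(2))
qed

lemma flat_algebra_prod:
  "finite I \<Longrightarrow> I \<noteq> {} \<Longrightarrow> (\<And>i. i \<in> I \<Longrightarrow> f i \<in> flat_algebra) \<Longrightarrow> (\<lambda>x. \<Prod>i\<in>I. f i x) \<in> flat_algebra"
  by (induction I rule: finite_ne_induct) (auto intro: flat_algebra.mult)

section \<open>Smooth approximation of indicators of boxes\<close>

lemma flat_0_bounds: "0 \<le> flat 0 t" "flat 0 t \<le> 1"
  by (auto simp: flat_def)

text \<open>Each factor is exp(-1/s) with s proportional to \<open>Suc n\<close>. It grows to 1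
  strictly inside the slab and is 0 outside, so the bumps approach the indicator of the open box
  from below.\<close>

definition bump :: "vec3 \<Rightarrow> vec3 \<Rightarrow> nat \<Rightarrow> vec3 \<Rightarrow> real" where
  "bump a b n x = (\<Prod>i\<in>UNIV. flat 0 (real (Suc n) * (x $ i - a $ i)) * flat 0 (real (Suc n) * (b $ i - x $ i)))"

lemma bump_outside: "x \<notin> box a b \<Longrightarrow> bump a b n x = 0"
proof -
  assume "x \<notin> box a b"
  then obtain i where "x $ i \<le> a $ i \<or> b $ i \<le> x $ i" by (auto simp: mem_box_cart not_less)
  then have "flat 0 (real (Suc n) * (x $ i - a $ i)) * flat 0 (real (Suc n) * (b $ i - x $ i)) = 0"
    by (auto simp: flat_def zero_less_mult_iff)
  then show ?thesis unfolding bump_def by (intro prod_zero) auto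
qed

lemma bump_test_function:
  assumes "cbox a b \<subseteq> \<Omega>"
  shows "bump a b n \<in> test_functions \<Omega>"
proof -
  have "(\<lambda>x. flat 0 (real (Suc n) * (x $ i - a $ i))) \<in> flat_algebra" for i
    using flat_algebra.base[of 1 0 "real (Suc n)" i "- real (Suc n) * a $ i"]
    by (simp add: algebra_simps del: of_nat_Suc)
  moreover have "(\<lambda>x. flat 0 (real (Suc n) * (b $ i - x $ i))) \<in> flat_algebra" for i
    using flat_algebra.base[of 1 0 "- real (Suc n)" i "real (Suc n) * b $ i"]
    by (simp add: algebra_simps del: of_nat_Suc)
  ultimately have "bump a b n \<in> flat_algebra"
    unfolding bump_def[abs_def] by (intro flat_algebra_prod flat_algebra.mult) auto
  then have "Ck_on k UNIV (bump a b n)" for k by (rule flat_algebra_smooth)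
  moreover have "bump a b n x = 0" if "x \<notin> cbox a b" for x
    using that box_subset_cbox[of a b] by (intro bump_outside) blast
  ultimately show ?thesis
    unfolding test_functions_def using assms by (auto intro!: exI[of _ "cbox a b"])
qed

lemma bump_bounds: "0 \<le> bump a b n x" "bump a b n x \<le> indicator (box a b) x"
proof -
  have n: "0 \<le> bump a b n x" for x unfolding bump_def by (intro prod_nonneg) (simp add: flat_0_bounds)
  show "0 \<le> bump a b n x" by (rule n)
  have "bump a b n x \<le> 1"
    unfolding bump_def by (intro prod_le_1) (auto simp: flat_0_bounds intro!: mult_le_one)
  then show "bump a b n x \<le> indicator (box a b) x"
    using bump_outside[of x a b n] by (auto simp: indicator_def)
qed

lemma bump_tendsto: "(\<lambda>n. bump a b n x) \<longlonglongrightarrow> indicator (box a b) x"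
proof (cases "x \<in> box a b")
  case True
  have lim: "(\<lambda>n. flat 0 (real (Suc n) * s)) \<longlonglongrightarrow> 1" if "s > 0" for s
  proof -
    have "(\<lambda>n. exp (- (inverse (real (Suc n)) * (1 / s)))) \<longlonglongrightarrow> exp (- (0 * (1 / s)))"
      by (intro tendsto_intros LIMSEQ_inverse_real_of_nat)
    moreover have "flat 0 (real (Suc n) * s) = exp (- (inverse (real (Suc n)) * (1 / s)))" for n
      using that by (simp add: flat_def field_simps del: of_nat_Suc)
    ultimately show ?thesis by simp
  qed
  have "(\<lambda>n. bump a b n x) \<longlonglongrightarrow> (\<Prod>i\<in>(UNIV :: 3 set). 1 * 1)"
    unfolding bump_def using True by (intro tendsto_prod tendsto_mult lim) (auto simp: mem_box_cart)
  then show ?thesis using True by simp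
qed (simp add: bump_outside)


section \<open>The fundamental lemma of the calculus of variations\<close>

text \<open>Pointwise the norm of \<open>f x\<close> is at most 1 plus its square, and the constant
  1 is integrable over a set of finite measure.\<close>

lemma L2_integrable_lmeasurable:
  fixes f :: "vec3 \<Rightarrow> 'b::euclidean_space"
  assumes "f \<in> L2 \<Omega>" "A \<in> lmeasurable" "\<Omega> \<in> sets lebesgue"
  shows "integrable (lebesgue_on \<Omega>) (\<lambda>x. indicator A x *\<^sub>R f x)"
proof (rule Bochner_Integration.integrable_bound)
  have "integrable lebesgue (\<lambda>x. indicator (A \<inter> \<Omega>) x :: real)"
    using assms by (simp add: fmeasurable_Int_fmeasurable flip: lmeasurable_iff_integrable)
  then have "integrable (lebesgue_on \<Omega>) (indicator A :: vec3 \<Rightarrow> real)"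
    using assms by (subst integrable_restrict_space) (auto simp: indicator_inter_arith mult.commute)
  then show "integrable (lebesgue_on \<Omega>) (\<lambda>x. indicator A x + (norm (f x))\<^sup>2)"
    using L2_integrable[OF assms(1)] by simp
  have "norm (f x) \<le> 1 + (norm (f x))\<^sup>2" for x
    using zero_le_power2[of "norm (f x) - 1"] norm_ge_zero[of "f x"] unfolding power2_diff power_one mult_1_right
    by linarith
  then show "AE x in lebesgue_on \<Omega>. norm (indicator A x *\<^sub>R f x) \<le> norm (indicator A x + (norm (f x))\<^sup>2)"
    by (auto simp: indicator_def)
  show "(\<lambda>x. indicator A x *\<^sub>R f x) \<in> borel_measurable (lebesgue_on \<Omega>)"
    using assms by (intro borel_measurable_scaleR L2_measurable borel_measurable_indicator'
        measurable_restrict_space1) auto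
qed

text \<open>Bumps show that \<open>g\<close> integrates to zero over boxes, a Dynkin argument
  extends this to measurable subsets of a box, and countably many boxes exhaust the domain. The
  lemma makes weak derivatives unique almost everywhere.\<close>

lemma fundamental_lemma:
  fixes g :: "vec3 \<Rightarrow> 'b::euclidean_space"
  assumes "open \<Omega>" and g: "g \<in> L2 \<Omega>"
    and orth: "\<And>\<phi> :: vec3 \<Rightarrow> real. \<phi> \<in> test_functions \<Omega> \<Longrightarrow> (LINT x|lebesgue_on \<Omega>. \<phi> x *\<^sub>R g x) = 0"
  shows "AE x in lebesgue_on \<Omega>. g x = 0"
proof -
  have O: "\<Omega> \<in> sets lebesgue" using assms(1) by simp
  have box0: "(LINT x|lebesgue_on \<Omega>. indicator (box a b) x *\<^sub>R g x) = 0" if ab: "cbox a b \<subseteq> \<Omega>" for a b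
  proof -
    have int: "integrable (lebesgue_on \<Omega>) (\<lambda>x. indicator (box a b) x *\<^sub>R g x)"
      by (rule L2_integrable_lmeasurable[OF g _ O]) simp
    have "(\<lambda>n. LINT x|lebesgue_on \<Omega>. bump a b n x *\<^sub>R g x)
        \<longlonglongrightarrow> (LINT x|lebesgue_on \<Omega>. indicator (box a b) x *\<^sub>R g x)"
    proof (rule integral_dominated_convergence[where w = "\<lambda>x. norm (indicator (box a b) x *\<^sub>R g x)"])
      show "(\<lambda>x. indicator (box a b) x *\<^sub>R g x) \<in> borel_measurable (lebesgue_on \<Omega>)"
        "integrable (lebesgue_on \<Omega>) (\<lambda>x. norm (indicator (box a b) x *\<^sub>R g x))"
        using borel_measurable_integrable[OF int] integrable_norm[OF int] by blast+
      show "(\<lambda>x. bump a b n x *\<^sub>R g x) \<in> borel_measurable (lebesgue_on \<Omega>)" for n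
        by (intro borel_measurable_scaleR[OF measurable_lebesgue_on_borel L2_measurable[OF g]]
            test_functions_measurable[OF bump_test_function[OF ab]])
      show "AE x in lebesgue_on \<Omega>. (\<lambda>n. bump a b n x *\<^sub>R g x) \<longlonglongrightarrow> indicator (box a b) x *\<^sub>R g x"
        by (intro AE_I2 tendsto_intros bump_tendsto)
      show "AE x in lebesgue_on \<Omega>. norm (bump a b n x *\<^sub>R g x) \<le> norm (indicator (box a b) x *\<^sub>R g x)" for n
        using bump_bounds by (auto intro!: AE_I2 mult_right_mono)
    qed
    then show ?thesis using orth[OF bump_test_function[OF ab]] by (simp add: tendsto_const_iff)
  qed
  have AE_box: "AE x in lebesgue_on (box a b). g x = 0" if ab: "cbox a b \<subseteq> \<Omega>" for a b
  proof -
    let ?M = "lebesgue_on (box a b)"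
    have sub: "box a b \<subseteq> \<Omega>" using ab box_subset_cbox by blast
    have transfer: "(LINT x|?M. f x) = (LINT x|lebesgue_on \<Omega>. indicator (box a b) x *\<^sub>R f x)"
      "integrable ?M f \<longleftrightarrow> integrable (lebesgue_on \<Omega>) (\<lambda>x. indicator (box a b) x *\<^sub>R f x)"
      for f :: "vec3 \<Rightarrow> 'b"
    proof -
      have eq: "(\<lambda>x. indicator \<Omega> x *\<^sub>R indicator (box a b) x *\<^sub>R f x) = (\<lambda>x. indicator (box a b) x *\<^sub>R f x)"
        using sub by (intro ext) (auto simp: indicator_def)
      have sets: "box a b \<inter> space lebesgue \<in> sets lebesgue" "\<Omega> \<inter> space lebesgue \<in> sets lebesgue"
        using O by auto
      show "(LINT x|?M. f x) = (LINT x|lebesgue_on \<Omega>. indicator (box a b) x *\<^sub>R f x)"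
        "integrable ?M f \<longleftrightarrow> integrable (lebesgue_on \<Omega>) (\<lambda>x. indicator (box a b) x *\<^sub>R f x)"
        unfolding sets[THEN integral_restrict_space] sets[THEN integrable_restrict_space] eq by (rule refl)+
    qed
    have int: "integrable ?M g"
      unfolding transfer by (rule L2_integrable_lmeasurable[OF g _ O]) simp
    interpret finite_measure ?M by (rule finite_measure_lebesgue_on) simp
    have setb: "A \<inter> box a b \<in> sets ?M" if "A \<in> sets borel" for A
      using that by (auto simp: sets_restrict_space_iff)
    have intb: "set_integrable ?M (A \<inter> box a b) g" if "A \<in> sets borel" for A
      unfolding set_integrable_def by (rule integrable_mult_indicator[OF setb[OF that] int])
    have UNIV0: "(LINT x|?M. g x) = 0" unfolding transfer by (rule box0[OF ab])
    \<comment> \<open>Boxes form an intersection-stable generator of the Borel sets. Passing to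
      complements works because the integral over the whole box vanishes too
      (\<open>UNIV0\<close>).\<close>
    have borel0: "set_lebesgue_integral ?M (A \<inter> box a b) g = 0" if "A \<in> sets borel" for A
    proof (rule sigma_sets_induct_disjoint[where G = "range (\<lambda>(a, b). box a b)" and \<Omega> = UNIV and A = A])
      show "A \<in> sigma_sets UNIV (range (\<lambda>(a, b). box a b))"
        using that by (simp add: borel_eq_box)
      show "Int_stable (range (\<lambda>(a, b). box a b :: vec3 set))"
        by (auto simp: Int_stable_def box_Int_box)
      have ss: "sigma_sets UNIV (range (\<lambda>(a, b). box a b :: vec3 set)) = sets borel"
        by (simp add: borel_eq_box)
      show "set_lebesgue_integral ?M (B \<inter> box a b) g = 0"
        if B: "B \<in> range (\<lambda>(a, b). box a b)" for B
      proof -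
        obtain c d where B: "B = box c d" using B by auto
        define p where "p = (\<Sum>i\<in>Basis. max (c \<bullet> i) (a \<bullet> i) *\<^sub>R i)"
        define q where "q = (\<Sum>i\<in>Basis. min (d \<bullet> i) (b \<bullet> i) *\<^sub>R i)"
        have pq: "B \<inter> box a b = box p q" "cbox c d \<inter> cbox a b = cbox p q"
          unfolding B p_def q_def by (rule box_Int_box, rule Int_interval)
        have "set_lebesgue_integral ?M (B \<inter> box a b) g
            = (LINT x|lebesgue_on \<Omega>. indicator (box a b) x *\<^sub>R indicator (box p q) x *\<^sub>R g x)"
          unfolding set_lebesgue_integral_def transfer pq ..
        also have "(\<lambda>x. indicator (box a b) x *\<^sub>R indicator (box p q) x *\<^sub>R g x) = (\<lambda>x. indicator (box p q) x *\<^sub>R g x)"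
          unfolding pq(1)[symmetric] by (auto simp: indicator_def)
        also have "(LINT x|lebesgue_on \<Omega>. indicator (box p q) x *\<^sub>R g x) = 0"
          using pq(2) ab by (intro box0) blast
        finally show ?thesis .
      qed
      show "set_lebesgue_integral ?M ({} \<inter> box a b) g = 0" by (simp add: set_lebesgue_integral_def)
      show "set_lebesgue_integral ?M ((UNIV - B) \<inter> box a b) g = 0"
        if B: "B \<in> sigma_sets UNIV (range (\<lambda>(a, b). box a b))" "set_lebesgue_integral ?M (B \<inter> box a b) g = 0" for B
      proof -
        have "set_lebesgue_integral ?M ((UNIV - B) \<inter> box a b) g
            = (LINT x|?M. g x - indicator (B \<inter> box a b) x *\<^sub>R g x)"
          unfolding set_lebesgue_integral_def
          by (rule Bochner_Integration.integral_cong) (auto simp: indicator_def)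
        also have "\<dots> = (LINT x|?M. g x) - set_lebesgue_integral ?M (B \<inter> box a b) g"
          using int intb[of B] B(1) unfolding ss set_lebesgue_integral_def set_integrable_def by simp
        finally show ?thesis using UNIV0 B(2) by simp
      qed
      show "set_lebesgue_integral ?M (\<Union> (range B) \<inter> box a b) g = 0"
        if B: "disjoint_family B" "range B \<subseteq> sigma_sets UNIV (range (\<lambda>(a, b). box a b))"
          "\<And>i. set_lebesgue_integral ?M (B i \<inter> box a b) g = 0" for B :: "nat \<Rightarrow> vec3 set"
      proof -
        have Bb: "B i \<in> sets borel" for i using B(2) unfolding ss by blast
        have "set_lebesgue_integral ?M (\<Union>i. B i \<inter> box a b) g
            = (\<Sum>i. set_lebesgue_integral ?M (B i \<inter> box a b) g)"
        proof (rule lebesgue_integral_countable_add)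
          show "set_integrable ?M (\<Union>i. B i \<inter> box a b) g"
            using intb[of "\<Union>i. B i"] Bb by simp
          show "(B i \<inter> box a b) \<inter> (B j \<inter> box a b) = {}" if "i \<noteq> j" for i j
            using B(1) that by (auto simp: disjoint_family_on_def)
        qed (rule setb[OF Bb])
        then show ?thesis using B(3) by simp
      qed
    qed auto
    show ?thesis
    proof (rule density_zero[OF int])
      \<comment> \<open>\<open>density_zero\<close> asks for all Lebesgue measurable sets; each of
        them differs from a Borel set by a null set.\<close>
      fix A assume "A \<in> sets ?M"
      then have A: "A \<in> sets lebesgue" "A \<subseteq> box a b" by (auto simp: sets_restrict_space_iff)
      obtain S N N' where N: "A = S \<union> N" "N \<subseteq> N'" "N' \<in> null_sets lborel" "S \<in> sets lborel"
        by (rule sets_completionE[OF A(1)])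
      have "AE x in lebesgue. x \<notin> N'"
        using N(3) by (intro AE_not_in) (simp add: null_sets_completionI)
      then have "AE x in ?M. x \<notin> N'"
        by (subst AE_restrict_space_iff) auto
      then have "AE x in ?M. indicator A x *\<^sub>R g x = indicator (S \<inter> box a b) x *\<^sub>R g x"
        by eventually_elim (use N A in \<open>auto simp: indicator_def\<close>)
      then have "set_lebesgue_integral ?M A g = set_lebesgue_integral ?M (S \<inter> box a b) g"
        unfolding set_lebesgue_integral_def
      proof (rule integral_cong_AE[rotated 2])
        show "(\<lambda>x. indicator A x *\<^sub>R g x) \<in> borel_measurable ?M"
          using int \<open>A \<in> sets ?M\<close> by (intro borel_measurable_scaleR borel_measurable_indicator) auto
        show "(\<lambda>x. indicator (S \<inter> box a b) x *\<^sub>R g x) \<in> borel_measurable ?M"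
          using int setb[of S] N(4) by (intro borel_measurable_scaleR borel_measurable_indicator) auto
      qed
      then show "set_lebesgue_integral ?M A g = 0" using borel0[of S] N(4) by simp
    qed
  qed
  define F where "F = {box a b :: vec3 set | a b. cbox a b \<subseteq> \<Omega>}"
  \<comment> \<open>A countable subcover is required so that the exceptional null sets of the single
    boxes have a null union.\<close>
  obtain F' where F': "F' \<subseteq> F" "countable F'" "\<Union>F' = \<Union>F"
    by (rule Lindelof[of F]) (auto simp: F_def)
  have cover: "\<Omega> \<subseteq> \<Union>F"
  proof
    fix x assume "x \<in> \<Omega>"
    then obtain a b where "cbox a b \<subseteq> \<Omega>" "x \<in> box a b"
      using open_contains_cbox[OF assms(1)] by metis
    then show "x \<in> \<Union>F" by (auto simp: F_def)
  qed
  have "AE x in lebesgue. x \<in> B \<longrightarrow> g x = 0" if "B \<in> F'" for B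
    using that F'(1) AE_box by (auto simp: F_def AE_restrict_space_iff)
  then have "AE x in lebesgue. \<forall>B\<in>F'. x \<in> B \<longrightarrow> g x = 0"
    unfolding AE_ball_countable[OF F'(2)] by blast
  then have "AE x in lebesgue. x \<in> \<Omega> \<longrightarrow> g x = 0"
    by eventually_elim (use cover F'(3) in blast)
  then show ?thesis using O by (simp add: AE_restrict_space_iff)
qed


section \<open>Weak derivatives\<close>

lemma L2_scaleR_integrable:
  fixes \<phi> :: "vec3 \<Rightarrow> real" and g :: "vec3 \<Rightarrow> 'b::euclidean_space"
  assumes "\<phi> \<in> L2 \<Omega>" "g \<in> L2 \<Omega>"
  shows "integrable (lebesgue_on \<Omega>) (\<lambda>x. \<phi> x *\<^sub>R g x)"
proof (rule Bochner_Integration.integrable_bound)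
  have "(\<lambda>x. norm (g x)) \<in> L2 \<Omega>"
    using assms(2) by (auto simp: L2_def)
  then show "integrable (lebesgue_on \<Omega>) (\<lambda>x. \<phi> x * norm (g x))"
    using L2_inner_integrable[OF assms(1)] by auto
qed (use assms in \<open>auto simp: abs_mult intro!: borel_measurable_scaleR dest: L2_measurable\<close>)

lemma L2_linear_image:
  fixes u :: "vec3 \<Rightarrow> 'b::euclidean_space" and L :: "'b \<Rightarrow> 'c::euclidean_space"
  assumes L: "bounded_linear L" and u: "u \<in> L2 \<Omega>"
  shows "(\<lambda>x. L (u x)) \<in> L2 \<Omega>"
proof -
  interpret bounded_linear L by fact
  obtain K where K: "\<And>x. norm (L x) \<le> norm x * K" using bounded by blast
  show ?thesis
  proof (rule L2_I_bound)
    show "(\<lambda>x. L (u x)) \<in> borel_measurable (lebesgue_on \<Omega>)"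
      by (rule borel_measurable_continuous_on[OF linear_continuous_on[OF L] L2_measurable[OF u]])
    show "integrable (lebesgue_on \<Omega>) (\<lambda>x. K\<^sup>2 * (norm (u x))\<^sup>2)"
      using L2_integrable[OF u] by simp
    show "(norm (L (u x)))\<^sup>2 \<le> K\<^sup>2 * (norm (u x))\<^sup>2" for x
      using power_mono[OF K norm_ge_zero, of "u x" 2] by (simp add: power_mult_distrib mult.commute)
  qed
qed

text \<open>Writes the Jacobian matrix as a sum of linear images of the partial derivatives
  (\<open>wgrad_eq_sum\<close>), so that its square integrability follows from that of the partial
  derivatives.\<close>

definition column_matrix :: "3 \<Rightarrow> vec3 \<Rightarrow> real ^ 3 ^ 3" where
  "column_matrix i y = (\<chi> k j. if j = i then y $ k else 0)"

lemma bounded_linear_column_matrix: "bounded_linear (column_matrix i)"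
proof (intro linear_conv_bounded_linear[THEN iffD1] linearI)
qed (auto simp: column_matrix_def vec_eq_iff)

lemma wgrad_eq_sum: "wgrad \<Omega> u x = (\<Sum>i\<in>UNIV. column_matrix i (wpartial \<Omega> i u x))"
  by (simp add: vec_eq_iff wgrad_def column_matrix_def)

lemma matrix_inner_eq_sum:
  "(\<chi> k i. a i $ k :: real ^ 3 ^ 3) \<bullet> (\<chi> k i. b i $ k) = (\<Sum>i\<in>UNIV. a i \<bullet> b i)"
  unfolding inner_vec_def by (simp, rule sum.swap)

lemma inner_wgrad:
  "wgrad \<Omega> u x \<bullet> wgrad \<Omega> v x = (\<Sum>i\<in>UNIV. wpartial \<Omega> i u x \<bullet> wpartial \<Omega> i v x)"
  unfolding wgrad_def by (rule matrix_inner_eq_sum)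

locale open_domain =
  fixes \<Omega> :: "vec3 set"
  assumes open_domain: "open \<Omega>"
begin

lemma lebesgue_sets [simp]: "\<Omega> \<in> sets lebesgue"
  using open_domain by simp

lemma test_L2: "\<phi> \<in> test_functions \<Omega> \<Longrightarrow> \<phi> \<in> L2 \<Omega>"
  by (rule test_functions_L2) auto

text \<open>Makes the choice in \<open>wpartial\<close> harmless: whatever derivative can be
  exhibited agrees with the chosen one almost everywhere.\<close>

lemma weak_deriv_unique:
  assumes "weak_deriv \<Omega> i u g" "weak_deriv \<Omega> i u g'"
  shows "AE x in lebesgue_on \<Omega>. g x = g' x"
proof -
  have g: "g \<in> L2 \<Omega>" "g' \<in> L2 \<Omega>" using assms by (auto simp: weak_deriv_def)
  have "AE x in lebesgue_on \<Omega>. g x - g' x = 0"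
  proof (rule fundamental_lemma[OF open_domain])
    fix \<phi> :: "vec3 \<Rightarrow> real" assume \<phi>: "\<phi> \<in> test_functions \<Omega>"
    have "- (LINT x|lebesgue_on \<Omega>. \<phi> x *\<^sub>R g x) = - (LINT x|lebesgue_on \<Omega>. \<phi> x *\<^sub>R g' x)"
      using assms \<phi> unfolding weak_deriv_def by simp
    then show "(LINT x|lebesgue_on \<Omega>. \<phi> x *\<^sub>R (g x - g' x)) = 0"
      using Bochner_Integration.integral_diff[OF g[THEN L2_scaleR_integrable[OF test_L2[OF \<phi>]]]]
      by (simp add: scaleR_diff_right)
  qed (use g in \<open>auto intro: L2_intros\<close>)
  then show ?thesis by simp
qed

lemma weak_deriv_add:
  assumes u: "weak_deriv \<Omega> i u g" and v: "weak_deriv \<Omega> i v h"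
  shows "weak_deriv \<Omega> i (\<lambda>x. u x + v x) (\<lambda>x. g x + h x)"
  unfolding weak_deriv_def
proof (intro conjI ballI)
  have L: "u \<in> L2 \<Omega>" "g \<in> L2 \<Omega>" "v \<in> L2 \<Omega>" "h \<in> L2 \<Omega>"
    using assms by (auto simp: weak_deriv_def)
  then show "(\<lambda>x. u x + v x) \<in> L2 \<Omega>" "(\<lambda>x. g x + h x) \<in> L2 \<Omega>" by (auto intro: L2_add)
  fix \<phi> :: "vec3 \<Rightarrow> real" assume \<phi>: "\<phi> \<in> test_functions \<Omega>"
  note int = L[THEN L2_scaleR_integrable[OF test_L2[OF \<phi>]]]
    L[THEN L2_scaleR_integrable[OF test_L2[OF test_functions_partial[OF \<phi>, of i]]]]
  have "(LINT x|lebesgue_on \<Omega>. partial i \<phi> x *\<^sub>R u x) = - (LINT x|lebesgue_on \<Omega>. \<phi> x *\<^sub>R g x)"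
    "(LINT x|lebesgue_on \<Omega>. partial i \<phi> x *\<^sub>R v x) = - (LINT x|lebesgue_on \<Omega>. \<phi> x *\<^sub>R h x)"
    using u v \<phi> by (auto simp: weak_deriv_def)
  then show "(LINT x|lebesgue_on \<Omega>. partial i \<phi> x *\<^sub>R (u x + v x)) = - (LINT x|lebesgue_on \<Omega>. \<phi> x *\<^sub>R (g x + h x))"
    using int by (simp add: scaleR_add_right)
qed

lemma weak_deriv_scaleR:
  assumes "weak_deriv \<Omega> i u g"
  shows "weak_deriv \<Omega> i (\<lambda>x. c *\<^sub>R u x) (\<lambda>x. c *\<^sub>R g x)"
  unfolding weak_deriv_def
proof (intro conjI ballI)
  show "(\<lambda>x. c *\<^sub>R u x) \<in> L2 \<Omega>" "(\<lambda>x. c *\<^sub>R g x) \<in> L2 \<Omega>"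
    using assms by (auto simp: weak_deriv_def intro: L2_scaleR)
  fix \<phi> :: "vec3 \<Rightarrow> real" assume "\<phi> \<in> test_functions \<Omega>"
  then have "(LINT x|lebesgue_on \<Omega>. partial i \<phi> x *\<^sub>R u x) = - (LINT x|lebesgue_on \<Omega>. \<phi> x *\<^sub>R g x)"
    using assms by (auto simp: weak_deriv_def)
  then have "(LINT x|lebesgue_on \<Omega>. c *\<^sub>R partial i \<phi> x *\<^sub>R u x) = - (LINT x|lebesgue_on \<Omega>. c *\<^sub>R \<phi> x *\<^sub>R g x)"
    unfolding integral_scaleR_right by simp
  then show "(LINT x|lebesgue_on \<Omega>. partial i \<phi> x *\<^sub>R c *\<^sub>R u x) = - (LINT x|lebesgue_on \<Omega>. \<phi> x *\<^sub>R c *\<^sub>R g x)"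
    by (subst (1 2) scaleR_left_commute)
qed

text \<open>The product of the two test functions has compact support, so its partial derivative
  integrates to zero, and the product rule splits that integral into the two required terms.\<close>

lemma weak_deriv_test:
  assumes "\<phi> \<in> test_functions \<Omega>"
  shows "weak_deriv \<Omega> i \<phi> (partial i \<phi>)"
  unfolding weak_deriv_def
proof (intro conjI ballI)
  show "\<phi> \<in> L2 \<Omega>" "partial i \<phi> \<in> L2 \<Omega>"
    using assms test_functions_partial[OF assms, of i] by (auto intro: test_L2)
  fix \<psi> :: "vec3 \<Rightarrow> real" assume \<psi>: "\<psi> \<in> test_functions \<Omega>"
  obtain K where K: "compact K" "\<And>x. x \<notin> K \<Longrightarrow> \<phi> x = 0"
    by (rule test_functionsE[OF assms]) blast
  define f where "f = (\<lambda>x. \<psi> x *\<^sub>R \<phi> x)"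
  have D: "(f has_derivative (\<lambda>h. \<psi> x *\<^sub>R frechet_derivative \<phi> (at x) h
      + frechet_derivative \<psi> (at x) h *\<^sub>R \<phi> x)) (at x)" for x
    unfolding f_def
    by (rule has_derivative_scaleR)
      (use smooth_has_derivative[OF test_functions_smooth[OF assms]]
        smooth_has_derivative[OF test_functions_smooth[OF \<psi>]] in auto)
  have pf: "partial i f = (\<lambda>x. \<psi> x *\<^sub>R partial i \<phi> x + partial i \<psi> x *\<^sub>R \<phi> x)"
    by (rule has_derivative_imp_partial[OF D])
  have cont: "continuous_on UNIV \<phi>" "continuous_on UNIV \<psi>"
      "continuous_on UNIV (partial i \<phi>)" "continuous_on UNIV (partial i \<psi>)"
    using assms \<psi> by (auto intro!: smooth_continuous_on test_functions_smooth test_functions_partial)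
  have "integral\<^sup>L lborel (partial i f) = 0"
  proof (rule integral_partial_eq_0[OF _ _ K(1)])
    show "f differentiable (at x)" for x using D by (auto simp: differentiable_def)
    show "continuous_on UNIV (partial i f)"
      unfolding pf by (intro continuous_intros cont)
    show "f x = 0" if "x \<notin> K" for x using K(2)[OF that] by (simp add: f_def)
  qed
  moreover have "integral\<^sup>L (lebesgue_on \<Omega>) (partial i f) = integral\<^sup>L lborel (partial i f)"
  proof (rule lebesgue_on_eq_lborel(1))
    show "partial i f \<in> borel_measurable borel"
      unfolding pf by (intro borel_measurable_continuous_onI continuous_intros cont)
    show "partial i f x = 0" if "x \<notin> \<Omega>" for x
      using that test_functions_zero_outside[OF assms]
        test_functions_zero_outside[OF test_functions_partial[OF assms, of i]]
      unfolding fun_cong[OF pf] by simp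
  qed simp
  ultimately have "(LINT x|lebesgue_on \<Omega>. \<psi> x *\<^sub>R partial i \<phi> x + partial i \<psi> x *\<^sub>R \<phi> x) = 0"
    by (simp add: pf)
  moreover have "integrable (lebesgue_on \<Omega>) (\<lambda>x. \<psi> x *\<^sub>R partial i \<phi> x)"
    "integrable (lebesgue_on \<Omega>) (\<lambda>x. partial i \<psi> x *\<^sub>R \<phi> x)"
    using assms \<psi> test_functions_partial[OF assms, of i] test_functions_partial[OF \<psi>, of i]
    by (auto intro!: L2_scaleR_integrable test_L2)
  ultimately show "(LINT x|lebesgue_on \<Omega>. partial i \<psi> x *\<^sub>R \<phi> x) = - (LINT x|lebesgue_on \<Omega>. \<psi> x *\<^sub>R partial i \<phi> x)"
    by (simp add: eq_neg_iff_add_eq_0 add.commute)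
qed

lemma H1_weak_deriv: "u \<in> H1 \<Omega> \<Longrightarrow> weak_deriv \<Omega> i u (wpartial \<Omega> i u)"
  unfolding wpartial_def H1_def by (auto intro: someI_ex[of "weak_deriv \<Omega> i u"])

lemma wpartial_L2: "u \<in> H1 \<Omega> \<Longrightarrow> wpartial \<Omega> i u \<in> L2 \<Omega>"
  using H1_weak_deriv by (auto simp: weak_deriv_def)

lemma wpartial_AE_eq:
  assumes "weak_deriv \<Omega> i u g"
  shows "AE x in lebesgue_on \<Omega>. wpartial \<Omega> i u x = g x"
  by (rule weak_deriv_unique[OF _ assms]) (unfold wpartial_def, rule someI[of _ g], fact)

lemma H1_L2: "u \<in> H1 \<Omega> \<Longrightarrow> u \<in> L2 \<Omega>"
  by (simp add: H1_def)

lemma H1_I: "(\<And>i. weak_deriv \<Omega> i u (g i)) \<Longrightarrow> u \<in> H1 \<Omega>"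
  by (auto simp: H1_def weak_deriv_def)

lemma H1_add: "u \<in> H1 \<Omega> \<Longrightarrow> v \<in> H1 \<Omega> \<Longrightarrow> (\<lambda>x. u x + v x) \<in> H1 \<Omega>"
  by (rule H1_I[OF weak_deriv_add[OF H1_weak_deriv H1_weak_deriv]])

lemma H1_scaleR: "u \<in> H1 \<Omega> \<Longrightarrow> (\<lambda>x. c *\<^sub>R u x) \<in> H1 \<Omega>"
  by (rule H1_I[OF weak_deriv_scaleR[OF H1_weak_deriv]])

lemma H1_diff: "u \<in> H1 \<Omega> \<Longrightarrow> v \<in> H1 \<Omega> \<Longrightarrow> (\<lambda>x. u x - v x) \<in> H1 \<Omega>"
  using H1_add[OF _ H1_scaleR[of v "-1"], of u] by simp

lemma test_H1: "\<phi> \<in> test_functions \<Omega> \<Longrightarrow> \<phi> \<in> H1 \<Omega>"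
  by (rule H1_I[OF weak_deriv_test])

lemma wgrad_L2: "u \<in> H1 \<Omega> \<Longrightarrow> wgrad \<Omega> u \<in> L2 \<Omega>"
  unfolding wgrad_eq_sum[abs_def]
  by (intro L2_sum L2_linear_image[OF bounded_linear_column_matrix] wpartial_L2)

lemma AE_wgrad_eq:
  assumes "\<And>i. weak_deriv \<Omega> i u (g i)"
  shows "AE x in lebesgue_on \<Omega>. wgrad \<Omega> u x = (\<chi> k i. g i x $ k)"
proof -
  have "AE x in lebesgue_on \<Omega>. \<forall>i. wpartial \<Omega> i u x = g i x"
    using wpartial_AE_eq[OF assms] by (simp add: AE_all_countable)
  then show ?thesis by eventually_elim (simp add: wgrad_def)
qed

text \<open>Only an almost everywhere identity, because \<open>wpartial\<close> picks the
  representatives for \<open>u\<close>, \<open>v\<close> and their sum independently.\<close>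

lemma wgrad_add:
  assumes "u \<in> H1 \<Omega>" "v \<in> H1 \<Omega>"
  shows "AE x in lebesgue_on \<Omega>. wgrad \<Omega> (\<lambda>x. u x + v x) x = wgrad \<Omega> u x + wgrad \<Omega> v x"
  using AE_wgrad_eq[OF weak_deriv_add[OF H1_weak_deriv[OF assms(1)] H1_weak_deriv[OF assms(2)]]]
  by eventually_elim (simp add: wgrad_def vec_eq_iff)

lemma wgrad_scaleR:
  assumes "u \<in> H1 \<Omega>"
  shows "AE x in lebesgue_on \<Omega>. wgrad \<Omega> (\<lambda>x. c *\<^sub>R u x) x = c *\<^sub>R wgrad \<Omega> u x"
  using AE_wgrad_eq[OF weak_deriv_scaleR[OF H1_weak_deriv[OF assms(1)]]]
  by eventually_elim (simp add: wgrad_def vec_eq_iff)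

lemma wgrad_diff:
  assumes "u \<in> H1 \<Omega>" "v \<in> H1 \<Omega>"
  shows "AE x in lebesgue_on \<Omega>. wgrad \<Omega> (\<lambda>x. u x - v x) x = wgrad \<Omega> u x - wgrad \<Omega> v x"
  using wgrad_add[OF assms(1) H1_scaleR[OF assms(2), of "-1"]] wgrad_scaleR[OF assms(2), of "-1"]
  by eventually_elim simp

lemma wgrad_test:
  assumes "\<phi> \<in> test_functions \<Omega>"
  shows "AE x in lebesgue_on \<Omega>. wgrad \<Omega> \<phi> x = (\<chi> k i. partial i \<phi> x $ k)"
  by (rule AE_wgrad_eq[OF weak_deriv_test[OF assms]])


section \<open>The Dirichlet form\<close>

lemma stokes_ext_eq_sum:
  assumes "u \<in> H1 \<Omega>" "v \<in> H1 \<Omega>"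
  shows "stokes_ext \<Omega> u v = (\<Sum>i\<in>UNIV. l2_inner \<Omega> (wpartial \<Omega> i u) (wpartial \<Omega> i v))"
  unfolding stokes_ext_def l2_inner_def inner_wgrad
  by (rule Bochner_Integration.integral_sum) (intro L2_inner_integrable wpartial_L2 assms)

lemma stokes_ext_commute: "stokes_ext \<Omega> u v = stokes_ext \<Omega> v u"
  by (simp add: stokes_ext_def l2_inner_commute)

lemma stokes_ext_add:
  assumes "u \<in> H1 \<Omega>" "v \<in> H1 \<Omega>" "z \<in> H1 \<Omega>"
  shows "stokes_ext \<Omega> (\<lambda>x. u x + v x) z = stokes_ext \<Omega> u z + stokes_ext \<Omega> v z"
proof -
  have "stokes_ext \<Omega> (\<lambda>x. u x + v x) z = l2_inner \<Omega> (\<lambda>x. wgrad \<Omega> u x + wgrad \<Omega> v x) (wgrad \<Omega> z)"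
    unfolding stokes_ext_def
    using assms by (intro l2_inner_cong_AE wgrad_add) (auto intro!: wgrad_L2 H1_add L2_add)
  also have "\<dots> = stokes_ext \<Omega> u z + stokes_ext \<Omega> v z"
    unfolding stokes_ext_def using assms by (intro l2_inner_add_left wgrad_L2)
  finally show ?thesis .
qed

lemma stokes_ext_scaleR:
  assumes "u \<in> H1 \<Omega>" "z \<in> H1 \<Omega>"
  shows "stokes_ext \<Omega> (\<lambda>x. c *\<^sub>R u x) z = c * stokes_ext \<Omega> u z"
proof -
  have "stokes_ext \<Omega> (\<lambda>x. c *\<^sub>R u x) z = l2_inner \<Omega> (\<lambda>x. c *\<^sub>R wgrad \<Omega> u x) (wgrad \<Omega> z)"
    unfolding stokes_ext_def
    using assms by (intro l2_inner_cong_AE wgrad_scaleR) (auto intro!: wgrad_L2 H1_scaleR L2_scaleR)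
  then show ?thesis by (simp add: stokes_ext_def l2_inner_scaleR_left)
qed

lemma stokes_ext_diff:
  assumes "u \<in> H1 \<Omega>" "v \<in> H1 \<Omega>" "z \<in> H1 \<Omega>"
  shows "stokes_ext \<Omega> (\<lambda>x. u x - v x) z = stokes_ext \<Omega> u z - stokes_ext \<Omega> v z"
  using stokes_ext_add[OF assms(1) H1_scaleR[OF assms(2), of "-1"] assms(3)]
    stokes_ext_scaleR[OF assms(2,3), of "-1"] by simp

lemma V_norm_power2: "(V_norm \<Omega> u)\<^sup>2 = stokes_ext \<Omega> u u"
  by (simp add: V_norm_def stokes_ext_def l2_norm_power2)

lemma V_norm_nonneg [simp]: "0 \<le> V_norm \<Omega> u"
  by (simp add: V_norm_def)

lemma stokes_ext_Cauchy_Schwarz: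
  "u \<in> H1 \<Omega> \<Longrightarrow> v \<in> H1 \<Omega> \<Longrightarrow> \<bar>stokes_ext \<Omega> u v\<bar> \<le> V_norm \<Omega> u * V_norm \<Omega> v"
  unfolding stokes_ext_def V_norm_def by (intro l2_Cauchy_Schwarz wgrad_L2)

lemma V_norm_diff_eq:
  assumes "u \<in> H1 \<Omega>" "v \<in> H1 \<Omega>"
  shows "V_norm \<Omega> (\<lambda>x. u x - v x) = l2_norm \<Omega> (\<lambda>x. wgrad \<Omega> u x - wgrad \<Omega> v x)"
  unfolding V_norm_def using assms
  by (intro l2_norm_cong_AE wgrad_diff wgrad_L2 H1_diff L2_diff) auto

lemma V_norm_scaleR:
  assumes "u \<in> H1 \<Omega>"
  shows "V_norm \<Omega> (\<lambda>x. c *\<^sub>R u x) = \<bar>c\<bar> * V_norm \<Omega> u"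
  unfolding V_norm_def l2_norm_scaleR[symmetric] using assms
  by (intro l2_norm_cong_AE wgrad_scaleR wgrad_L2 H1_scaleR L2_scaleR) auto

lemma V_norm_diff_commute:
  assumes "u \<in> H1 \<Omega>" "v \<in> H1 \<Omega>"
  shows "V_norm \<Omega> (\<lambda>x. u x - v x) = V_norm \<Omega> (\<lambda>x. v x - u x)"
  unfolding V_norm_diff_eq[OF assms] V_norm_diff_eq[OF assms(2,1)] by (rule l2_norm_diff_commute)

lemma V_norm_triangle_sub:
  assumes "u \<in> H1 \<Omega>" "v \<in> H1 \<Omega>"
  shows "V_norm \<Omega> u \<le> V_norm \<Omega> v + V_norm \<Omega> (\<lambda>x. u x - v x)"
  unfolding V_norm_diff_eq[OF assms] V_norm_def[of _ u] V_norm_def[of _ v]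
  by (intro l2_norm_triangle_sub wgrad_L2 assms)

lemma V_norm_triangle:
  assumes "u \<in> H1 \<Omega>" "v \<in> H1 \<Omega>"
  shows "V_norm \<Omega> (\<lambda>x. u x + v x) \<le> V_norm \<Omega> u + V_norm \<Omega> v"
  using V_norm_triangle_sub[OF H1_add[OF assms] assms(2)] by simp

lemma V_norm_zero [simp]: "V_norm \<Omega> (\<lambda>x. 0) = 0"
  using V_norm_scaleR[OF test_H1[OF test_functions_zero], of 0] by simp


section \<open>Fields vanishing on the boundary\<close>

text \<open>The sum of squares in \<open>H10_def\<close> suits triangle inequalities badly. Together
  with \<open>H10_approx\<close> this exchanges it for separate smallness of the two norms.\<close>

lemma H10_I:
  assumes "u \<in> H1 \<Omega>"
    and "\<And>\<epsilon>. \<epsilon> > 0 \<Longrightarrow> \<exists>\<phi>\<in>test_functions \<Omega>. l2_norm \<Omega> (\<lambda>x. u x - \<phi> x) < \<epsilon> \<and> V_norm \<Omega> (\<lambda>x. u x - \<phi> x) < \<epsilon>"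
  shows "u \<in> H10 \<Omega>"
  unfolding H10_def
proof (intro CollectI conjI assms(1) allI impI)
  fix \<epsilon> :: real assume "\<epsilon> > 0"
  then obtain \<phi> where \<phi>: "\<phi> \<in> test_functions \<Omega>" "l2_norm \<Omega> (\<lambda>x. u x - \<phi> x) < sqrt (\<epsilon> / 2)"
      "V_norm \<Omega> (\<lambda>x. u x - \<phi> x) < sqrt (\<epsilon> / 2)"
    using assms(2)[of "sqrt (\<epsilon> / 2)"] by auto
  have "(l2_norm \<Omega> (\<lambda>x. u x - \<phi> x))\<^sup>2 < \<epsilon> / 2" "(V_norm \<Omega> (\<lambda>x. u x - \<phi> x))\<^sup>2 < \<epsilon> / 2"
    using power_strict_mono[OF \<phi>(2), of 2] power_strict_mono[OF \<phi>(3), of 2] \<open>\<epsilon> > 0\<close> by simp_all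
  then show "\<exists>\<phi>\<in>test_functions \<Omega>. (l2_norm \<Omega> (\<lambda>x. u x - \<phi> x))\<^sup>2 + (l2_norm \<Omega> (wgrad \<Omega> (\<lambda>x. u x - \<phi> x)))\<^sup>2 < \<epsilon>"
    using \<phi>(1) by (intro bexI[of _ \<phi>]) (simp_all add: V_norm_def)
qed

lemma H10_approx:
  assumes "u \<in> H10 \<Omega>" "\<epsilon> > 0"
  obtains \<phi> where "\<phi> \<in> test_functions \<Omega>" "l2_norm \<Omega> (\<lambda>x. u x - \<phi> x) < \<epsilon>" "V_norm \<Omega> (\<lambda>x. u x - \<phi> x) < \<epsilon>"
proof -
  obtain \<phi> where \<phi>: "\<phi> \<in> test_functions \<Omega>"
    "(l2_norm \<Omega> (\<lambda>x. u x - \<phi> x))\<^sup>2 + (V_norm \<Omega> (\<lambda>x. u x - \<phi> x))\<^sup>2 < \<epsilon>\<^sup>2"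
    using assms unfolding H10_def V_norm_def by auto (meson zero_less_power)
  have "(l2_norm \<Omega> (\<lambda>x. u x - \<phi> x))\<^sup>2 < \<epsilon>\<^sup>2" "(V_norm \<Omega> (\<lambda>x. u x - \<phi> x))\<^sup>2 < \<epsilon>\<^sup>2"
    using \<phi>(2) zero_le_power2[of "l2_norm \<Omega> (\<lambda>x. u x - \<phi> x)"] zero_le_power2[of "V_norm \<Omega> (\<lambda>x. u x - \<phi> x)"]
    by linarith+
  then show ?thesis using that[OF \<phi>(1)] assms(2) power2_less_imp_less less_imp_le by blast
qed

lemma H10_H1: "u \<in> H10 \<Omega> \<Longrightarrow> u \<in> H1 \<Omega>"
  by (simp add: H10_def)

lemma H10_L2: "u \<in> H10 \<Omega> \<Longrightarrow> u \<in> L2 \<Omega>"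
  by (simp add: H10_H1 H1_L2)

lemma test_H10: "\<phi> \<in> test_functions \<Omega> \<Longrightarrow> \<phi> \<in> H10 \<Omega>"
  by (rule H10_I) (auto intro!: test_H1 bexI[of _ \<phi>])

lemma H10_add:
  assumes "u \<in> H10 \<Omega>" "v \<in> H10 \<Omega>"
  shows "(\<lambda>x. u x + v x) \<in> H10 \<Omega>"
proof (rule H10_I)
  show "(\<lambda>x. u x + v x) \<in> H1 \<Omega>" using assms by (intro H1_add H10_H1)
  fix \<epsilon> :: real assume "\<epsilon> > 0"
  obtain \<phi> where \<phi>: "\<phi> \<in> test_functions \<Omega>" "l2_norm \<Omega> (\<lambda>x. u x - \<phi> x) < \<epsilon> / 2" "V_norm \<Omega> (\<lambda>x. u x - \<phi> x) < \<epsilon> / 2"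
    by (rule H10_approx[OF assms(1), of "\<epsilon> / 2"]) (use \<open>\<epsilon> > 0\<close> in auto)
  obtain \<psi> where \<psi>: "\<psi> \<in> test_functions \<Omega>" "l2_norm \<Omega> (\<lambda>x. v x - \<psi> x) < \<epsilon> / 2" "V_norm \<Omega> (\<lambda>x. v x - \<psi> x) < \<epsilon> / 2"
    by (rule H10_approx[OF assms(2), of "\<epsilon> / 2"]) (use \<open>\<epsilon> > 0\<close> in auto)
  have eq: "(\<lambda>x. u x + v x - (\<phi> x + \<psi> x)) = (\<lambda>x. (u x - \<phi> x) + (v x - \<psi> x))" by auto
  have H: "(\<lambda>x. u x - \<phi> x) \<in> H1 \<Omega>" "(\<lambda>x. v x - \<psi> x) \<in> H1 \<Omega>"
    using assms \<phi>(1) \<psi>(1) by (auto intro!: H1_diff intro: H10_H1 test_H1)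
  show "\<exists>\<phi>\<in>test_functions \<Omega>. l2_norm \<Omega> (\<lambda>x. u x + v x - \<phi> x) < \<epsilon> \<and> V_norm \<Omega> (\<lambda>x. u x + v x - \<phi> x) < \<epsilon>"
    using l2_norm_triangle[OF H[THEN H1_L2]] V_norm_triangle[OF H] \<phi> \<psi>
    by (intro bexI[of _ "\<lambda>x. \<phi> x + \<psi> x"] test_functions_add) (auto simp: eq)
qed

lemma H10_scaleR:
  assumes "u \<in> H10 \<Omega>"
  shows "(\<lambda>x. c *\<^sub>R u x) \<in> H10 \<Omega>"
proof (rule H10_I)
  show "(\<lambda>x. c *\<^sub>R u x) \<in> H1 \<Omega>" using assms by (intro H1_scaleR H10_H1)
  fix \<epsilon> :: real assume "\<epsilon> > 0"
  \<comment> \<open>The summand 1 keeps the tolerance well defined for \<open>c = 0\<close>.\<close>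
  obtain \<phi> where \<phi>: "\<phi> \<in> test_functions \<Omega>" "l2_norm \<Omega> (\<lambda>x. u x - \<phi> x) < \<epsilon> / (\<bar>c\<bar> + 1)"
    "V_norm \<Omega> (\<lambda>x. u x - \<phi> x) < \<epsilon> / (\<bar>c\<bar> + 1)"
    by (rule H10_approx[OF assms, of "\<epsilon> / (\<bar>c\<bar> + 1)"]) (use \<open>\<epsilon> > 0\<close> in auto)
  have H: "(\<lambda>x. u x - \<phi> x) \<in> H1 \<Omega>"
    using assms \<phi>(1) by (auto intro!: H1_diff intro: H10_H1 test_H1)
  have eq: "(\<lambda>x. c *\<^sub>R u x - c *\<^sub>R \<phi> x) = (\<lambda>x. c *\<^sub>R (u x - \<phi> x))" by (auto simp: scaleR_diff_right)
  have small: "\<bar>c\<bar> * r < \<epsilon>" if "r < \<epsilon> / (\<bar>c\<bar> + 1)" "r \<ge> 0" for r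
  proof -
    have "\<bar>c\<bar> * r \<le> (\<bar>c\<bar> + 1) * r" using that(2) by (simp add: mult_right_mono)
    also have "\<dots> < \<epsilon>" using that(1) by (simp add: field_simps)
    finally show ?thesis .
  qed
  show "\<exists>\<phi>\<in>test_functions \<Omega>. l2_norm \<Omega> (\<lambda>x. c *\<^sub>R u x - \<phi> x) < \<epsilon> \<and> V_norm \<Omega> (\<lambda>x. c *\<^sub>R u x - \<phi> x) < \<epsilon>"
    using small[OF \<phi>(2)] small[OF \<phi>(3)]
    by (intro bexI[of _ "\<lambda>x. c *\<^sub>R \<phi> x"] test_functions_linear_image[OF bounded_linear_scaleR_right \<phi>(1)])
      (simp add: eq l2_norm_scaleR V_norm_scaleR[OF H])
qed

lemma H10_diff: "u \<in> H10 \<Omega> \<Longrightarrow> v \<in> H10 \<Omega> \<Longrightarrow> (\<lambda>x. u x - v x) \<in> H10 \<Omega>"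
  using H10_add[OF _ H10_scaleR[of v "-1"], of u] by simp

lemma divfree_add:
  assumes "\<phi> \<in> divfree_test_functions \<Omega>" "\<psi> \<in> divfree_test_functions \<Omega>"
  shows "(\<lambda>x. \<phi> x + \<psi> x) \<in> divfree_test_functions \<Omega>"
proof -
  have t: "\<phi> \<in> test_functions \<Omega>" "\<psi> \<in> test_functions \<Omega>" using assms by (auto simp: divfree_test_functions_def)
  show ?thesis
    using assms test_functions_add[OF t]
      smooth_add(2)[OF t[THEN test_functions_smooth]]
    by (simp add: divfree_test_functions_def fun_eq_iff sum.distrib)
qed

lemma divfree_scaleR:
  assumes "\<phi> \<in> divfree_test_functions \<Omega>"
  shows "(\<lambda>x. c *\<^sub>R \<phi> x) \<in> divfree_test_functions \<Omega>"
proof -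
  have t: "\<phi> \<in> test_functions \<Omega>" using assms by (auto simp: divfree_test_functions_def)
  have "(\<Sum>i\<in>UNIV. partial i \<phi> x $ i) = 0" for x using assms by (auto simp: divfree_test_functions_def)
  then show ?thesis
    using test_functions_linear_image[OF bounded_linear_scaleR_right t]
      smooth_linear_image(2)[OF bounded_linear_scaleR_right[of c] test_functions_smooth[OF t]]
    by (simp add: divfree_test_functions_def fun_eq_iff flip: sum_distrib_left)
qed

lemma space_H_L2: "u \<in> space_H \<Omega> \<Longrightarrow> u \<in> L2 \<Omega>"
  by (simp add: space_H_def)

lemma space_H_add:
  assumes "u \<in> space_H \<Omega>" "v \<in> space_H \<Omega>"
  shows "(\<lambda>x. u x + v x) \<in> space_H \<Omega>"
  unfolding space_H_def
proof (intro CollectI conjI allI impI L2_add space_H_L2 assms)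
  fix \<epsilon> :: real assume "\<epsilon> > 0"
  then have "\<epsilon> / 2 > 0" by simp
  obtain \<phi> where \<phi>: "\<phi> \<in> divfree_test_functions \<Omega>" "l2_norm \<Omega> (\<lambda>x. u x - \<phi> x) < \<epsilon> / 2"
    using assms(1) \<open>\<epsilon> / 2 > 0\<close> unfolding space_H_def by blast
  obtain \<psi> where \<psi>: "\<psi> \<in> divfree_test_functions \<Omega>" "l2_norm \<Omega> (\<lambda>x. v x - \<psi> x) < \<epsilon> / 2"
    using assms(2) \<open>\<epsilon> / 2 > 0\<close> unfolding space_H_def by blast
  have eq: "(\<lambda>x. u x + v x - (\<phi> x + \<psi> x)) = (\<lambda>x. (u x - \<phi> x) + (v x - \<psi> x))" by auto
  have H: "(\<lambda>x. u x - \<phi> x) \<in> L2 \<Omega>" "(\<lambda>x. v x - \<psi> x) \<in> L2 \<Omega>"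
    using assms \<phi>(1) \<psi>(1) by (auto intro!: L2_diff intro: space_H_L2 test_L2 simp: divfree_test_functions_def)
  show "\<exists>\<phi>\<in>divfree_test_functions \<Omega>. l2_norm \<Omega> (\<lambda>x. u x + v x - \<phi> x) < \<epsilon>"
    using l2_norm_triangle[OF H] \<phi> \<psi>
    by (intro bexI[of _ "\<lambda>x. \<phi> x + \<psi> x"] divfree_add) (auto simp: eq)
qed

lemma space_H_scaleR:
  assumes "u \<in> space_H \<Omega>"
  shows "(\<lambda>x. c *\<^sub>R u x) \<in> space_H \<Omega>"
  unfolding space_H_def
proof (intro CollectI conjI allI impI L2_scaleR space_H_L2 assms)
  fix \<epsilon> :: real assume "\<epsilon> > 0"
  then have "\<epsilon> / (\<bar>c\<bar> + 1) > 0" by simp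
  then obtain \<phi> where \<phi>: "\<phi> \<in> divfree_test_functions \<Omega>" "l2_norm \<Omega> (\<lambda>x. u x - \<phi> x) < \<epsilon> / (\<bar>c\<bar> + 1)"
    using assms unfolding space_H_def by blast
  have eq: "(\<lambda>x. c *\<^sub>R u x - c *\<^sub>R \<phi> x) = (\<lambda>x. c *\<^sub>R (u x - \<phi> x))" by (auto simp: scaleR_diff_right)
  have "\<bar>c\<bar> * l2_norm \<Omega> (\<lambda>x. u x - \<phi> x) \<le> (\<bar>c\<bar> + 1) * l2_norm \<Omega> (\<lambda>x. u x - \<phi> x)"
    by (simp add: mult_right_mono)
  also have "\<dots> < \<epsilon>" using \<phi>(2) by (simp add: field_simps)
  finally show "\<exists>\<phi>\<in>divfree_test_functions \<Omega>. l2_norm \<Omega> (\<lambda>x. c *\<^sub>R u x - \<phi> x) < \<epsilon>"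
    by (intro bexI[of _ "\<lambda>x. c *\<^sub>R \<phi> x"] divfree_scaleR \<phi>(1)) (simp add: eq l2_norm_scaleR)
qed

lemma space_V_D:
  assumes "u \<in> space_V \<Omega>"
  shows space_V_H10: "u \<in> H10 \<Omega>" and space_V_H: "u \<in> space_H \<Omega>" and space_V_H1: "u \<in> H1 \<Omega>"
    and space_V_L2: "u \<in> L2 \<Omega>"
  using assms by (auto simp: space_V_def H10_H1 H10_L2)

lemma space_V_add: "u \<in> space_V \<Omega> \<Longrightarrow> v \<in> space_V \<Omega> \<Longrightarrow> (\<lambda>x. u x + v x) \<in> space_V \<Omega>"
  by (simp add: space_V_def H10_add space_H_add)

lemma space_V_scaleR: "u \<in> space_V \<Omega> \<Longrightarrow> (\<lambda>x. c *\<^sub>R u x) \<in> space_V \<Omega>"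
  by (simp add: space_V_def H10_scaleR space_H_scaleR)

lemma space_V_diff: "u \<in> space_V \<Omega> \<Longrightarrow> v \<in> space_V \<Omega> \<Longrightarrow> (\<lambda>x. u x - v x) \<in> space_V \<Omega>"
  using space_V_add[OF _ space_V_scaleR[of v "-1"], of u] by simp

lemma space_V_zero: "(\<lambda>x. 0) \<in> space_V \<Omega>"
proof -
  have "(\<lambda>x. 0) \<in> divfree_test_functions \<Omega>"
    by (simp add: divfree_test_functions_def has_derivative_imp_partial[of "\<lambda>x. 0" "\<lambda>x y. 0"]
        flip: frechet_derivative_at[of "\<lambda>x. 0" "\<lambda>x. 0"])
  then have "(\<lambda>x. 0) \<in> space_H \<Omega>" by (auto simp: space_H_def intro!: bexI[of _ "\<lambda>x. 0"])
  then show ?thesis by (simp add: space_V_def test_H10)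
qed

lemma space_V_sum: "(\<And>i. i \<in> I \<Longrightarrow> u i \<in> space_V \<Omega>) \<Longrightarrow> (\<lambda>x. \<Sum>i\<in>I. u i x) \<in> space_V \<Omega>"
  by (induction I rule: infinite_finite_induct) (auto intro: space_V_add space_V_zero)


section \<open>Integration by parts\<close>

text \<open>\<open>weak_deriv\<close> tests a field with scalar functions. Testing with the k-th
  component of \<open>\<Psi>\<close>, reading off the k-th component of the result and summing over
  k gives the vectorial formula.\<close>

lemma integration_by_parts_test:
  assumes "u \<in> H1 \<Omega>" "\<Psi> \<in> test_functions \<Omega>"
  shows "l2_inner \<Omega> u (partial i \<Psi>) = - l2_inner \<Omega> (wpartial \<Omega> i u) \<Psi>"
proof -
  have L: "bounded_linear (\<lambda>y. y $ k)" for k :: 3 by (rule bounded_linear_vec_nth)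
  have t: "(\<lambda>x. \<Psi> x $ k) \<in> test_functions \<Omega>" for k
    by (rule test_functions_linear_image[OF L assms(2)])
  have p: "partial i (\<lambda>x. \<Psi> x $ k) = (\<lambda>x. partial i \<Psi> x $ k)" for k
    by (rule smooth_linear_image(2)[OF L test_functions_smooth[OF assms(2)]])
  note W = H1_weak_deriv[OF assms(1), of i]
  have int: "integrable (lebesgue_on \<Omega>) (\<lambda>x. (partial i \<Psi> x $ k) *\<^sub>R u x)"
    "integrable (lebesgue_on \<Omega>) (\<lambda>x. (\<Psi> x $ k) *\<^sub>R wpartial \<Omega> i u x)" for k
    using L2_scaleR_integrable[OF test_L2[OF t[of k]] wpartial_L2[OF assms(1), of i]]
      L2_scaleR_integrable[OF test_L2[OF test_functions_partial[OF t[of k], of i]] H1_L2[OF assms(1)]]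
    unfolding fun_cong[OF p] by blast+
  have "(LINT x|lebesgue_on \<Omega>. (partial i \<Psi> x $ k) * u x $ k)
      = - (LINT x|lebesgue_on \<Omega>. (\<Psi> x $ k) * wpartial \<Omega> i u x $ k)" for k
  proof -
    have "(LINT x|lebesgue_on \<Omega>. partial i (\<lambda>x. \<Psi> x $ k) x *\<^sub>R u x)
        = - (LINT x|lebesgue_on \<Omega>. (\<Psi> x $ k) *\<^sub>R wpartial \<Omega> i u x)"
      using W t[of k] unfolding weak_deriv_def by blast
    then have "(LINT x|lebesgue_on \<Omega>. (partial i \<Psi> x $ k) *\<^sub>R u x) $ k
        = - (LINT x|lebesgue_on \<Omega>. (\<Psi> x $ k) *\<^sub>R wpartial \<Omega> i u x) $ k"
      unfolding fun_cong[OF p] by simp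
    then show ?thesis
      using integral_bounded_linear[OF L int(1)[of k], of k] integral_bounded_linear[OF L int(2)[of k], of k]
      by simp
  qed
  note comp = this
  have int': "integrable (lebesgue_on \<Omega>) (\<lambda>x. (partial i \<Psi> x $ k) * u x $ k)"
     "integrable (lebesgue_on \<Omega>) (\<lambda>x. (\<Psi> x $ k) * wpartial \<Omega> i u x $ k)" for k
    using integrable_bounded_linear[OF L int(1)[of k], of k] integrable_bounded_linear[OF L int(2)[of k], of k]
    by simp_all
  have "l2_inner \<Omega> (partial i \<Psi>) u = (\<Sum>k\<in>UNIV. LINT x|lebesgue_on \<Omega>. (partial i \<Psi> x $ k) * u x $ k)"
    unfolding l2_inner_def inner_vec_def using int' by simp
  also have "\<dots> = - (\<Sum>k\<in>UNIV. LINT x|lebesgue_on \<Omega>. (\<Psi> x $ k) * wpartial \<Omega> i u x $ k)"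
    by (simp add: comp sum_negf)
  also have "\<dots> = - l2_inner \<Omega> \<Psi> (wpartial \<Omega> i u)"
    unfolding l2_inner_def inner_vec_def using int' by simp
  finally show ?thesis by (simp add: l2_inner_commute)
qed

lemma stokes_ext_test:
  assumes "u \<in> H1 \<Omega>" "\<psi> \<in> test_functions \<Omega>"
  shows "stokes_ext \<Omega> u \<psi> = (\<Sum>i\<in>UNIV. l2_inner \<Omega> (wpartial \<Omega> i u) (partial i \<psi>))"
proof -
  have "l2_inner \<Omega> (wpartial \<Omega> i u) (wpartial \<Omega> i \<psi>) = l2_inner \<Omega> (wpartial \<Omega> i u) (partial i \<psi>)" for i
    by (rule l2_inner_cong_AE)
      (use wpartial_AE_eq[OF weak_deriv_test[OF assms(2)]] in
        \<open>auto intro: wpartial_L2 test_L2 test_functions_partial test_H1 assms\<close>)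
  then show ?thesis by (simp add: stokes_ext_eq_sum test_H1 assms)
qed

text \<open>All derivatives are moved onto the test field, so that convergence of \<open>u\<close>
  in L2 alone controls the Dirichlet form. This is what identifies limits of gradients
  later.\<close>

lemma stokes_ext_test_laplacian:
  assumes "u \<in> H1 \<Omega>" "\<psi> \<in> test_functions \<Omega>"
  shows "stokes_ext \<Omega> u \<psi> = - l2_inner \<Omega> u (\<lambda>x. \<Sum>i\<in>UNIV. partial i (partial i \<psi>) x)"
proof -
  have t: "partial i (partial i \<psi>) \<in> test_functions \<Omega>" for i
    by (intro test_functions_partial assms(2))
  have "stokes_ext \<Omega> u \<psi> = - (\<Sum>i\<in>UNIV. l2_inner \<Omega> u (partial i (partial i \<psi>)))"
    unfolding stokes_ext_test[OF assms]
    using integration_by_parts_test[OF assms(1) test_functions_partial[OF assms(2)]]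
    by (simp add: sum_negf)
  also have "(\<Sum>i\<in>UNIV. l2_inner \<Omega> u (partial i (partial i \<psi>)))
      = l2_inner \<Omega> u (\<lambda>x. \<Sum>i\<in>UNIV. partial i (partial i \<psi>) x)"
    using test_L2[OF t] H1_L2[OF assms(1)] by (intro l2_inner_sum_right[symmetric]) auto
  finally show ?thesis .
qed

lemma wlaplacian_L2: "u \<in> H2 \<Omega> \<Longrightarrow> wlaplacian \<Omega> u \<in> L2 \<Omega>"
  unfolding wlaplacian_def[abs_def] H2_def by (auto intro!: L2_sum wpartial_L2)

text \<open>Green's formula holds for test fields by parts, and both sides are continuous in the H1
  norm, in which test fields are dense in \<open>H10 \<Omega>\<close>.\<close>

lemma stokes_ext_H2:
  assumes u: "u \<in> H2 \<Omega>" and \<phi>: "\<phi> \<in> H10 \<Omega>"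
  shows "stokes_ext \<Omega> u \<phi> = l2_inner \<Omega> (\<lambda>x. - wlaplacian \<Omega> u x) \<phi>"
proof -
  have u1: "u \<in> H1 \<Omega>" "wpartial \<Omega> i u \<in> H1 \<Omega>" for i using u by (auto simp: H2_def)
  define L where "L = (\<lambda>x. - wlaplacian \<Omega> u x)"
  have L: "L \<in> L2 \<Omega>" unfolding L_def by (intro L2_minus wlaplacian_L2 u)
  have test: "stokes_ext \<Omega> u \<psi> = l2_inner \<Omega> L \<psi>" if \<psi>: "\<psi> \<in> test_functions \<Omega>" for \<psi>
  proof -
    have "stokes_ext \<Omega> u \<psi> = (\<Sum>i\<in>UNIV. - l2_inner \<Omega> (wpartial \<Omega> i (wpartial \<Omega> i u)) \<psi>)"
      unfolding stokes_ext_test[OF u1(1) \<psi>] using integration_by_parts_test[OF u1(2) \<psi>] by simp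
    also have "\<dots> = - l2_inner \<Omega> (\<lambda>x. \<Sum>i\<in>UNIV. wpartial \<Omega> i (wpartial \<Omega> i u) x) \<psi>"
      using test_L2[OF \<psi>] wpartial_L2[OF u1(2)] by (simp add: l2_inner_sum_left sum_negf)
    finally show ?thesis unfolding L_def l2_inner_minus_left by (simp add: wlaplacian_def)
  qed
  have "\<bar>stokes_ext \<Omega> u \<phi> - l2_inner \<Omega> L \<phi>\<bar> \<le> 0"
  proof (rule field_le_epsilon)
    fix e :: real assume "e > 0"
    define c where "c = V_norm \<Omega> u + l2_norm \<Omega> L + 1"
    have c: "c > 0" unfolding c_def by (intro add_nonneg_pos add_nonneg_nonneg) auto
    obtain \<psi> where \<psi>: "\<psi> \<in> test_functions \<Omega>" "l2_norm \<Omega> (\<lambda>x. \<phi> x - \<psi> x) < e / c" "V_norm \<Omega> (\<lambda>x. \<phi> x - \<psi> x) < e / c"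
      by (rule H10_approx[OF \<phi>, of "e / c"]) (use c \<open>e > 0\<close> in auto)
    have H: "\<phi> \<in> H1 \<Omega>" "\<psi> \<in> H1 \<Omega>" "(\<lambda>x. \<phi> x - \<psi> x) \<in> H1 \<Omega>"
      using \<phi> \<psi>(1) by (auto intro: H10_H1 test_H1 H1_diff)
    have "stokes_ext \<Omega> u \<phi> - l2_inner \<Omega> L \<phi>
        = stokes_ext \<Omega> u (\<lambda>x. \<phi> x - \<psi> x) - l2_inner \<Omega> L (\<lambda>x. \<phi> x - \<psi> x)"
      using stokes_ext_diff[OF H(1,2) u1(1)] l2_inner_diff_right[OF H(1,2)[THEN H1_L2] L] test[OF \<psi>(1)]
      by (simp add: stokes_ext_commute[of u])
    also have "\<bar>\<dots>\<bar> \<le> V_norm \<Omega> u * V_norm \<Omega> (\<lambda>x. \<phi> x - \<psi> x) + l2_norm \<Omega> L * l2_norm \<Omega> (\<lambda>x. \<phi> x - \<psi> x)"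
      using stokes_ext_Cauchy_Schwarz[OF u1(1) H(3)] l2_Cauchy_Schwarz[OF L H1_L2[OF H(3)]] by linarith
    also have "\<dots> \<le> V_norm \<Omega> u * (e / c) + l2_norm \<Omega> L * (e / c)"
      using \<psi>(2,3) by (intro add_mono mult_left_mono) auto
    also have "\<dots> \<le> c * (e / c)"
      using c \<open>e > 0\<close> unfolding c_def distrib_right by simp
    finally show "\<bar>stokes_ext \<Omega> u \<phi> - l2_inner \<Omega> L \<phi>\<bar> \<le> 0 + e" using c by simp
  qed
  then show ?thesis by (simp add: L_def)
qed

end


section \<open>Eigenfunction expansions\<close>

context open_domain
begin

lemma stokes_ext_diff_right:
  assumes "u \<in> H1 \<Omega>" "v \<in> H1 \<Omega>" "z \<in> H1 \<Omega>"
  shows "stokes_ext \<Omega> z (\<lambda>x. u x - v x) = stokes_ext \<Omega> z u - stokes_ext \<Omega> z v"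
  using stokes_ext_diff[OF assms] by (metis stokes_ext_commute)

text \<open>Membership in \<open>H1\<close> is carried along because additivity of the form needs it
  for the partial sums of the induction.\<close>

lemma stokes_ext_sum:
  assumes "\<And>i. i \<in> I \<Longrightarrow> u i \<in> H1 \<Omega>" "z \<in> H1 \<Omega>" "finite I"
  shows "stokes_ext \<Omega> (\<lambda>x. \<Sum>i\<in>I. u i x) z = (\<Sum>i\<in>I. stokes_ext \<Omega> (u i) z)
    \<and> (\<lambda>x. \<Sum>i\<in>I. u i x) \<in> H1 \<Omega>"
  using assms(3,1)
proof (induction I rule: finite_induct)
  case empty
  show ?case using stokes_ext_scaleR[OF assms(2,2), of 0] test_H1[OF test_functions_zero] by simp
next
  case (insert i I)
  then show ?case by (simp add: stokes_ext_add assms(2) H1_add)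
qed

end

locale stokes_system = open_domain +
  fixes w :: "nat \<Rightarrow> field" and lam :: "nat \<Rightarrow> real"
  assumes eigensystem: "stokes_eigensystem \<Omega> w lam"
begin

lemma eigenfunction_V: "1 \<le> j \<Longrightarrow> w j \<in> space_V \<Omega>"
  using eigensystem by (auto simp: stokes_eigensystem_def stokes_def)

lemma eigenvalue_mono:
  assumes "1 \<le> i" "i \<le> j"
  shows "lam i \<le> lam j"
  using assms(2)
proof (induction j rule: dec_induct)
  case (step n)
  then have "lam n \<le> lam (Suc n)"
    using eigensystem assms(1) unfolding stokes_eigensystem_def by simp
  with step.IH show ?case by linarith
qed simp

lemma eigenvalue_pos: "1 \<le> j \<Longrightarrow> 0 < lam j"
  using eigenvalue_mono[of 1 j] eigensystem by (simp add: stokes_eigensystem_def)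

lemma eigenfunction_orthonormal:
  "1 \<le> i \<Longrightarrow> 1 \<le> j \<Longrightarrow> l2_inner \<Omega> (w i) (w j) = (if i = j then 1 else 0)"
  using eigensystem by (simp add: stokes_eigensystem_def)

text \<open>The projection onto H in the definition of the Stokes operator disappears when tested
  with elements of V, a subset of H. This weak form is how the eigenvalue equation enters everything
  below.\<close>

lemma stokes_ext_eigenfunction:
  assumes "1 \<le> j" "\<phi> \<in> space_V \<Omega>"
  shows "stokes_ext \<Omega> (w j) \<phi> = lam j * l2_inner \<Omega> (w j) \<phi>"
proof -
  have s: "w j \<in> H2 \<Omega>" "is_orth_proj \<Omega> (space_H \<Omega>) (\<lambda>x. - wlaplacian \<Omega> (w j) x) (\<lambda>x. lam j *\<^sub>R w j x)"
    using eigensystem assms(1) by (auto simp: stokes_eigensystem_def stokes_def)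
  have "0 = l2_inner \<Omega> (\<lambda>x. - wlaplacian \<Omega> (w j) x - lam j *\<^sub>R w j x) \<phi>"
    using s(2) space_V_H[OF assms(2)] by (simp add: is_orth_proj_def)
  also have "\<dots> = l2_inner \<Omega> (\<lambda>x. - wlaplacian \<Omega> (w j) x) \<phi> - l2_inner \<Omega> (\<lambda>x. lam j *\<^sub>R w j x) \<phi>"
    using assms by (intro l2_inner_diff_left L2_minus wlaplacian_L2 s(1) L2_scaleR space_V_L2 eigenfunction_V)
  finally show ?thesis
    using stokes_ext_H2[OF s(1) space_V_H10[OF assms(2)]] by (simp add: l2_inner_scaleR_left)
qed

section \<open>Truncated eigenfunction expansions\<close>

definition combination :: "nat \<Rightarrow> (nat \<Rightarrow> real) \<Rightarrow> field" where
  "combination m a = (\<lambda>x. \<Sum>j=1..m. a j *\<^sub>R w j x)"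

text \<open>The projection onto the first \<open>m\<close> modes as an explicit function;
  \<open>orth_proj_eigenspan\<close> identifies it with the projection chosen in
  \<open>orth_proj\<close>.\<close>

definition truncation :: "nat \<Rightarrow> field \<Rightarrow> field" where
  "truncation m \<phi> = combination m (\<lambda>j. l2_inner \<Omega> (w j) \<phi>)"

lemma combination_V: "combination m a \<in> space_V \<Omega>"
  unfolding combination_def by (intro space_V_sum space_V_scaleR eigenfunction_V) simp

lemma truncation_V: "truncation m \<phi> \<in> space_V \<Omega>"
  unfolding truncation_def by (rule combination_V)

lemma combination_eigenspan: "combination m a \<in> eigenspan w m"
  by (auto simp: eigenspan_def combination_def)

lemma eigenspanE:
  assumes "p \<in> eigenspan w m"
  obtains a where "p = combination m a"
  using assms by (auto simp: eigenspan_def combination_def)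

lemma l2_inner_combination:
  assumes "\<phi> \<in> L2 \<Omega>"
  shows "l2_inner \<Omega> (combination m a) \<phi> = (\<Sum>j=1..m. a j * l2_inner \<Omega> (w j) \<phi>)"
  unfolding combination_def
  by (subst l2_inner_sum_left)
    (auto simp: l2_inner_scaleR_left simp del: One_nat_def
      intro: L2_scaleR[OF space_V_L2[OF eigenfunction_V]] assms)

lemma l2_inner_eigenfunction_combination:
  assumes "1 \<le> i"
  shows "l2_inner \<Omega> (w i) (combination m a) = (if i \<le> m then a i else 0)"
proof -
  have "l2_inner \<Omega> (combination m a) (w i) = (\<Sum>j=1..m. if j = i then a i else 0)"
    unfolding l2_inner_combination[OF space_V_L2[OF eigenfunction_V[OF assms]]]
    by (rule sum.cong) (auto simp: eigenfunction_orthonormal assms simp del: One_nat_def)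
  then show ?thesis using assms by (simp add: l2_inner_commute)
qed

lemma stokes_ext_combination:
  assumes "\<phi> \<in> space_V \<Omega>"
  shows "stokes_ext \<Omega> (combination m a) \<phi> = (\<Sum>j=1..m. lam j * a j * l2_inner \<Omega> (w j) \<phi>)"
proof -
  have "stokes_ext \<Omega> (combination m a) \<phi> = (\<Sum>j=1..m. stokes_ext \<Omega> (\<lambda>x. a j *\<^sub>R w j x) \<phi>)"
    unfolding combination_def using assms
    by (intro stokes_ext_sum[THEN conjunct1]) (auto intro!: H1_scaleR eigenfunction_V intro: space_V_H1)
  also have "\<dots> = (\<Sum>j=1..m. lam j * a j * l2_inner \<Omega> (w j) \<phi>)"
  proof (rule sum.cong[OF refl])
    fix j assume "j \<in> {1..m}"
    then have j: "1 \<le> j" by simp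
    show "stokes_ext \<Omega> (\<lambda>x. a j *\<^sub>R w j x) \<phi> = lam j * a j * l2_inner \<Omega> (w j) \<phi>"
      using stokes_ext_scaleR[OF space_V_H1[OF eigenfunction_V[OF j]] space_V_H1[OF assms]]
      by (simp add: stokes_ext_eigenfunction[OF j assms])
  qed
  finally show ?thesis .
qed

lemma V_norm_combination: "(V_norm \<Omega> (combination m a))\<^sup>2 = (\<Sum>j=1..m. lam j * (a j)\<^sup>2)"
  unfolding V_norm_power2 stokes_ext_combination[OF combination_V]
  by (rule sum.cong) (auto simp: l2_inner_eigenfunction_combination power2_eq_square)

lemma l2_norm_combination: "(l2_norm \<Omega> (combination m a))\<^sup>2 = (\<Sum>j=1..m. (a j)\<^sup>2)"
  unfolding l2_norm_power2 l2_inner_combination[OF space_V_L2[OF combination_V]]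
  by (rule sum.cong) (auto simp: l2_inner_eigenfunction_combination power2_eq_square)

lemma l2_norm_diff_truncation:
  assumes "\<phi> \<in> L2 \<Omega>"
  shows "(l2_norm \<Omega> (\<lambda>x. \<phi> x - truncation m \<phi> x))\<^sup>2
    = (l2_norm \<Omega> \<phi>)\<^sup>2 - (\<Sum>j=1..m. (l2_inner \<Omega> (w j) \<phi>)\<^sup>2)"
  unfolding l2_norm_diff_power2[OF assms space_V_L2[OF truncation_V]]
  unfolding truncation_def l2_norm_combination l2_inner_commute[of \<Omega> \<phi>] l2_inner_combination[OF assms]
  by (simp add: power2_eq_square)

text \<open>Eigenfunctions are orthogonal in the Dirichlet form too, so the remainder is orthogonal
  to the truncation. The first identity keeps the full field \<open>\<phi>\<close> as second
  argument, where it can be replaced by a test field; the second one gives Bessel's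
  inequality.\<close>

lemma V_norm_diff_truncation:
  assumes "\<phi> \<in> space_V \<Omega>"
  shows "(V_norm \<Omega> (\<lambda>x. \<phi> x - truncation m \<phi> x))\<^sup>2 = stokes_ext \<Omega> (\<lambda>x. \<phi> x - truncation m \<phi> x) \<phi>"
    and "(V_norm \<Omega> (\<lambda>x. \<phi> x - truncation m \<phi> x))\<^sup>2
      = (V_norm \<Omega> \<phi>)\<^sup>2 - (\<Sum>j=1..m. lam j * (l2_inner \<Omega> (w j) \<phi>)\<^sup>2)"
proof -
  let ?T = "truncation m \<phi>"
  have H: "\<phi> \<in> H1 \<Omega>" "?T \<in> H1 \<Omega>" "(\<lambda>x. \<phi> x - ?T x) \<in> H1 \<Omega>"
    using assms by (auto intro!: H1_diff intro: space_V_H1 truncation_V)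
  have T\<phi>: "stokes_ext \<Omega> ?T \<phi> = (\<Sum>j=1..m. lam j * (l2_inner \<Omega> (w j) \<phi>)\<^sup>2)"
    unfolding truncation_def stokes_ext_combination[OF assms] by (simp add: power2_eq_square mult.assoc)
  have TT: "stokes_ext \<Omega> ?T ?T = (\<Sum>j=1..m. lam j * (l2_inner \<Omega> (w j) \<phi>)\<^sup>2)"
    unfolding V_norm_power2[symmetric] truncation_def V_norm_combination ..
  have eq: "stokes_ext \<Omega> (\<lambda>x. \<phi> x - ?T x) (\<lambda>x. \<phi> x - ?T x)
      = stokes_ext \<Omega> (\<lambda>x. \<phi> x - ?T x) \<phi> - stokes_ext \<Omega> (\<lambda>x. \<phi> x - ?T x) ?T"
    by (rule stokes_ext_diff_right[OF H(1,2,3)])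
  have 0: "stokes_ext \<Omega> (\<lambda>x. \<phi> x - ?T x) ?T = 0"
    unfolding stokes_ext_diff[OF H(1,2,2)] stokes_ext_commute[of \<phi>] T\<phi> TT by simp
  show "(V_norm \<Omega> (\<lambda>x. \<phi> x - ?T x))\<^sup>2 = stokes_ext \<Omega> (\<lambda>x. \<phi> x - ?T x) \<phi>"
    unfolding V_norm_power2 eq 0 by simp
  then show "(V_norm \<Omega> (\<lambda>x. \<phi> x - ?T x))\<^sup>2 = (V_norm \<Omega> \<phi>)\<^sup>2 - (\<Sum>j=1..m. lam j * (l2_inner \<Omega> (w j) \<phi>)\<^sup>2)"
    unfolding stokes_ext_diff[OF H(1,2,1)] T\<phi> V_norm_power2 by simp
qed

lemma V_Bessel:
  assumes "\<phi> \<in> space_V \<Omega>"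
  shows "(\<Sum>j=1..m. lam j * (l2_inner \<Omega> (w j) \<phi>)\<^sup>2) \<le> (V_norm \<Omega> \<phi>)\<^sup>2"
  using V_norm_diff_truncation(2)[OF assms, of m] zero_le_power2[of "V_norm \<Omega> (\<lambda>x. \<phi> x - truncation m \<phi> x)"]
  by linarith

text \<open>After expansion the coefficients decouple, and completing the square shows that the
  Fourier coefficient minimises each term.\<close>

lemma truncation_best_approximation:
  assumes \<phi>: "\<phi> \<in> L2 \<Omega>"
  shows "l2_norm \<Omega> (\<lambda>x. \<phi> x - truncation m \<phi> x) \<le> l2_norm \<Omega> (\<lambda>x. \<phi> x - combination m a x)"
proof (rule power2_le_imp_le)
  let ?c = "\<lambda>j. l2_inner \<Omega> (w j) \<phi>"
  have "(\<Sum>j=1..m. 2 * (a j * ?c j)) \<le> (\<Sum>j=1..m. (a j)\<^sup>2 + (?c j)\<^sup>2)"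
  proof (rule sum_mono)
    fix j show "2 * (a j * ?c j) \<le> (a j)\<^sup>2 + (?c j)\<^sup>2"
      using zero_le_power2[of "a j - ?c j"] by (simp add: power2_diff mult.assoc)
  qed
  then show "(l2_norm \<Omega> (\<lambda>x. \<phi> x - truncation m \<phi> x))\<^sup>2 \<le> (l2_norm \<Omega> (\<lambda>x. \<phi> x - combination m a x))\<^sup>2"
    unfolding l2_norm_diff_truncation[OF \<phi>] l2_norm_diff_power2[OF \<phi> space_V_L2[OF combination_V]]
      l2_norm_combination l2_inner_commute[of \<Omega> \<phi>] l2_inner_combination[OF \<phi>]
    by (simp add: sum.distrib sum_distrib_left)
qed simp

text \<open>Completeness of the eigensystem yields merely one good combination for one length. Best
  approximation transfers it to the truncation of that length, and remainders decrease as the length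
  grows.\<close>

lemma truncation_tendsto:
  assumes "\<phi> \<in> space_H \<Omega>"
  shows "(\<lambda>m. l2_norm \<Omega> (\<lambda>x. \<phi> x - truncation m \<phi> x)) \<longlonglongrightarrow> 0"
proof (rule LIMSEQ_I)
  fix e :: real assume "e > 0"
  have \<phi>: "\<phi> \<in> L2 \<Omega>" by (rule space_H_L2[OF assms])
  obtain N p where "p \<in> eigenspan w N" and p: "l2_norm \<Omega> (\<lambda>x. \<phi> x - p x) < e"
    using eigensystem assms \<open>e > 0\<close> unfolding stokes_eigensystem_def by blast
  then obtain a where a: "p = combination N a" using eigenspanE by blast
  show "\<exists>N. \<forall>m\<ge>N. norm (l2_norm \<Omega> (\<lambda>x. \<phi> x - truncation m \<phi> x) - 0) < e"
  proof (intro exI allI impI)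
    fix m assume "N \<le> m"
    have "l2_norm \<Omega> (\<lambda>x. \<phi> x - truncation m \<phi> x) \<le> l2_norm \<Omega> (\<lambda>x. \<phi> x - truncation N \<phi> x)"
    proof (rule power2_le_imp_le)
      show "(l2_norm \<Omega> (\<lambda>x. \<phi> x - truncation m \<phi> x))\<^sup>2 \<le> (l2_norm \<Omega> (\<lambda>x. \<phi> x - truncation N \<phi> x))\<^sup>2"
        unfolding l2_norm_diff_truncation[OF \<phi>] using \<open>N \<le> m\<close> by (intro diff_left_mono sum_mono2) auto
    qed simp
    also have "\<dots> \<le> l2_norm \<Omega> (\<lambda>x. \<phi> x - p x)"
      unfolding a by (rule truncation_best_approximation[OF \<phi>])
    finally show "norm (l2_norm \<Omega> (\<lambda>x. \<phi> x - truncation m \<phi> x) - 0) < e" using p by simp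
  qed
qed

text \<open>The weak limit of the truncated gradients is identified by testing against gradients of smooth
  fields, whose Laplacians can be moved onto the strongly convergent truncations. Completeness of
  the space is not needed.\<close>

lemma truncation_V_tendsto:
  assumes \<phi>: "\<phi> \<in> space_V \<Omega>"
  shows "(\<lambda>m. V_norm \<Omega> (\<lambda>x. \<phi> x - truncation m \<phi> x)) \<longlonglongrightarrow> 0"
proof -
  let ?d = "\<lambda>m x. \<phi> x - truncation m \<phi> x"
  have d: "?d m \<in> H1 \<Omega>" for m using \<phi> by (intro H1_diff space_V_H1 truncation_V)
  have dV: "V_norm \<Omega> (?d m) \<le> V_norm \<Omega> \<phi>" for m
  proof (rule power2_le_imp_le)
    show "(V_norm \<Omega> (?d m))\<^sup>2 \<le> (V_norm \<Omega> \<phi>)\<^sup>2"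
      unfolding V_norm_diff_truncation(2)[OF \<phi>]
      using sum_nonneg[of "{1..m}" "\<lambda>j. lam j * (l2_inner \<Omega> (w j) \<phi>)\<^sup>2"] eigenvalue_pos
      by (simp add: less_imp_le)
  qed simp
  have "(\<lambda>m. (V_norm \<Omega> (?d m))\<^sup>2) \<longlonglongrightarrow> 0"
  proof (rule LIMSEQ_I)
    fix e :: real assume "e > 0"
    \<comment> \<open>Calibrated so that the part of the estimate carried by the uniform bound
      \<open>dV\<close> uses up at most half of \<open>e\<close>.\<close>
    define c where "c = e / (2 * (V_norm \<Omega> \<phi> + 1))"
    have V1: "V_norm \<Omega> \<phi> + 1 > 0" using V_norm_nonneg[of \<phi>] by linarith
    then have c: "c > 0" "V_norm \<Omega> \<phi> * c \<le> e / 2"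
      using \<open>e > 0\<close> by (auto simp: c_def field_simps)
    obtain \<psi> where \<psi>: "\<psi> \<in> test_functions \<Omega>" "V_norm \<Omega> (\<lambda>x. \<phi> x - \<psi> x) < c"
      by (rule H10_approx[OF space_V_H10[OF \<phi>] c(1)])
    define L where "L = (\<lambda>x. \<Sum>i\<in>UNIV. partial i (partial i \<psi>) x)"
    have L: "L \<in> L2 \<Omega>"
      unfolding L_def by (intro L2_sum test_L2 test_functions_partial \<psi>(1))
    have H: "\<phi> \<in> H1 \<Omega>" "\<psi> \<in> H1 \<Omega>" "(\<lambda>x. \<phi> x - \<psi> x) \<in> H1 \<Omega>"
      using \<phi> \<psi>(1) by (auto intro!: H1_diff intro: space_V_H1 test_H1)
    have "(\<lambda>m. l2_norm \<Omega> (?d m) * l2_norm \<Omega> L) \<longlonglongrightarrow> 0"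
      using tendsto_mult_right[OF truncation_tendsto[OF space_V_H[OF \<phi>]], of "l2_norm \<Omega> L"] by simp
    then have "\<forall>\<^sub>F m in sequentially. l2_norm \<Omega> (?d m) * l2_norm \<Omega> L < e / 2"
      using \<open>e > 0\<close> by (intro order_tendstoD(2)) auto
    then obtain N where N: "\<And>m. m \<ge> N \<Longrightarrow> l2_norm \<Omega> (?d m) * l2_norm \<Omega> L < e / 2"
      by (auto simp: eventually_sequentially)
    show "\<exists>N. \<forall>m\<ge>N. norm ((V_norm \<Omega> (?d m))\<^sup>2 - 0) < e"
    proof (intro exI allI impI)
      fix m assume "N \<le> m"
      \<comment> \<open>The second argument is split into a smooth field and a rest: on the smooth
        field the L2 convergence of the remainders suffices, and the rest is small uniformly in
        \<open>m\<close>.\<close>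
      have "(V_norm \<Omega> (?d m))\<^sup>2 = stokes_ext \<Omega> (?d m) \<psi> + stokes_ext \<Omega> (?d m) (\<lambda>x. \<phi> x - \<psi> x)"
        unfolding V_norm_diff_truncation(1)[OF \<phi>]
        using stokes_ext_diff_right[OF H(1,2) d] by simp
      also have "stokes_ext \<Omega> (?d m) \<psi> = - l2_inner \<Omega> (?d m) L"
        unfolding L_def by (rule stokes_ext_test_laplacian[OF d \<psi>(1)])
      also have "\<dots> \<le> l2_norm \<Omega> (?d m) * l2_norm \<Omega> L"
        using l2_Cauchy_Schwarz[OF H1_L2[OF d] L, of m] by linarith
      also have "\<dots> < e / 2" by (rule N) fact
      also have "stokes_ext \<Omega> (?d m) (\<lambda>x. \<phi> x - \<psi> x) \<le> V_norm \<Omega> (?d m) * V_norm \<Omega> (\<lambda>x. \<phi> x - \<psi> x)"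
        using stokes_ext_Cauchy_Schwarz[OF d H(3), of m] by linarith
      also have "\<dots> \<le> V_norm \<Omega> \<phi> * c"
        using dV \<psi>(2) by (intro mult_mono) auto
      finally show "norm ((V_norm \<Omega> (?d m))\<^sup>2 - 0) < e" using c(2) by simp
    qed
  qed
  then have "(\<lambda>m. sqrt ((V_norm \<Omega> (?d m))\<^sup>2)) \<longlonglongrightarrow> sqrt 0" by (rule tendsto_real_sqrt)
  then show ?thesis by simp
qed

text \<open>The modes from m + 1 to n each carry a weight of at least \<open>lam (Suc m)\<close> in
  the Dirichlet form, which Bessel's inequality bounds; then n tends to infinity. This is where a
  large eigenvalue makes the high modes small.\<close>

lemma truncation_Poincare:
  assumes \<phi>: "\<phi> \<in> space_V \<Omega>"
  shows "lam (Suc m) * (l2_norm \<Omega> (\<lambda>x. \<phi> x - truncation m \<phi> x))\<^sup>2 \<le> (V_norm \<Omega> \<phi>)\<^sup>2"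
proof -
  let ?c = "\<lambda>j. (l2_inner \<Omega> (w j) \<phi>)\<^sup>2"
  have L: "\<phi> \<in> L2 \<Omega>" by (rule space_V_L2[OF \<phi>])
  have bound: "lam (Suc m) * (l2_norm \<Omega> (\<lambda>x. \<phi> x - truncation m \<phi> x))\<^sup>2
      \<le> (V_norm \<Omega> \<phi>)\<^sup>2 + lam (Suc m) * (l2_norm \<Omega> (\<lambda>x. \<phi> x - truncation n \<phi> x))\<^sup>2" if "m \<le> n" for n
  proof -
    have split: "sum f {1..n} = sum f {1..m} + sum f {Suc m..n}" for f :: "nat \<Rightarrow> real"
      using that by (subst sum.union_disjoint[symmetric]) (auto intro!: sum.cong)
    have "lam (Suc m) * sum ?c {Suc m..n} \<le> (\<Sum>j=Suc m..n. lam j * ?c j)"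
      unfolding sum_distrib_left by (intro sum_mono mult_right_mono eigenvalue_mono) auto
    also have "\<dots> \<le> (\<Sum>j=1..n. lam j * ?c j)"
      by (intro sum_mono2) (auto simp: eigenvalue_pos less_imp_le)
    also have "\<dots> \<le> (V_norm \<Omega> \<phi>)\<^sup>2" by (rule V_Bessel[OF \<phi>])
    finally show ?thesis
      unfolding l2_norm_diff_truncation[OF L] split by (simp add: algebra_simps)
  qed
  have "(\<lambda>n. (V_norm \<Omega> \<phi>)\<^sup>2 + lam (Suc m) * (l2_norm \<Omega> (\<lambda>x. \<phi> x - truncation n \<phi> x))\<^sup>2)
      \<longlonglongrightarrow> (V_norm \<Omega> \<phi>)\<^sup>2 + lam (Suc m) * 0\<^sup>2"
    by (intro tendsto_intros truncation_tendsto space_V_H \<phi>)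
  then show ?thesis using bound by (intro LIMSEQ_le_const) auto
qed

lemma Poincare:
  assumes "\<phi> \<in> space_V \<Omega>"
  shows "lam 1 * (l2_norm \<Omega> \<phi>)\<^sup>2 \<le> (V_norm \<Omega> \<phi>)\<^sup>2"
  using truncation_Poincare[OF assms, of 0] by (simp add: truncation_def combination_def)

text \<open>\<open>orth_proj\<close> is a choice, so uniqueness must hold as equality of functions.
  It does, because elements of \<open>eigenspan\<close> are literal finite combinations and
  orthonormality determines their coefficients.\<close>

lemma orth_proj_eigenspan:
  assumes f: "f \<in> L2 \<Omega>"
  shows "orth_proj \<Omega> (eigenspan w m) f = truncation m f"
  unfolding orth_proj_def
proof (rule some_equality)
  have orth: "l2_inner \<Omega> (\<lambda>x. f x - combination m a x) (combination m b)
      = (\<Sum>j=1..m. b j * (l2_inner \<Omega> (w j) f - a j))" for a b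
  proof -
    have "l2_inner \<Omega> (\<lambda>x. f x - combination m a x) (combination m b)
      = l2_inner \<Omega> (combination m b) f - l2_inner \<Omega> (combination m b) (combination m a)"
      unfolding l2_inner_commute[of _ "\<lambda>x. f x - combination m a x"]
      by (intro l2_inner_diff_right f space_V_L2 combination_V)
    also have "l2_inner \<Omega> (combination m b) (combination m a) = (\<Sum>j=1..m. b j * a j)"
      unfolding l2_inner_combination[OF space_V_L2[OF combination_V]]
      by (rule sum.cong) (auto simp: l2_inner_eigenfunction_combination)
    finally show ?thesis
      by (simp add: l2_inner_combination[OF f] sum_subtractf right_diff_distrib)
  qed
  show "is_orth_proj \<Omega> (eigenspan w m) f (truncation m f)"
    unfolding is_orth_proj_def truncation_def
    using f combination_eigenspan orth by (auto elim!: eigenspanE)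
  fix p assume p: "is_orth_proj \<Omega> (eigenspan w m) f p"
  then obtain a where a: "p = combination m a"
    using eigenspanE unfolding is_orth_proj_def by blast
  define b where "b j = l2_inner \<Omega> (w j) f - a j" for j
  \<comment> \<open>Testing the orthogonality with the coefficient defect \<open>b\<close> itself
    yields the sum of its squares.\<close>
  have "(\<Sum>j=1..m. b j * b j) = 0"
    using p orth[of a b] combination_eigenspan[of m b] unfolding is_orth_proj_def a b_def by simp
  then have "b j = 0" if "j \<in> {1..m}" for j
    using that by (subst (asm) sum_nonneg_eq_0_iff) auto
  then show "p = truncation m f"
    unfolding a truncation_def combination_def b_def by (intro ext sum.cong) auto
qed


section \<open>The dual norm\<close>

lemma V_dual_add:
  "f \<in> V_dual \<Omega> \<Longrightarrow> \<phi> \<in> space_V \<Omega> \<Longrightarrow> \<psi> \<in> space_V \<Omega> \<Longrightarrow> f (\<lambda>x. \<phi> x + \<psi> x) = f \<phi> + f \<psi>"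
  by (simp add: V_dual_def)

lemma V_dual_scaleR: "f \<in> V_dual \<Omega> \<Longrightarrow> \<phi> \<in> space_V \<Omega> \<Longrightarrow> f (\<lambda>x. c *\<^sub>R \<phi> x) = c * f \<phi>"
  by (simp add: V_dual_def)

lemma V_dual_combination:
  assumes "f \<in> V_dual \<Omega>"
  shows "f (combination m a) = (\<Sum>j=1..m. a j * f (w j))"
proof (induction m)
  case 0
  from V_dual_scaleR[OF assms space_V_zero, of 0] show ?case by (simp add: combination_def)
next
  case (Suc m)
  have "f (combination (Suc m) a) = f (\<lambda>x. combination m a x + a (Suc m) *\<^sub>R w (Suc m) x)"
    by (simp add: combination_def)
  also have "\<dots> = f (combination m a) + f (\<lambda>x. a (Suc m) *\<^sub>R w (Suc m) x)"
    by (intro V_dual_add[OF assms] combination_V space_V_scaleR eigenfunction_V) simp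
  also have "f (\<lambda>x. a (Suc m) *\<^sub>R w (Suc m) x) = a (Suc m) * f (w (Suc m))"
    by (intro V_dual_scaleR[OF assms] eigenfunction_V) simp
  finally show ?case using Suc by simp
qed

text \<open>\<open>spectral_norm\<close> is built on \<open>suminf\<close>, which is meaningful only
  for a convergent series. Boundedness of the functional on V is first turned into a uniform bound
  on the partial sums.\<close>

lemma dual_norm_sum_le:
  assumes f: "f \<in> V_dual \<Omega>"
  shows "0 \<le> dual_norm w lam f" and "(\<Sum>j=1..m. (f (w j))\<^sup>2 / lam j) \<le> (dual_norm w lam f)\<^sup>2"
proof -
  obtain K0 where K0: "\<And>\<phi>. \<phi> \<in> space_V \<Omega> \<Longrightarrow> \<bar>f \<phi>\<bar> \<le> K0 * V_norm \<Omega> \<phi>"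
    using f unfolding V_dual_def by blast
  define K where "K = max K0 0"
  have K: "K \<ge> 0" "\<bar>f \<phi>\<bar> \<le> K * V_norm \<Omega> \<phi>" if "\<phi> \<in> space_V \<Omega>" for \<phi>
    using K0[OF that] mult_right_mono[of K0 K "V_norm \<Omega> \<phi>"] by (auto simp: K_def)
  define S where "S m = (\<Sum>j=1..m. (f (w j))\<^sup>2 / lam j)" for m
  have S0: "0 \<le> S m" for m unfolding S_def
    by (intro sum_nonneg divide_nonneg_pos eigenvalue_pos) auto
  have SK: "S m \<le> K\<^sup>2" for m
  proof -
    \<comment> \<open>Coefficients of the truncated Riesz representative: for them both the value of
      \<open>f\<close> and the squared V norm equal \<open>S m\<close>, so that the square of
      \<open>S m\<close> is at most \<open>K\<^sup>2 * S m\<close>.\<close>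
    define a where "a j = f (w j) / lam j" for j
    have "f (combination m a) = S m"
      unfolding V_dual_combination[OF f] S_def a_def by (simp add: power2_eq_square)
    moreover have "(V_norm \<Omega> (combination m a))\<^sup>2 = S m"
      unfolding V_norm_combination S_def a_def
    proof (rule sum.cong[OF refl])
      fix j assume "j \<in> {1..m}"
      then have "lam j > 0" by (intro eigenvalue_pos) simp
      then show "lam j * (f (w j) / lam j)\<^sup>2 = (f (w j))\<^sup>2 / lam j"
        by (simp add: power2_eq_square)
    qed
    moreover have "\<bar>f (combination m a)\<bar>\<^sup>2 \<le> (K * V_norm \<Omega> (combination m a))\<^sup>2"
      by (intro power_mono K combination_V) simp
    ultimately have "S m * S m \<le> K\<^sup>2 * S m"
      by (simp add: power_mult_distrib flip: power2_eq_square)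
    then show ?thesis using S0[of m] by (cases "S m = 0") (auto simp: mult_le_cancel_right)
  qed
  define g where "g j = lam (Suc j) powr (-1) * (f (w (Suc j)))\<^sup>2" for j
  have g: "g j = (f (w (Suc j)))\<^sup>2 / lam (Suc j)" for j
    using eigenvalue_pos[of "Suc j"] by (simp add: g_def powr_minus divide_inverse mult.commute)
  have gS: "(\<Sum>j<m. g j) = S m" for m
    unfolding S_def g by (simp add: sum.atLeast1_atMost_eq)
  have g0: "0 \<le> g j" for j unfolding g using eigenvalue_pos[of "Suc j"] by simp
  have "summable g" by (rule summableI_nonneg_bounded[where x = "K\<^sup>2", OF g0]) (simp add: gS SK)
  then have "S m \<le> suminf g" unfolding gS[symmetric] using g0 by (intro sum_le_suminf) auto
  moreover have "(dual_norm w lam f)\<^sup>2 = suminf g"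
    unfolding spectral_norm_def g_def[symmetric]
    using \<open>summable g\<close> g0 by (simp add: suminf_nonneg)
  ultimately show "(\<Sum>j=1..m. (f (w j))\<^sup>2 / lam j) \<le> (dual_norm w lam f)\<^sup>2" by (simp add: S_def)
  show "0 \<le> dual_norm w lam f"
    unfolding spectral_norm_def g_def[symmetric] using \<open>summable g\<close> g0 by (simp add: suminf_nonneg)
qed

text \<open>On truncations this is Cauchy-Schwarz for finite sums with weights
  \<open>sqrt (lam j)\<close> shared between the two factors. Truncations converge in V, so the
  bound survives the limit; the constant \<open>K\<close> of the functional multiplies only the
  vanishing remainder.\<close>

lemma dual_norm_bound:
  assumes f: "f \<in> V_dual \<Omega>" and \<phi>: "\<phi> \<in> space_V \<Omega>"
  shows "\<bar>f \<phi>\<bar> \<le> dual_norm w lam f * V_norm \<Omega> \<phi>"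
proof -
  let ?c = "\<lambda>j. l2_inner \<Omega> (w j) \<phi>"
  obtain K where K: "\<And>\<phi>. \<phi> \<in> space_V \<Omega> \<Longrightarrow> \<bar>f \<phi>\<bar> \<le> K * V_norm \<Omega> \<phi>"
    using f unfolding V_dual_def by blast
  have trunc: "\<bar>f (truncation m \<phi>)\<bar> \<le> dual_norm w lam f * V_norm \<Omega> \<phi>" for m
  proof -
    have "(f (truncation m \<phi>))\<^sup>2 = (\<Sum>j=1..m. (sqrt (lam j) * ?c j) * (f (w j) / sqrt (lam j)))\<^sup>2"
      unfolding truncation_def V_dual_combination[OF f]
      by (intro arg_cong[of _ _ "\<lambda>x. x\<^sup>2"] sum.cong) (auto dest: eigenvalue_pos simp del: One_nat_def)
    also have "\<dots> \<le> (\<Sum>j=1..m. (sqrt (lam j) * ?c j)\<^sup>2) * (\<Sum>j=1..m. (f (w j) / sqrt (lam j))\<^sup>2)"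
      by (rule Cauchy_Schwarz_ineq_sum)
    also have "(\<Sum>j=1..m. (sqrt (lam j) * ?c j)\<^sup>2) = (\<Sum>j=1..m. lam j * (?c j)\<^sup>2)"
      by (rule sum.cong) (auto simp: power_mult_distrib dest: eigenvalue_pos simp del: One_nat_def)
    also have "(\<Sum>j=1..m. (f (w j) / sqrt (lam j))\<^sup>2) = (\<Sum>j=1..m. (f (w j))\<^sup>2 / lam j)"
      by (rule sum.cong) (auto simp: power_divide dest: eigenvalue_pos simp del: One_nat_def)
    also have "(\<Sum>j=1..m. lam j * (?c j)\<^sup>2) * (\<Sum>j=1..m. (f (w j))\<^sup>2 / lam j)
        \<le> (V_norm \<Omega> \<phi>)\<^sup>2 * (dual_norm w lam f)\<^sup>2"
      by (intro mult_mono V_Bessel \<phi> dual_norm_sum_le(2) f sum_nonneg divide_nonneg_pos eigenvalue_pos) auto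
    finally have "\<bar>f (truncation m \<phi>)\<bar>\<^sup>2 \<le> (dual_norm w lam f * V_norm \<Omega> \<phi>)\<^sup>2"
      by (simp add: power_mult_distrib mult.commute)
    then show ?thesis
      by (rule power2_le_imp_le) (intro mult_nonneg_nonneg dual_norm_sum_le(1) f V_norm_nonneg)
  qed
  have diff: "\<bar>f \<phi>\<bar> \<le> \<bar>f (truncation m \<phi>)\<bar> + K * V_norm \<Omega> (\<lambda>x. \<phi> x - truncation m \<phi> x)" for m
  proof -
    have d: "(\<lambda>x. \<phi> x - truncation m \<phi> x) \<in> space_V \<Omega>" by (intro space_V_diff \<phi> truncation_V)
    have "f (\<lambda>x. truncation m \<phi> x + (\<phi> x - truncation m \<phi> x))
        = f (truncation m \<phi>) + f (\<lambda>x. \<phi> x - truncation m \<phi> x)"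
      by (rule V_dual_add[OF f truncation_V d])
    then show ?thesis using K[OF d] by simp
  qed
  have "\<bar>f \<phi>\<bar> \<le> dual_norm w lam f * V_norm \<Omega> \<phi> + K * V_norm \<Omega> (\<lambda>x. \<phi> x - truncation m \<phi> x)" for m
    using trunc[of m] diff[of m] by linarith
  moreover have "(\<lambda>m. dual_norm w lam f * V_norm \<Omega> \<phi> + K * V_norm \<Omega> (\<lambda>x. \<phi> x - truncation m \<phi> x))
      \<longlonglongrightarrow> dual_norm w lam f * V_norm \<Omega> \<phi> + K * 0"
    by (intro tendsto_intros truncation_V_tendsto \<phi>)
  ultimately show ?thesis by (intro LIMSEQ_le_const) auto
qed

end


section \<open>Ladyzhenskaya's inequality\<close>

definition point3 :: "real \<Rightarrow> real \<Rightarrow> real \<Rightarrow> vec3" where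
  "point3 x y z = x *\<^sub>R axis 1 1 + y *\<^sub>R axis 2 1 + z *\<^sub>R axis 3 1"

lemma point3_nth [simp]: "point3 x y z $ 1 = x" "point3 x y z $ 2 = y" "point3 x y z $ 3 = z"
  by (simp_all add: point3_def axis_def)

lemma measurable_point3 [measurable]:
  assumes [measurable]: "f \<in> borel_measurable M" "g \<in> borel_measurable M" "h \<in> borel_measurable M"
  shows "(\<lambda>p. point3 (f p) (g p) (h p)) \<in> borel_measurable M"
  unfolding point3_def by measurable

lemma prod_Basis_vec3: "prod f (Basis :: vec3 set) = f (axis 1 1) * f (axis 2 1) * f (axis 3 1)"
proof -
  have "(Basis :: vec3 set) = (\<lambda>i. axis i 1) ` UNIV" by (auto simp: Basis_vec_def)
  then have "prod f (Basis :: vec3 set) = prod f ((\<lambda>i. axis i 1) ` UNIV)" by (rule arg_cong)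
  also have "\<dots> = (\<Prod>i\<in>UNIV. f (axis i 1))"
    by (subst prod.reindex) (auto simp: inj_on_def axis_eq_axis)
  finally show ?thesis unfolding UNIV_3 by (simp add: mult.assoc)
qed

text \<open>Both measures agree on boxes. The third coordinate comes first in the product, so that
  Tonelli splits the space into horizontal planes in one step.\<close>

lemma lborel_eq_distr_point3:
  "(lborel :: vec3 measure) = distr (lborel \<Otimes>\<^sub>M (lborel \<Otimes>\<^sub>M lborel)) borel (\<lambda>p. point3 (fst (snd p)) (snd (snd p)) (fst p))"
proof (rule lborel_eqI)
  fix l u :: vec3
  assume le: "\<And>b. b \<in> Basis \<Longrightarrow> l \<bullet> b \<le> u \<bullet> b"
  have le': "l $ i \<le> u $ i" for i
    using le[of "axis i 1"] by (simp add: inner_axis axis_in_Basis_iff)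
  let ?M = "lborel \<Otimes>\<^sub>M (lborel \<Otimes>\<^sub>M lborel) :: (real \<times> real \<times> real) measure"
  let ?P = "\<lambda>p. point3 (fst (snd p)) (snd (snd p)) (fst p)"
  have meas: "?P \<in> borel_measurable ?M" by measurable
  have "emeasure (distr ?M borel ?P) (box l u) = emeasure ?M (?P -` box l u \<inter> space ?M)"
    by (rule emeasure_distr[OF meas]) simp
  also have "?P -` box l u \<inter> space ?M = {l $ 3<..<u $ 3} \<times> ({l $ 1<..<u $ 1} \<times> {l $ 2<..<u $ 2})"
    by (auto simp: mem_box_cart forall_3 space_pair_measure)
  also have "emeasure ?M \<dots> = ennreal (u $ 3 - l $ 3) * (ennreal (u $ 1 - l $ 1) * ennreal (u $ 2 - l $ 2))"
    by (subst sigma_finite_measure.emeasure_pair_measure_Times)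
      (auto simp: lborel.emeasure_pair_measure_Times le' intro!: lborel_pair.sigma_finite_measure_axioms)
  also have "\<dots> = ennreal (prod ((\<bullet>) (u - l)) Basis)"
    by (simp add: prod_Basis_vec3 inner_axis le' ennreal_mult[symmetric] mult_ac)
  finally show "emeasure (distr ?M borel ?P) (box l u) = ennreal (prod ((\<bullet>) (u - l)) Basis)" .
qed simp

lemma nn_integral_point3:
  assumes [measurable]: "f \<in> borel_measurable (borel :: vec3 measure)"
  shows "(\<integral>\<^sup>+x. f x \<partial>lborel) = (\<integral>\<^sup>+z. (\<integral>\<^sup>+q. f (point3 (fst q) (snd q) z) \<partial>(lborel \<Otimes>\<^sub>M lborel)) \<partial>lborel)"
proof -
  have "(\<integral>\<^sup>+x. f x \<partial>lborel)
      = (\<integral>\<^sup>+p. f (point3 (fst (snd p)) (snd (snd p)) (fst p)) \<partial>(lborel \<Otimes>\<^sub>M (lborel \<Otimes>\<^sub>M lborel)))"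
    by (subst lborel_eq_distr_point3, subst nn_integral_distr) auto
  also have "\<dots> = (\<integral>\<^sup>+z. (\<integral>\<^sup>+q. f (point3 (fst q) (snd q) z) \<partial>(lborel \<Otimes>\<^sub>M lborel)) \<partial>lborel)"
    by (subst sigma_finite_measure.nn_integral_fst[OF lborel_pair.sigma_finite_measure_axioms, symmetric]) auto
  finally show ?thesis .
qed

text \<open>The squared norm is the integral of its derivative, twice the inner product of \<psi>
  and its derivative, started where \<psi> vanishes. Integrating from one side gives the factor 2,
  from which the later constants descend.\<close>

lemma pointwise_square_bound:
  fixes \<psi> \<psi>' :: "real \<Rightarrow> 'b::euclidean_space"
  assumes deriv: "\<And>t. (\<psi> has_vector_derivative \<psi>' t) (at t)" and cont: "continuous_on UNIV \<psi>'"
    and zero: "\<And>t. t \<le> r \<Longrightarrow> \<psi> t = 0"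
  shows "ennreal ((norm (\<psi> t))\<^sup>2) \<le> 2 * (\<integral>\<^sup>+s. ennreal (norm (\<psi> s) * norm (\<psi>' s)) \<partial>lborel)"
proof -
  \<comment> \<open>The minimum keeps \<open>a \<le> t\<close> while \<open>a\<close> stays in the
    region where \<open>\<psi>\<close> is zero.\<close>
  define a where "a = min r t"
  define f where "f s = 2 * (\<psi> s \<bullet> \<psi>' s)" for s
  have c: "isCont \<psi> s" for s
    using deriv has_vector_derivative_continuous by blast
  have c': "isCont \<psi>' s" for s using cont by (simp add: continuous_on_eq_continuous_at)
  have fc: "isCont f s" for s unfolding f_def by (intro continuous_intros c c')
  have "((\<lambda>s. \<psi> s \<bullet> \<psi> s) has_real_derivative f s) (at s)" for s
  proof -
    have "((\<lambda>s. \<psi> s \<bullet> \<psi> s) has_derivative (\<lambda>h. \<psi> s \<bullet> (h *\<^sub>R \<psi>' s) + (h *\<^sub>R \<psi>' s) \<bullet> \<psi> s)) (at s)"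
      using deriv[of s] unfolding has_vector_derivative_def by (intro has_derivative_inner)
    then show ?thesis
      by (rule has_derivative_imp_has_field_derivative) (simp add: f_def inner_commute)
  qed
  then have "(LBINT s. f s * indicat_real {a..t} s) = \<psi> t \<bullet> \<psi> t - \<psi> a \<bullet> \<psi> a"
    by (intro integral_FTC_Icc_real fc) (simp_all add: a_def)
  also have "\<psi> a = 0" by (rule zero) (simp add: a_def)
  finally have eq: "(norm (\<psi> t))\<^sup>2 = (LBINT s. f s * indicat_real {a..t} s)"
    by (simp add: power2_norm_eq_inner)
  have "integrable lborel (\<lambda>s. indicat_real {a..t} s *\<^sub>R f s)"
    by (rule borel_integrable_compact) (auto intro!: continuous_at_imp_continuous_on fc)
  then have "integrable lborel (\<lambda>s. f s * indicat_real {a..t} s)" by (simp add: mult.commute)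
  then have "ennreal (norm (LBINT s. f s * indicat_real {a..t} s))
      \<le> (\<integral>\<^sup>+s. norm (f s * indicat_real {a..t} s) \<partial>lborel)"
    by (rule integral_norm_bound_ennreal)
  also have "\<dots> \<le> (\<integral>\<^sup>+s. 2 * ennreal (norm (\<psi> s) * norm (\<psi>' s)) \<partial>lborel)"
  proof (rule nn_integral_mono)
    fix s
    have "norm (f s * indicat_real {a..t} s) \<le> \<bar>f s\<bar>" by (auto simp: indicator_def)
    also have "\<dots> \<le> 2 * (norm (\<psi> s) * norm (\<psi>' s))"
      using Cauchy_Schwarz_ineq2[of "\<psi> s" "\<psi>' s"] by (simp add: f_def abs_mult)
    finally have "ennreal (norm (f s * indicat_real {a..t} s)) \<le> ennreal (2 * (norm (\<psi> s) * norm (\<psi>' s)))"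
      by (rule ennreal_leI)
    then show "ennreal (norm (f s * indicat_real {a..t} s)) \<le> 2 * ennreal (norm (\<psi> s) * norm (\<psi>' s))"
      by (simp add: ennreal_mult)
  qed
  also have "\<dots> = 2 * (\<integral>\<^sup>+s. ennreal (norm (\<psi> s) * norm (\<psi>' s)) \<partial>lborel)"
  proof (rule nn_integral_cmult)
    have "continuous_on UNIV \<psi>" using c by (simp add: continuous_at_imp_continuous_on)
    then have "continuous_on UNIV (\<lambda>s. norm (\<psi> s) * norm (\<psi>' s))"
      using cont by (intro continuous_intros)
    then have "(\<lambda>s. norm (\<psi> s) * norm (\<psi>' s)) \<in> borel_measurable borel"
      by (rule borel_measurable_continuous_onI)
    then show "(\<lambda>s. ennreal (norm (\<psi> s) * norm (\<psi>' s))) \<in> borel_measurable lborel" by simp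
  qed
  finally show ?thesis unfolding eq by (simp add: eq[symmetric])
qed

lemma test_function_line_bound:
  fixes \<phi> :: "vec3 \<Rightarrow> 'b::euclidean_space"
  assumes \<phi>: "\<phi> \<in> test_functions \<Omega>"
  shows "ennreal ((norm (\<phi> (c + t *\<^sub>R axis i 1)))\<^sup>2)
    \<le> 2 * (\<integral>\<^sup>+s. ennreal (norm (\<phi> (c + s *\<^sub>R axis i 1)) * norm (partial i \<phi> (c + s *\<^sub>R axis i 1))) \<partial>lborel)"
proof -
  obtain K where K: "\<forall>k. Ck_on k UNIV \<phi>" "compact K" "K \<subseteq> \<Omega>" "\<And>x. x \<notin> K \<Longrightarrow> \<phi> x = 0"
    by (rule test_functionsE[OF \<phi>]) blast
  obtain B where B: "\<And>x. x \<in> K \<Longrightarrow> norm x \<le> B"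
    using compact_imp_bounded[OF K(2)] unfolding bounded_iff by blast
  show ?thesis
  \<comment> \<open>For parameters below this value the i-th coordinate lies below
    \<open>- B\<close>, hence outside the ball that contains the support.\<close>
  proof (rule pointwise_square_bound[where r = "- B - 1 - \<bar>c $ i\<bar>"])
    fix t
    have "((\<lambda>s. \<phi> (c + s *\<^sub>R axis i 1)) has_derivative
        (\<lambda>s. frechet_derivative \<phi> (at (c + t *\<^sub>R axis i 1)) (s *\<^sub>R axis i 1))) (at t)"
      by (rule has_derivative_compose[OF _ smooth_has_derivative[OF K(1)]])
        (auto intro!: derivative_eq_intros)
    moreover have "linear (frechet_derivative \<phi> (at y))" for y
      using smooth_has_derivative[OF K(1)] has_derivative_linear by blast
    ultimately show "((\<lambda>s. \<phi> (c + s *\<^sub>R axis i 1)) has_vector_derivative partial i \<phi> (c + t *\<^sub>R axis i 1)) (at t)"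
      by (simp add: has_vector_derivative_def linear_scale)
  next
    show "continuous_on UNIV (\<lambda>t. partial i \<phi> (c + t *\<^sub>R axis i 1))"
      by (rule continuous_on_compose2[OF smooth_continuous_on[OF smooth_partial[OF K(1)]]])
        (auto intro!: continuous_intros)
  next
    fix t assume t: "t \<le> - B - 1 - \<bar>c $ i\<bar>"
    have "\<bar>(c + t *\<^sub>R axis i 1) $ i\<bar> \<le> norm (c + t *\<^sub>R axis i 1)" by (rule component_le_norm_cart)
    moreover have "(c + t *\<^sub>R axis i 1) $ i = c $ i + t" by simp
    ultimately have "norm (c + t *\<^sub>R axis i 1) > B" using t by linarith
    then show "\<phi> (c + t *\<^sub>R axis i 1) = 0" using B K(4) by force
  qed
qed

text \<open>In each plane the line bounds in two directions separate variables; the third direction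
  bounds the plane integrals of \<open>p\<close> uniformly; Cauchy-Schwarz joins the planes. With
  nonnegative extended integrals Tonelli applies without any integrability of the slices.\<close>

lemma Ladyzhenskaya_ennreal:
  fixes \<phi> :: "vec3 \<Rightarrow> 'b::euclidean_space"
  assumes \<phi>: "\<phi> \<in> test_functions \<Omega>"
  defines "D \<equiv> \<lambda>i. \<integral>\<^sup>+x. ennreal ((norm (partial i \<phi> x))\<^sup>2) \<partial>lborel"
  shows "(\<integral>\<^sup>+x. ennreal ((norm (\<phi> x))^4) \<partial>lborel)\<^sup>2
    \<le> 64 * (\<integral>\<^sup>+x. ennreal ((norm (\<phi> x))\<^sup>2) \<partial>lborel) * (D 1 * D 2 * D 3)"
proof -
  have [measurable]: "\<phi> \<in> borel_measurable borel" by (rule test_functions_measurable[OF \<phi>])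
  have [measurable]: "partial i \<phi> \<in> borel_measurable borel" for i
    by (rule test_functions_measurable[OF test_functions_partial[OF \<phi>]])
  define p where "p x = ennreal ((norm (\<phi> x))\<^sup>2)" for x
  define e where "e i x = ennreal (norm (\<phi> x) * norm (partial i \<phi> x))" for i x
  define q where "q i x = ennreal ((norm (partial i \<phi> x))\<^sup>2)" for i x
  have [measurable]: "p \<in> borel_measurable borel" "e i \<in> borel_measurable borel" "q i \<in> borel_measurable borel" for i
    unfolding p_def[abs_def] e_def[abs_def] q_def[abs_def] by measurable
  define G where "G f z = (\<integral>\<^sup>+q. f (point3 (fst q) (snd q) z) \<partial>(lborel \<Otimes>\<^sub>M lborel))" for f :: "vec3 \<Rightarrow> ennreal" and z
  have [measurable]: "G f \<in> borel_measurable borel" if [measurable]: "f \<in> borel_measurable borel" for f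
    unfolding G_def[abs_def] by measurable
  have total: "(\<integral>\<^sup>+x. f x \<partial>lborel) = (\<integral>\<^sup>+z. G f z \<partial>lborel)" if "f \<in> borel_measurable borel" for f
    unfolding G_def by (rule nn_integral_point3[OF that])
  have G_xy: "G f z = (\<integral>\<^sup>+x. \<integral>\<^sup>+y. f (point3 x y z) \<partial>lborel \<partial>lborel)"
    and G_yx: "G f z = (\<integral>\<^sup>+y. \<integral>\<^sup>+x. f (point3 x y z) \<partial>lborel \<partial>lborel)"
    if [measurable]: "f \<in> borel_measurable borel" for f z
    unfolding G_def
    by (subst lborel.nn_integral_fst[symmetric], auto)
      (subst lborel_pair.nn_integral_snd[symmetric], auto)
  have e2: "(e i x)\<^sup>2 = p x * q i x" for i x
    unfolding e_def p_def q_def by (simp add: ennreal_power ennreal_mult[symmetric] power_mult_distrib)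
  have CS: "(G (e i) z)\<^sup>2 \<le> G p z * G (q i) z" for i z
  proof -
    have "(G (e i) z) = (\<integral>\<^sup>+r. ennreal (norm (\<phi> (point3 (fst r) (snd r) z)))
        * ennreal (norm (partial i \<phi> (point3 (fst r) (snd r) z))) \<partial>(lborel \<Otimes>\<^sub>M lborel))"
      unfolding G_def e_def by (simp add: ennreal_mult)
    then show ?thesis
      unfolding G_def p_def q_def
      by (simp add: ennreal_power[symmetric]) (rule Cauchy_Schwarz_nn_integral; measurable)
  qed
  have bx: "p (point3 x y z) \<le> 2 * (\<integral>\<^sup>+s. e 1 (point3 s y z) \<partial>lborel)"
    and b_y: "p (point3 x y z) \<le> 2 * (\<integral>\<^sup>+s. e 2 (point3 x s z) \<partial>lborel)"
    and bz: "p (point3 x y z) \<le> 2 * (\<integral>\<^sup>+s. e 3 (point3 x y s) \<partial>lborel)" for x y z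
    using test_function_line_bound[OF \<phi>, of "point3 0 y z" x 1]
      test_function_line_bound[OF \<phi>, of "point3 x 0 z" y 2]
      test_function_line_bound[OF \<phi>, of "point3 x y 0" z 3]
    unfolding p_def e_def by (simp_all add: point3_def add_ac)
  \<comment> \<open>Integrating the line bound in direction 3 over a plane removes the dependence on
    the height, hence the bound on \<open>G p z\<close> is uniform in \<open>z\<close>.\<close>
  define I3 where "I3 = (\<integral>\<^sup>+x. e 3 x \<partial>lborel)"
  have Gp: "G p z \<le> 2 * I3" for z
  proof -
    have "G p z \<le> (\<integral>\<^sup>+r. 2 * (\<integral>\<^sup>+s. e 3 (point3 (fst r) (snd r) s) \<partial>lborel) \<partial>(lborel \<Otimes>\<^sub>M lborel))"
      unfolding G_def by (intro nn_integral_mono bz)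
    also have "\<dots> = 2 * (\<integral>\<^sup>+r. (\<integral>\<^sup>+s. e 3 (point3 (fst r) (snd r) s) \<partial>lborel) \<partial>(lborel \<Otimes>\<^sub>M lborel))"
      by (intro nn_integral_cmult) measurable
    also have "(\<integral>\<^sup>+r. (\<integral>\<^sup>+s. e 3 (point3 (fst r) (snd r) s) \<partial>lborel) \<partial>(lborel \<Otimes>\<^sub>M lborel)) = I3"
    proof -
      interpret P: pair_sigma_finite "lborel \<Otimes>\<^sub>M lborel :: (real \<times> real) measure" "lborel :: real measure"
        by (intro pair_sigma_finite.intro lborel_pair.sigma_finite_measure_axioms lborel.sigma_finite_measure_axioms)
      show ?thesis
        unfolding I3_def nn_integral_point3[OF \<open>e 3 \<in> borel_measurable borel\<close>]
        by (rule P.Fubini'[symmetric]) measurable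
    qed
    finally show ?thesis .
  qed
  have I3: "I3\<^sup>2 \<le> (\<integral>\<^sup>+x. p x \<partial>lborel) * D 3"
  proof -
    have "I3 = (\<integral>\<^sup>+x. ennreal (norm (\<phi> x)) * ennreal (norm (partial 3 \<phi> x)) \<partial>lborel)"
      unfolding I3_def e_def by (simp add: ennreal_mult)
    then show ?thesis
      unfolding D_def p_def
      by (simp add: ennreal_power[symmetric]) (rule Cauchy_Schwarz_nn_integral; measurable)
  qed
  \<comment> \<open>One factor \<open>p\<close> is bounded along the first axis, leaving a function
    of y and z, the other along the second axis, leaving a function of x and z. The plane integral
    therefore factors.\<close>
  have "G (\<lambda>x. (p x)\<^sup>2) z \<le> (2 * G (e 2) z) * (2 * G (e 1) z)" for z
  proof -
    have "G (\<lambda>x. (p x)\<^sup>2) z = (\<integral>\<^sup>+x. \<integral>\<^sup>+y. (p (point3 x y z))\<^sup>2 \<partial>lborel \<partial>lborel)"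
      by (rule G_xy) measurable
    also have "\<dots> \<le> (\<integral>\<^sup>+x. \<integral>\<^sup>+y. (2 * (\<integral>\<^sup>+s. e 2 (point3 x s z) \<partial>lborel)) * (2 * (\<integral>\<^sup>+s. e 1 (point3 s y z) \<partial>lborel)) \<partial>lborel \<partial>lborel)"
      unfolding power2_eq_square by (intro nn_integral_mono mult_mono bx b_y) auto
    also have "\<dots> = (\<integral>\<^sup>+x. (2 * (\<integral>\<^sup>+s. e 2 (point3 x s z) \<partial>lborel)) * (\<integral>\<^sup>+y. (2 * (\<integral>\<^sup>+s. e 1 (point3 s y z) \<partial>lborel)) \<partial>lborel) \<partial>lborel)"
      by (intro nn_integral_cong nn_integral_cmult) measurable
    also have "\<dots> = (\<integral>\<^sup>+x. (2 * (\<integral>\<^sup>+s. e 2 (point3 x s z) \<partial>lborel)) \<partial>lborel) * (\<integral>\<^sup>+y. (2 * (\<integral>\<^sup>+s. e 1 (point3 s y z) \<partial>lborel)) \<partial>lborel)"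
      by (intro nn_integral_multc) measurable
    also have "(\<integral>\<^sup>+x. (2 * (\<integral>\<^sup>+s. e 2 (point3 x s z) \<partial>lborel)) \<partial>lborel) = 2 * G (e 2) z"
      by (subst nn_integral_cmult, measurable) (simp add: G_xy)
    also have "(\<integral>\<^sup>+y. (2 * (\<integral>\<^sup>+s. e 1 (point3 s y z) \<partial>lborel)) \<partial>lborel) = 2 * G (e 1) z"
      by (subst nn_integral_cmult, measurable) (simp add: G_yx)
    finally show ?thesis .
  qed
  then have "(\<integral>\<^sup>+x. (p x)\<^sup>2 \<partial>lborel) \<le> (\<integral>\<^sup>+z. (2 * G (e 2) z) * (2 * G (e 1) z) \<partial>lborel)"
    by (subst total, measurable) (rule nn_integral_mono)
  then have "(\<integral>\<^sup>+x. (p x)\<^sup>2 \<partial>lborel)\<^sup>2 \<le> (\<integral>\<^sup>+z. (2 * G (e 2) z) * (2 * G (e 1) z) \<partial>lborel)\<^sup>2"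
    by (rule power_mono) simp
  \<comment> \<open>Cauchy-Schwarz in the remaining variable z.\<close>
  also have "\<dots> \<le> (\<integral>\<^sup>+z. (2 * G (e 2) z)\<^sup>2 \<partial>lborel) * (\<integral>\<^sup>+z. (2 * G (e 1) z)\<^sup>2 \<partial>lborel)"
    by (rule Cauchy_Schwarz_nn_integral) measurable
  also have "\<dots> \<le> (8 * I3 * D 2) * (8 * I3 * D 1)"
  proof (intro mult_mono)
    have "(\<integral>\<^sup>+z. (2 * G (e i) z)\<^sup>2 \<partial>lborel) \<le> 8 * I3 * D i" for i
    proof -
      have "(\<integral>\<^sup>+z. (2 * G (e i) z)\<^sup>2 \<partial>lborel) \<le> (\<integral>\<^sup>+z. 8 * I3 * G (q i) z \<partial>lborel)"
      proof (rule nn_integral_mono)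
        fix z
        \<comment> \<open>The constant 8 is 4 from the squared line factor times 2 from the bound
          \<open>Gp\<close>; two such factors make 64, whose root is the 8 in the final
          inequality.\<close>
        have "(2 * G (e i) z)\<^sup>2 = 4 * (G (e i) z)\<^sup>2" by (simp add: power_mult_distrib)
        also have "\<dots> \<le> 4 * (2 * I3 * G (q i) z)"
          by (intro mult_left_mono order_trans[OF CS] mult_right_mono Gp) auto
        finally show "(2 * G (e i) z)\<^sup>2 \<le> 8 * I3 * G (q i) z" by (simp add: mult.assoc[symmetric])
      qed
      also have "\<dots> = 8 * I3 * (\<integral>\<^sup>+z. G (q i) z \<partial>lborel)"
        by (rule nn_integral_cmult) measurable
      also have "(\<integral>\<^sup>+z. G (q i) z \<partial>lborel) = D i"
        unfolding D_def by (subst total[symmetric]) (simp_all add: q_def[abs_def])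
      finally show ?thesis .
    qed
    then show "(\<integral>\<^sup>+z. (2 * G (e 2) z)\<^sup>2 \<partial>lborel) \<le> 8 * I3 * D 2"
      "(\<integral>\<^sup>+z. (2 * G (e 1) z)\<^sup>2 \<partial>lborel) \<le> 8 * I3 * D 1" by blast+
  qed auto
  also have "\<dots> = 64 * I3\<^sup>2 * (D 1 * D 2)" by (simp add: power2_eq_square mult_ac)
  also have "\<dots> \<le> 64 * ((\<integral>\<^sup>+x. p x \<partial>lborel) * D 3) * (D 1 * D 2)"
    by (intro mult_right_mono mult_left_mono I3) auto
  finally have "(\<integral>\<^sup>+x. (p x)\<^sup>2 \<partial>lborel)\<^sup>2 \<le> 64 * (\<integral>\<^sup>+x. p x \<partial>lborel) * (D 1 * D 2 * D 3)"
    by (simp add: mult_ac)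
  moreover have "(p x)\<^sup>2 = ennreal ((norm (\<phi> x))^4)" for x
    unfolding p_def by (simp add: ennreal_power flip: power_mult)
  ultimately show ?thesis by (simp add: p_def)
qed


text \<open>Cauchy-Schwarz in every row; the norm of this matrix type is the Frobenius norm.\<close>

lemma norm_matrix_vector_mult_le:
  fixes A :: "real ^ 3 ^ 3"
  shows "norm (A *v x) \<le> norm A * norm x"
proof (rule power2_le_imp_le)
  have "(norm (A *v x))\<^sup>2 = (\<Sum>k\<in>UNIV. (A $ k \<bullet> x)\<^sup>2)"
    unfolding power2_norm_eq_inner by (simp add: inner_vec_def matrix_vector_mult_def power2_eq_square)
  also have "\<dots> \<le> (\<Sum>k\<in>UNIV. (A $ k \<bullet> A $ k) * (x \<bullet> x))"
    by (intro sum_mono Cauchy_Schwarz_ineq)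
  also have "\<dots> = (norm A * norm x)\<^sup>2"
    unfolding power_mult_distrib power2_norm_eq_inner inner_vec_def[of A A] sum_distrib_right ..
  finally show "(norm (A *v x))\<^sup>2 \<le> (norm A * norm x)\<^sup>2" .
qed simp

section \<open>Ladyzhenskaya's inequality for fields on the domain\<close>

context open_domain
begin

lemma nn_integral_test:
  fixes \<phi> :: "vec3 \<Rightarrow> 'b::euclidean_space"
  assumes "\<phi> \<in> test_functions \<Omega>" "f 0 = 0"
  shows "(\<integral>\<^sup>+x. ennreal (f (\<phi> x)) \<partial>lebesgue_on \<Omega>) = (\<integral>\<^sup>+x. ennreal (f (\<phi> x)) \<partial>lborel)"
proof -
  have "(\<integral>\<^sup>+x. ennreal (f (\<phi> x)) \<partial>lebesgue_on \<Omega>) = (\<integral>\<^sup>+x. ennreal (f (\<phi> x)) * indicator \<Omega> x \<partial>lebesgue)"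
    by (subst nn_integral_restrict_space) auto
  also have "\<dots> = (\<integral>\<^sup>+x. ennreal (f (\<phi> x)) \<partial>lebesgue)"
    by (rule nn_integral_cong)
      (use test_functions_zero_outside[OF assms(1)] assms(2) in \<open>auto simp: indicator_def\<close>)
  also have "\<dots> = (\<integral>\<^sup>+x. ennreal (f (\<phi> x)) \<partial>lborel)"
    by (rule nn_integral_completion)
  finally show ?thesis .
qed

lemma nn_integral_norm_power2:
  assumes "u \<in> L2 \<Omega>"
  shows "(\<integral>\<^sup>+x. ennreal ((norm (u x))\<^sup>2) \<partial>lebesgue_on \<Omega>) = ennreal ((l2_norm \<Omega> u)\<^sup>2)"
  using nn_integral_eq_integral[OF L2_integrable[OF assms]]
  by (simp add: l2_norm_power2 l2_inner_def dot_square_norm)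

text \<open>Extended-valued, so that it can be estimated before the fourth power is known to be
  integrable.\<close>

definition quartic :: "field \<Rightarrow> ennreal" where
  "quartic u = (\<integral>\<^sup>+x. ennreal ((norm (u x)) ^ 4) \<partial>lebesgue_on \<Omega>)"

lemma Ladyzhenskaya_test:
  assumes \<phi>: "\<phi> \<in> test_functions \<Omega>"
  shows "quartic \<phi> \<le> ennreal (8 * l2_norm \<Omega> \<phi> * (V_norm \<Omega> \<phi>) ^ 3)"
proof -
  have t: "partial i \<phi> \<in> test_functions \<Omega>" for i by (rule test_functions_partial[OF \<phi>])
  define d where "d i = (l2_norm \<Omega> (partial i \<phi>))\<^sup>2" for i
  have nn: "(\<integral>\<^sup>+x. ennreal ((norm (\<psi> x))\<^sup>2) \<partial>lborel) = ennreal ((l2_norm \<Omega> \<psi>)\<^sup>2)"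
    if "\<psi> \<in> test_functions \<Omega>" for \<psi> :: field
    using nn_integral_test[OF that, of "\<lambda>y. (norm y)\<^sup>2"] nn_integral_norm_power2[OF test_L2[OF that]]
    by simp
  have "(quartic \<phi>)\<^sup>2 \<le> 64 * ennreal ((l2_norm \<Omega> \<phi>)\<^sup>2) * (ennreal (d 1) * ennreal (d 2) * ennreal (d 3))"
    using Ladyzhenskaya_ennreal[OF \<phi>] nn_integral_test[OF \<phi>, of "\<lambda>y. norm y ^ 4"]
    unfolding nn[OF \<phi>] nn[OF t] quartic_def d_def by simp
  also have "\<dots> = ennreal (64 * (l2_norm \<Omega> \<phi>)\<^sup>2 * (d 1 * d 2 * d 3))"
    by (simp add: d_def ennreal_mult)
  also have "\<dots> \<le> ennreal ((8 * l2_norm \<Omega> \<phi> * (V_norm \<Omega> \<phi>) ^ 3)\<^sup>2)"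
  proof (rule ennreal_leI)
    have "(V_norm \<Omega> \<phi>)\<^sup>2 = (\<Sum>i\<in>UNIV. (l2_norm \<Omega> (wpartial \<Omega> i \<phi>))\<^sup>2)"
      unfolding V_norm_power2 stokes_ext_eq_sum[OF test_H1[OF \<phi>] test_H1[OF \<phi>]] l2_norm_power2 ..
    also have "\<dots> = (\<Sum>i\<in>UNIV. d i)"
    proof (rule sum.cong[OF refl])
      fix i
      have "l2_norm \<Omega> (wpartial \<Omega> i \<phi>) = l2_norm \<Omega> (partial i \<phi>)"
        by (rule l2_norm_cong_AE[OF wpartial_AE_eq[OF weak_deriv_test[OF \<phi>]] wpartial_L2[OF test_H1[OF \<phi>]] test_L2[OF t]])
      then show "(l2_norm \<Omega> (wpartial \<Omega> i \<phi>))\<^sup>2 = d i" by (simp add: d_def)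
    qed
    finally have V: "(V_norm \<Omega> \<phi>)\<^sup>2 = d 1 + d 2 + d 3" by (simp add: sum_3)
    have d0: "d i \<ge> 0" for i by (simp add: d_def)
    \<comment> \<open>Each directional term is bounded crudely by the full gradient, which leaves
      the constant 8 unchanged.\<close>
    have "d 1 * d 2 * d 3 \<le> (V_norm \<Omega> \<phi>)\<^sup>2 * (V_norm \<Omega> \<phi>)\<^sup>2 * (V_norm \<Omega> \<phi>)\<^sup>2"
      unfolding V using d0[of 1] d0[of 2] d0[of 3] by (intro mult_mono mult_nonneg_nonneg) auto
    also have "\<dots> = ((V_norm \<Omega> \<phi>) ^ 3)\<^sup>2"
      by (simp add: power2_eq_square power3_eq_cube)
    finally show "64 * (l2_norm \<Omega> \<phi>)\<^sup>2 * (d 1 * d 2 * d 3) \<le> (8 * l2_norm \<Omega> \<phi> * (V_norm \<Omega> \<phi>) ^ 3)\<^sup>2"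
      unfolding power_mult_distrib by (simp add: mult_left_mono)
  qed
  finally have *: "(quartic \<phi>)\<^sup>2 \<le> ennreal ((8 * l2_norm \<Omega> \<phi> * (V_norm \<Omega> \<phi>) ^ 3)\<^sup>2)" .
  \<comment> \<open>Finiteness comes first, so that the square root can be taken among real
    numbers.\<close>
  then have "quartic \<phi> \<noteq> top" by (auto simp: power2_eq_square ennreal_mult_eq_top_iff top_unique)
  then obtain q where q: "q \<ge> 0" "quartic \<phi> = ennreal q" by (cases "quartic \<phi>") auto
  have "q\<^sup>2 \<le> (8 * l2_norm \<Omega> \<phi> * (V_norm \<Omega> \<phi>) ^ 3)\<^sup>2"
    using * q by (simp add: ennreal_power)
  then have "q \<le> 8 * l2_norm \<Omega> \<phi> * (V_norm \<Omega> \<phi>) ^ 3" by (rule power2_le_imp_le) simp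
  then show ?thesis by (simp add: q ennreal_leI)
qed

lemma H10_sequence:
  assumes "z \<in> H10 \<Omega>"
  obtains \<phi> where "\<And>n. \<phi> n \<in> test_functions \<Omega>" "(\<lambda>n. l2_norm \<Omega> (\<lambda>x. z x - \<phi> n x)) \<longlonglongrightarrow> 0"
    "(\<lambda>n. V_norm \<Omega> (\<lambda>x. z x - \<phi> n x)) \<longlonglongrightarrow> 0"
proof -
  have "\<exists>\<phi>. \<phi> \<in> test_functions \<Omega> \<and> l2_norm \<Omega> (\<lambda>x. z x - \<phi> x) < inverse (real (Suc n)) \<and>
      V_norm \<Omega> (\<lambda>x. z x - \<phi> x) < inverse (real (Suc n))" for n
    by (rule H10_approx[OF assms, of "inverse (real (Suc n))"]) auto
  then have "\<exists>\<phi>. \<forall>n. \<phi> n \<in> test_functions \<Omega> \<and> l2_norm \<Omega> (\<lambda>x. z x - \<phi> n x) < inverse (real (Suc n)) \<and>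
      V_norm \<Omega> (\<lambda>x. z x - \<phi> n x) < inverse (real (Suc n))"
    by (intro choice allI)
  then obtain \<phi> where \<phi>: "\<And>n. \<phi> n \<in> test_functions \<Omega>"
    "\<And>n. l2_norm \<Omega> (\<lambda>x. z x - \<phi> n x) < inverse (real (Suc n))"
    "\<And>n. V_norm \<Omega> (\<lambda>x. z x - \<phi> n x) < inverse (real (Suc n))" by auto
  have "(\<lambda>n. l2_norm \<Omega> (\<lambda>x. z x - \<phi> n x)) \<longlonglongrightarrow> 0"
    by (rule Lim_null_comparison[OF _ LIMSEQ_inverse_real_of_nat])
      (auto intro!: always_eventually less_imp_le \<phi>(2) simp del: of_nat_Suc)
  moreover have "(\<lambda>n. V_norm \<Omega> (\<lambda>x. z x - \<phi> n x)) \<longlonglongrightarrow> 0"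
    by (rule Lim_null_comparison[OF _ LIMSEQ_inverse_real_of_nat])
      (auto intro!: always_eventually less_imp_le \<phi>(3) simp del: of_nat_Suc)
  ultimately show ?thesis by (rule that[OF \<phi>(1)])
qed

lemma l2_norm_tendsto:
  assumes "\<And>n. f n \<in> L2 \<Omega>" "z \<in> L2 \<Omega>" "(\<lambda>n. l2_norm \<Omega> (\<lambda>x. z x - f n x)) \<longlonglongrightarrow> 0"
  shows "(\<lambda>n. l2_norm \<Omega> (f n)) \<longlonglongrightarrow> l2_norm \<Omega> z"
proof (rule LIM_zero_cancel, rule Lim_null_comparison[OF _ assms(3)], rule always_eventually, rule allI)
  fix n
  show "norm (l2_norm \<Omega> (f n) - l2_norm \<Omega> z) \<le> l2_norm \<Omega> (\<lambda>x. z x - f n x)"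
    using l2_norm_triangle_sub[OF assms(1,2), of n] l2_norm_triangle_sub[OF assms(2,1), of n]
    by (simp add: l2_norm_diff_commute[of \<Omega> "f n" z] abs_le_iff)
qed

lemma V_norm_tendsto:
  assumes "\<And>n. f n \<in> H1 \<Omega>" "z \<in> H1 \<Omega>" "(\<lambda>n. V_norm \<Omega> (\<lambda>x. z x - f n x)) \<longlonglongrightarrow> 0"
  shows "(\<lambda>n. V_norm \<Omega> (f n)) \<longlonglongrightarrow> V_norm \<Omega> z"
  using assms unfolding V_norm_diff_eq[OF assms(2,1)] unfolding V_norm_def
  by (intro l2_norm_tendsto wgrad_L2) auto

text \<open>Convergence in L4 is not yet available. Approximating test fields converge almost
  everywhere along a subsequence, Fatou's lemma handles the left side, and the right side converges
  because both of its norms do.\<close>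

lemma Ladyzhenskaya_H10:
  assumes z: "z \<in> H10 \<Omega>"
  shows "quartic z \<le> ennreal (8 * l2_norm \<Omega> z * (V_norm \<Omega> z) ^ 3)"
proof -
  obtain \<phi> where \<phi>: "\<And>n. \<phi> n \<in> test_functions \<Omega>" "(\<lambda>n. l2_norm \<Omega> (\<lambda>x. z x - \<phi> n x)) \<longlonglongrightarrow> 0"
    "(\<lambda>n. V_norm \<Omega> (\<lambda>x. z x - \<phi> n x)) \<longlonglongrightarrow> 0" by (rule H10_sequence[OF z]) (rule that)
  have d: "(\<lambda>x. z x - \<phi> n x) \<in> L2 \<Omega>" for n by (intro L2_diff H10_L2 z test_L2 \<phi>(1))
  have "\<exists>r. strict_mono r \<and> (AE x in lebesgue_on \<Omega>. (\<lambda>n. (norm (z x - \<phi> (r n) x))\<^sup>2) \<longlonglongrightarrow> 0)"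
  proof (rule tendsto_L1_AE_subseq)
    show "integrable (lebesgue_on \<Omega>) (\<lambda>x. (norm (z x - \<phi> n x))\<^sup>2)" for n by (rule L2_integrable[OF d])
    have "(\<lambda>n. (l2_norm \<Omega> (\<lambda>x. z x - \<phi> n x))\<^sup>2) \<longlonglongrightarrow> 0\<^sup>2" by (intro tendsto_intros \<phi>(2))
    then show "(\<lambda>n. LINT x|lebesgue_on \<Omega>. norm ((norm (z x - \<phi> n x))\<^sup>2)) \<longlonglongrightarrow> 0"
      by (simp add: l2_norm_power2 l2_inner_def dot_square_norm)
  qed
  then obtain r where r: "strict_mono r"
    "AE x in lebesgue_on \<Omega>. (\<lambda>n. (norm (z x - \<phi> (r n) x))\<^sup>2) \<longlonglongrightarrow> 0" by blast
  have "AE x in lebesgue_on \<Omega>. ennreal (norm (z x) ^ 4) = liminf (\<lambda>n. ennreal (norm (\<phi> (r n) x) ^ 4))"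
    using r(2)
  proof eventually_elim
    case (elim x)
    have "(\<lambda>n. sqrt ((norm (z x - \<phi> (r n) x))\<^sup>2)) \<longlonglongrightarrow> sqrt 0"
      using elim by (rule tendsto_real_sqrt)
    then have "(\<lambda>n. z x - \<phi> (r n) x) \<longlonglongrightarrow> 0" by (simp add: tendsto_norm_zero_iff)
    then have "(\<lambda>n. z x - (z x - \<phi> (r n) x)) \<longlonglongrightarrow> z x - 0" by (intro tendsto_intros)
    then have "(\<lambda>n. ennreal (norm (\<phi> (r n) x) ^ 4)) \<longlonglongrightarrow> ennreal (norm (z x) ^ 4)"
      by (intro tendsto_ennrealI tendsto_intros) simp
    then show ?case by (rule lim_imp_Liminf[OF trivial_limit_sequentially, symmetric])
  qed
  then have "quartic z = (\<integral>\<^sup>+x. liminf (\<lambda>n. ennreal (norm (\<phi> (r n) x) ^ 4)) \<partial>lebesgue_on \<Omega>)"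
    unfolding quartic_def by (rule nn_integral_cong_AE)
  also have "\<dots> \<le> liminf (\<lambda>n. quartic (\<phi> (r n)))"
    unfolding quartic_def
  proof (rule nn_integral_liminf)
    fix n
    have "\<phi> (r n) \<in> borel_measurable (lebesgue_on \<Omega>)" by (rule L2_measurable[OF test_L2[OF \<phi>(1)]])
    then show "(\<lambda>x. ennreal (norm (\<phi> (r n) x) ^ 4)) \<in> borel_measurable (lebesgue_on \<Omega>)" by measurable
  qed
  also have "\<dots> \<le> liminf (\<lambda>n. ennreal (8 * l2_norm \<Omega> (\<phi> (r n)) * (V_norm \<Omega> (\<phi> (r n))) ^ 3))"
    by (intro Liminf_mono always_eventually allI Ladyzhenskaya_test \<phi>(1))
  also have "\<dots> = ennreal (8 * l2_norm \<Omega> z * (V_norm \<Omega> z) ^ 3)"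
  proof (rule lim_imp_Liminf[OF trivial_limit_sequentially])
    have "(\<lambda>n. l2_norm \<Omega> (\<phi> n)) \<longlonglongrightarrow> l2_norm \<Omega> z"
      by (rule l2_norm_tendsto[OF test_L2[OF \<phi>(1)] H10_L2[OF z] \<phi>(2)])
    moreover have "(\<lambda>n. V_norm \<Omega> (\<phi> n)) \<longlonglongrightarrow> V_norm \<Omega> z"
      by (rule V_norm_tendsto[OF test_H1[OF \<phi>(1)] H10_H1[OF z] \<phi>(3)])
    ultimately have "(\<lambda>n. ennreal (8 * l2_norm \<Omega> (\<phi> n) * (V_norm \<Omega> (\<phi> n)) ^ 3))
        \<longlonglongrightarrow> ennreal (8 * l2_norm \<Omega> z * (V_norm \<Omega> z) ^ 3)"
      by (intro tendsto_ennrealI tendsto_intros)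
    from LIMSEQ_subseq_LIMSEQ[OF this r(1)]
    show "(\<lambda>n. ennreal (8 * l2_norm \<Omega> (\<phi> (r n)) * (V_norm \<Omega> (\<phi> (r n))) ^ 3))
        \<longlonglongrightarrow> ennreal (8 * l2_norm \<Omega> z * (V_norm \<Omega> z) ^ 3)"
      by (simp add: o_def)
  qed
  finally show ?thesis .
qed

text \<open>The square of the L4 norm, phrased as an L2 norm so that the L2 Cauchy-Schwarz
  inequality applies to it.\<close>

abbreviation L4_norm_sq :: "field \<Rightarrow> real" where
  "L4_norm_sq z \<equiv> l2_norm \<Omega> (\<lambda>x. (norm (z x))\<^sup>2)"

lemma H10_norm_sq_L2:
  assumes "z \<in> H10 \<Omega>"
  shows "(\<lambda>x. (norm (z x))\<^sup>2) \<in> L2 \<Omega>"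
proof -
  have m: "z \<in> borel_measurable (lebesgue_on \<Omega>)" by (rule L2_measurable[OF H10_L2[OF assms]])
  have "integrable (lebesgue_on \<Omega>) (\<lambda>x. norm (z x) ^ 4)"
  proof (rule integrableI_nonneg)
    show "(\<lambda>x. norm (z x) ^ 4) \<in> borel_measurable (lebesgue_on \<Omega>)" using m by measurable
    show "(\<integral>\<^sup>+x. ennreal (norm (z x) ^ 4) \<partial>lebesgue_on \<Omega>) < \<infinity>"
      using Ladyzhenskaya_H10[OF assms] unfolding quartic_def by (rule le_less_trans) simp
  qed simp
  moreover have "(\<lambda>x. (norm (z x))\<^sup>2) \<in> borel_measurable (lebesgue_on \<Omega>)" using m by measurable
  ultimately show ?thesis by (simp add: L2_def flip: power_mult)
qed

lemma Ladyzhenskaya: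
  assumes "z \<in> H10 \<Omega>"
  shows "(L4_norm_sq z)\<^sup>2 \<le> 8 * l2_norm \<Omega> z * (V_norm \<Omega> z) ^ 3"
proof -
  have "ennreal ((L4_norm_sq z)\<^sup>2) = quartic z"
    using nn_integral_norm_power2[OF H10_norm_sq_L2[OF assms]]
    by (simp add: quartic_def flip: power_mult)
  then have "ennreal ((L4_norm_sq z)\<^sup>2) \<le> ennreal (8 * l2_norm \<Omega> z * (V_norm \<Omega> z) ^ 3)"
    using Ladyzhenskaya_H10[OF assms] by simp
  then show ?thesis by (subst (asm) ennreal_le_iff) simp_all
qed


section \<open>The trilinear form\<close>

text \<open>Hoelder's inequality with exponents 2, 4, 4, as two applications of Cauchy-Schwarz. The
  matrix field \<open>G\<close> is arbitrary so that a chosen gradient may be exchanged for another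
  representative.\<close>

lemma trilinear_bound:
  assumes G: "G \<in> L2 \<Omega>" and a: "a \<in> H10 \<Omega>" and b: "b \<in> H10 \<Omega>"
  shows "integrable (lebesgue_on \<Omega>) (\<lambda>x. (G x *v a x) \<bullet> b x)"
    and "\<bar>l2_inner \<Omega> (\<lambda>x. G x *v a x) b\<bar> \<le> l2_norm \<Omega> G * sqrt (L4_norm_sq a * L4_norm_sq b)"
proof -
  have m: "G \<in> borel_measurable (lebesgue_on \<Omega>)" "a \<in> borel_measurable (lebesgue_on \<Omega>)"
    "b \<in> borel_measurable (lebesgue_on \<Omega>)"
    using G a b by (auto intro: L2_measurable H10_L2)
  define y where "y x = norm (a x) * norm (b x)" for x
  define g where "g x = norm (G x)" for x
  have y: "y \<in> L2 \<Omega>"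
  proof (rule L2_I_bound)
    show "y \<in> borel_measurable (lebesgue_on \<Omega>)" unfolding y_def[abs_def] using m by measurable
    show "integrable (lebesgue_on \<Omega>) (\<lambda>x. (norm (a x))\<^sup>2 \<bullet> (norm (b x))\<^sup>2)"
      by (rule L2_inner_integrable[OF H10_norm_sq_L2[OF a] H10_norm_sq_L2[OF b]])
  qed (simp add: y_def power_mult_distrib)
  have g: "g \<in> L2 \<Omega>" unfolding g_def[abs_def] using G by (auto simp: L2_def)
  have bound: "\<bar>(G x *v a x) \<bullet> b x\<bar> \<le> g x \<bullet> y x" for x
  proof -
    have "\<bar>(G x *v a x) \<bullet> b x\<bar> \<le> norm (G x *v a x) * norm (b x)" by (rule Cauchy_Schwarz_ineq2)
    also have "\<dots> \<le> norm (G x) * norm (a x) * norm (b x)"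
      by (intro mult_right_mono norm_matrix_vector_mult_le) simp
    finally show ?thesis by (simp add: g_def y_def mult.assoc)
  qed
  have gy: "integrable (lebesgue_on \<Omega>) (\<lambda>x. g x \<bullet> y x)" by (rule L2_inner_integrable[OF g y])
  show int: "integrable (lebesgue_on \<Omega>) (\<lambda>x. (G x *v a x) \<bullet> b x)"
  proof (rule Bochner_Integration.integrable_bound[OF gy])
    have "(\<lambda>x. (G x *v a x) \<bullet> b x) = (\<lambda>x. \<Sum>k\<in>UNIV. (\<Sum>i\<in>UNIV. G x $ k $ i * a x $ i) * b x $ k)"
      by (simp add: inner_vec_def matrix_vector_mult_def)
    moreover have "(\<lambda>x. G x $ k $ i) \<in> borel_measurable (lebesgue_on \<Omega>)" for k i
      by (rule borel_measurable_continuous_on[OF _ m(1), of "\<lambda>A. A $ k $ i"]) (intro continuous_intros)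
    moreover have "(\<lambda>x. a x $ i) \<in> borel_measurable (lebesgue_on \<Omega>)" "(\<lambda>x. b x $ i) \<in> borel_measurable (lebesgue_on \<Omega>)" for i
      by (rule borel_measurable_continuous_on[OF _ m(2), of "\<lambda>A. A $ i"]
          borel_measurable_continuous_on[OF _ m(3), of "\<lambda>A. A $ i"], intro continuous_intros)+
    ultimately show "(\<lambda>x. (G x *v a x) \<bullet> b x) \<in> borel_measurable (lebesgue_on \<Omega>)" by simp
    show "AE x in lebesgue_on \<Omega>. norm ((G x *v a x) \<bullet> b x) \<le> norm (g x \<bullet> y x)"
      using bound by (intro AE_I2) (metis abs_ge_self order_trans real_norm_def)
  qed
  have "\<bar>l2_inner \<Omega> (\<lambda>x. G x *v a x) b\<bar> \<le> (LINT x|lebesgue_on \<Omega>. \<bar>(G x *v a x) \<bullet> b x\<bar>)"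
    unfolding l2_inner_def by (rule integral_abs_bound)
  also have "\<dots> \<le> l2_inner \<Omega> g y"
    unfolding l2_inner_def using int gy bound by (intro integral_mono) auto
  also have "\<dots> \<le> l2_norm \<Omega> g * l2_norm \<Omega> y" using l2_Cauchy_Schwarz[OF g y] by simp
  also have "l2_norm \<Omega> g = l2_norm \<Omega> G"
    by (simp add: l2_norm_def l2_inner_def g_def dot_square_norm power2_eq_square)
  also have "l2_norm \<Omega> y \<le> sqrt (L4_norm_sq a * L4_norm_sq b)"
  proof -
    have "l2_inner \<Omega> y y = l2_inner \<Omega> (\<lambda>x. (norm (a x))\<^sup>2) (\<lambda>x. (norm (b x))\<^sup>2)"
      by (simp add: l2_inner_def y_def power2_eq_square mult_ac)
    also have "\<dots> \<le> L4_norm_sq a * L4_norm_sq b"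
      using l2_Cauchy_Schwarz[OF H10_norm_sq_L2[OF a] H10_norm_sq_L2[OF b]] by simp
    finally show ?thesis unfolding l2_norm_def[of _ y] by simp
  qed
  finally show "\<bar>l2_inner \<Omega> (\<lambda>x. G x *v a x) b\<bar> \<le> l2_norm \<Omega> G * sqrt (L4_norm_sq a * L4_norm_sq b)"
    by (simp add: mult_left_mono)
qed

lemma B_form_bound:
  assumes "v \<in> H1 \<Omega>" "a \<in> H10 \<Omega>" "b \<in> H10 \<Omega>"
  shows "\<bar>B_form \<Omega> a v b\<bar> \<le> V_norm \<Omega> v * sqrt (L4_norm_sq a * L4_norm_sq b)"
  unfolding B_form_def V_norm_def by (rule trilinear_bound(2)[OF wgrad_L2[OF assms(1)] assms(2,3)])

lemma B_form_cong_AE: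
  assumes "v \<in> H1 \<Omega>" "G \<in> L2 \<Omega>" "a \<in> H10 \<Omega>" "b \<in> H10 \<Omega>" "AE x in lebesgue_on \<Omega>. wgrad \<Omega> v x = G x"
  shows "B_form \<Omega> a v b = l2_inner \<Omega> (\<lambda>x. G x *v a x) b"
  unfolding B_form_def l2_inner_def
proof (rule integral_cong_AE)
  show "AE x in lebesgue_on \<Omega>. (wgrad \<Omega> v x *v a x) \<bullet> b x = (G x *v a x) \<bullet> b x"
    using assms(5) by eventually_elim simp
qed (use trilinear_bound(1)[OF wgrad_L2[OF assms(1)] assms(3,4)] trilinear_bound(1)[OF assms(2-4)] in auto)

lemma B_form_diff_first:
  assumes "a \<in> H10 \<Omega>" "a' \<in> H10 \<Omega>" "v \<in> H1 \<Omega>" "b \<in> H10 \<Omega>"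
  shows "B_form \<Omega> (\<lambda>x. a x - a' x) v b = B_form \<Omega> a v b - B_form \<Omega> a' v b"
  unfolding B_form_def l2_inner_def
  by (simp add: matrix_vector_mult_diff_distrib inner_diff_left trilinear_bound(1)[OF wgrad_L2] assms)

lemma B_form_diff_second:
  assumes "a \<in> H10 \<Omega>" "v \<in> H1 \<Omega>" "v' \<in> H1 \<Omega>" "b \<in> H10 \<Omega>"
  shows "B_form \<Omega> a (\<lambda>x. v x - v' x) b = B_form \<Omega> a v b - B_form \<Omega> a v' b"
proof -
  have "B_form \<Omega> a (\<lambda>x. v x - v' x) b = l2_inner \<Omega> (\<lambda>x. (wgrad \<Omega> v x - wgrad \<Omega> v' x) *v a x) b"
    by (intro B_form_cong_AE H1_diff L2_diff wgrad_L2 wgrad_diff assms)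
  then show ?thesis
    unfolding B_form_def l2_inner_def
    by (simp add: matrix_vector_mult_diff_rdistrib inner_diff_left trilinear_bound(1)[OF wgrad_L2] assms)
qed

lemma B_form_diff_third:
  assumes "a \<in> H10 \<Omega>" "v \<in> H1 \<Omega>" "b \<in> H10 \<Omega>" "b' \<in> H10 \<Omega>"
  shows "B_form \<Omega> a v (\<lambda>x. b x - b' x) = B_form \<Omega> a v b - B_form \<Omega> a v b'"
  unfolding B_form_def l2_inner_def
  by (simp add: inner_diff_right trilinear_bound(1)[OF wgrad_L2] assms)

lemma L4_norm_sq_tendsto_0:
  assumes "\<And>n. f n \<in> H10 \<Omega>" "(\<lambda>n. l2_norm \<Omega> (f n)) \<longlonglongrightarrow> 0" "(\<lambda>n. V_norm \<Omega> (f n)) \<longlonglongrightarrow> 0"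
  shows "(\<lambda>n. L4_norm_sq (f n)) \<longlonglongrightarrow> 0"
proof -
  have "(\<lambda>n. sqrt (8 * l2_norm \<Omega> (f n) * (V_norm \<Omega> (f n)) ^ 3)) \<longlonglongrightarrow> sqrt (8 * 0 * 0 ^ 3)"
    by (intro tendsto_intros assms)
  then have "(\<lambda>n. sqrt (8 * l2_norm \<Omega> (f n) * (V_norm \<Omega> (f n)) ^ 3)) \<longlonglongrightarrow> 0" by simp
  then show ?thesis
  proof (rule Lim_null_comparison[rotated], intro always_eventually allI)
    fix n
    have "sqrt ((L4_norm_sq (f n))\<^sup>2) \<le> sqrt (8 * l2_norm \<Omega> (f n) * (V_norm \<Omega> (f n)) ^ 3)"
      by (intro real_sqrt_le_mono Ladyzhenskaya assms)
    then show "norm (L4_norm_sq (f n)) \<le> sqrt (8 * l2_norm \<Omega> (f n) * (V_norm \<Omega> (f n)) ^ 3)" by simp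
  qed
qed

text \<open>For a divergence-free test field \<open>\<psi>\<close> the integrand is the divergence of \<open>|\<phi>|\<^sup>2 \<psi> / 2\<close>.\<close>

lemma divfree_convection_zero:
  assumes \<psi>: "\<psi> \<in> divfree_test_functions \<Omega>" and \<phi>: "\<phi> \<in> test_functions \<Omega>"
  shows "(LINT x|lebesgue_on \<Omega>. (\<Sum>i\<in>UNIV. \<psi> x $ i * (partial i \<phi> x \<bullet> \<phi> x))) = 0"
proof -
  have \<psi>t: "\<psi> \<in> test_functions \<Omega>" and div: "\<And>x. (\<Sum>i\<in>UNIV. partial i \<psi> x $ i) = 0"
    using \<psi> by (auto simp: divfree_test_functions_def)
  obtain K where K: "compact K" "\<And>x. x \<notin> K \<Longrightarrow> \<phi> x = 0"
    by (rule test_functionsE[OF \<phi>]) blast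
  have cont: "continuous_on UNIV \<phi>" "continuous_on UNIV \<psi>"
      "continuous_on UNIV (partial i \<phi>)" "continuous_on UNIV (partial i \<psi>)" for i
    using \<phi> \<psi>t by (auto intro!: smooth_continuous_on test_functions_smooth test_functions_partial)
  have \<phi>d: "(\<phi> has_derivative frechet_derivative \<phi> (at x)) (at x)" for x
    by (rule smooth_has_derivative[OF test_functions_smooth[OF \<phi>]])
  have \<psi>d: "(\<psi> has_derivative frechet_derivative \<psi> (at x)) (at x)" for x
    by (rule smooth_has_derivative[OF test_functions_smooth[OF \<psi>t]])
  define f where "f i x = \<psi> x $ i * (\<phi> x \<bullet> \<phi> x)" for i x
  have D: "(f i has_derivative (\<lambda>h. \<psi> x $ i * (\<phi> x \<bullet> frechet_derivative \<phi> (at x) h + frechet_derivative \<phi> (at x) h \<bullet> \<phi> x)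
      + frechet_derivative \<psi> (at x) h $ i * (\<phi> x \<bullet> \<phi> x))) (at x)" for i x
    unfolding f_def
    by (intro has_derivative_mult has_derivative_inner \<phi>d
        bounded_linear.has_derivative[OF bounded_linear_vec_nth \<psi>d])
  have pf: "partial i (f i) = (\<lambda>x. 2 * (\<psi> x $ i * (partial i \<phi> x \<bullet> \<phi> x)) + partial i \<psi> x $ i * (\<phi> x \<bullet> \<phi> x))" for i
    using has_derivative_imp_partial[OF D, of i i] by (simp add: inner_commute algebra_simps)
  have c: "continuous_on UNIV (partial i (f i))" for i
    unfolding pf by (intro continuous_intros cont)
  have z: "f i x = 0" if "x \<notin> K" for i x using K(2)[OF that] by (simp add: f_def)
  have int0: "integral\<^sup>L lborel (partial i (f i)) = 0" for i
    by (rule integral_partial_eq_0[OF _ c K(1) z]) (use D in \<open>auto simp: differentiable_def\<close>)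
  have int: "integrable lborel (partial i (f i))" for i
    by (rule integrable_compact_support[OF c K(1)]) (rule partial_zero_outside[OF K(1) z])
  have "0 = (\<Sum>i\<in>UNIV. integral\<^sup>L lborel (partial i (f i)))" using int0 by simp
  also have "\<dots> = (LINT x|lborel. (\<Sum>i\<in>UNIV. partial i (f i) x))"
    using int by (intro Bochner_Integration.integral_sum[symmetric]) auto
  also have "(\<lambda>x. \<Sum>i\<in>UNIV. partial i (f i) x) = (\<lambda>x. 2 * (\<Sum>i\<in>UNIV. \<psi> x $ i * (partial i \<phi> x \<bullet> \<phi> x)))"
    unfolding fun_cong[OF pf]
    by (simp add: sum.distrib sum_distrib_left[symmetric] sum_distrib_right[symmetric] div)
  also have "(LINT x|lborel. 2 * (\<Sum>i\<in>UNIV. \<psi> x $ i * (partial i \<phi> x \<bullet> \<phi> x)))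
      = 2 * (LINT x|lborel. (\<Sum>i\<in>UNIV. \<psi> x $ i * (partial i \<phi> x \<bullet> \<phi> x)))" by simp
  also have "(LINT x|lborel. (\<Sum>i\<in>UNIV. \<psi> x $ i * (partial i \<phi> x \<bullet> \<phi> x)))
      = (LINT x|lebesgue_on \<Omega>. (\<Sum>i\<in>UNIV. \<psi> x $ i * (partial i \<phi> x \<bullet> \<phi> x)))"
    by (rule lebesgue_on_eq_lborel(1)[symmetric])
      (auto intro!: borel_measurable_continuous_onI continuous_intros cont
        simp: test_functions_zero_outside[OF \<phi>])
  finally show ?thesis by simp
qed

text \<open>Divergence-free test fields approximate \<open>u\<close> in the L2 norm only. This
  suffices while \<open>\<phi>\<close> is a fixed test field, since the form is then the inner
  product of \<open>u\<close> with a square integrable field. Hence \<open>u\<close> is approximated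
  before the other argument.\<close>

lemma B_form_test_zero:
  assumes u: "u \<in> space_H \<Omega>" "u \<in> H10 \<Omega>" and \<phi>: "\<phi> \<in> test_functions \<Omega>"
  shows "B_form \<Omega> u \<phi> \<phi> = 0"
proof -
  have t: "partial i \<phi> \<in> test_functions \<Omega>" for i by (rule test_functions_partial[OF \<phi>])
  have cont: "continuous_on UNIV \<phi>" "continuous_on UNIV (partial i \<phi>)" for i
    using \<phi> t by (auto intro!: smooth_continuous_on test_functions_smooth)
  obtain K where K: "compact K" "\<And>x. x \<notin> K \<Longrightarrow> \<phi> x = 0"
    by (rule test_functionsE[OF \<phi>]) blast
  obtain B where B: "\<And>x. norm (\<phi> x) \<le> B"
    using compact_support_bounded[OF cont(1) K] by blast
  \<comment> \<open>\<open>k\<close> is the gradient of half the squared norm of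
    \<open>\<phi>\<close>.\<close>
  define k :: field where "k x = (\<chi> i. partial i \<phi> x \<bullet> \<phi> x)" for x
  have k: "k \<in> L2 \<Omega>"
  proof (rule L2_I_bound)
    have "continuous_on UNIV k"
      unfolding k_def[abs_def] by (intro continuous_intros cont)
    then show "k \<in> borel_measurable (lebesgue_on \<Omega>)"
      by (intro measurable_lebesgue_on_borel borel_measurable_continuous_onI)
    show "integrable (lebesgue_on \<Omega>) (\<lambda>x. \<Sum>i\<in>UNIV. B\<^sup>2 * (norm (partial i \<phi> x))\<^sup>2)"
      using L2_integrable[OF test_L2[OF t]] by simp
    fix x
    have "(norm (k x))\<^sup>2 = (\<Sum>i\<in>UNIV. (partial i \<phi> x \<bullet> \<phi> x)\<^sup>2)"
      unfolding power2_norm_eq_inner by (simp add: inner_vec_def k_def power2_eq_square)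
    also have "\<dots> \<le> (\<Sum>i\<in>UNIV. B\<^sup>2 * (norm (partial i \<phi> x))\<^sup>2)"
    proof (rule sum_mono)
      fix i
      have "(partial i \<phi> x \<bullet> \<phi> x)\<^sup>2 \<le> (norm (partial i \<phi> x))\<^sup>2 * (norm (\<phi> x))\<^sup>2"
        using Cauchy_Schwarz_ineq[of "partial i \<phi> x" "\<phi> x"] by (simp add: power2_norm_eq_inner)
      also have "\<dots> \<le> (norm (partial i \<phi> x))\<^sup>2 * B\<^sup>2"
        by (intro mult_left_mono power_mono B) auto
      finally show "(partial i \<phi> x \<bullet> \<phi> x)\<^sup>2 \<le> B\<^sup>2 * (norm (partial i \<phi> x))\<^sup>2" by (simp add: mult.commute)
    qed
    finally show "(norm (k x))\<^sup>2 \<le> (\<Sum>i\<in>UNIV. B\<^sup>2 * (norm (partial i \<phi> x))\<^sup>2)" .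
  qed
  have inner_k: "a x \<bullet> k x = (\<Sum>i\<in>UNIV. a x $ i * (partial i \<phi> x \<bullet> \<phi> x))" for a x
    by (simp add: inner_vec_def k_def)
  have orth: "l2_inner \<Omega> \<psi> k = 0" if "\<psi> \<in> divfree_test_functions \<Omega>" for \<psi>
    unfolding l2_inner_def inner_k by (rule divfree_convection_zero[OF that \<phi>])
  have "B_form \<Omega> u \<phi> \<phi> = l2_inner \<Omega> (\<lambda>x. (\<chi> k i. partial i \<phi> x $ k) *v u x) \<phi>"
  proof (rule B_form_cong_AE[OF test_H1[OF \<phi>] _ u(2) test_H10[OF \<phi>] wgrad_test[OF \<phi>]])
    have "(\<lambda>x. \<chi> k i. partial i \<phi> x $ k) = (\<lambda>x. \<Sum>i\<in>UNIV. column_matrix i (partial i \<phi> x))"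
      by (simp add: fun_eq_iff vec_eq_iff column_matrix_def)
    then show "(\<lambda>x. \<chi> k i. partial i \<phi> x $ k) \<in> L2 \<Omega>"
      by (simp add: L2_sum L2_linear_image[OF bounded_linear_column_matrix] test_L2[OF t])
  qed
  also have "\<dots> = l2_inner \<Omega> u k"
    unfolding l2_inner_def inner_k
    by (simp add: matrix_vector_mult_def inner_vec_def sum_3 algebra_simps)
  finally have eq: "B_form \<Omega> u \<phi> \<phi> = l2_inner \<Omega> u k" .
  have "\<bar>l2_inner \<Omega> u k\<bar> \<le> 0"
  proof (rule field_le_epsilon)
    fix e :: real assume "e > 0"
    have N: "l2_norm \<Omega> k + 1 > 0" using l2_norm_nonneg[of \<Omega> k] by linarith
    then have "e / (l2_norm \<Omega> k + 1) > 0" using \<open>e > 0\<close> by simp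
    then obtain \<psi> where \<psi>: "\<psi> \<in> divfree_test_functions \<Omega>" "l2_norm \<Omega> (\<lambda>x. u x - \<psi> x) < e / (l2_norm \<Omega> k + 1)"
      using u(1) unfolding space_H_def by blast
    have L: "u \<in> L2 \<Omega>" "\<psi> \<in> L2 \<Omega>"
      using u(1) \<psi>(1) by (auto intro: space_H_L2 test_L2 simp: divfree_test_functions_def)
    have "l2_inner \<Omega> u k = l2_inner \<Omega> (\<lambda>x. u x - \<psi> x) k"
      by (simp add: l2_inner_diff_left[OF L k] orth[OF \<psi>(1)])
    also have "\<bar>\<dots>\<bar> \<le> l2_norm \<Omega> (\<lambda>x. u x - \<psi> x) * l2_norm \<Omega> k"
      by (intro l2_Cauchy_Schwarz L2_diff L k)
    also have "\<dots> \<le> (e / (l2_norm \<Omega> k + 1)) * (l2_norm \<Omega> k + 1)"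
      using \<psi>(2) N \<open>e > 0\<close> by (intro mult_mono) auto
    finally show "\<bar>l2_inner \<Omega> u k\<bar> \<le> 0 + e" using N by simp
  qed
  then show ?thesis by (simp add: eq)
qed

text \<open>The second limit, with \<open>u\<close> fixed: replacing \<open>z\<close> by a test
  field in either slot costs an error that is linear in the difference, and the trilinear bound with
  Ladyzhenskaya's inequality makes it vanish.\<close>

lemma B_form_self_zero:
  assumes u: "u \<in> space_V \<Omega>" and z: "z \<in> H10 \<Omega>"
  shows "B_form \<Omega> u z z = 0"
proof -
  obtain \<phi> where \<phi>: "\<And>n. \<phi> n \<in> test_functions \<Omega>" "(\<lambda>n. l2_norm \<Omega> (\<lambda>x. z x - \<phi> n x)) \<longlonglongrightarrow> 0"
    "(\<lambda>n. V_norm \<Omega> (\<lambda>x. z x - \<phi> n x)) \<longlonglongrightarrow> 0" by (rule H10_sequence[OF z]) (rule that)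
  let ?d = "\<lambda>n x. z x - \<phi> n x"
  have H: "u \<in> H10 \<Omega>" "\<phi> n \<in> H10 \<Omega>" "?d n \<in> H10 \<Omega>" for n
    using u z \<phi>(1) by (auto intro: space_V_H10 test_H10 H10_diff)
  note H1 = H[THEN H10_H1]
  define b where "b n = V_norm \<Omega> (?d n) * sqrt (L4_norm_sq u * L4_norm_sq z)
      + V_norm \<Omega> (\<phi> n) * sqrt (L4_norm_sq u * L4_norm_sq (?d n))" for n
  have "\<bar>B_form \<Omega> u z z\<bar> \<le> b n" for n
  proof -
    have "B_form \<Omega> u (?d n) z = B_form \<Omega> u z z - B_form \<Omega> u (\<phi> n) z"
      by (rule B_form_diff_second[OF H(1) H10_H1[OF z] H1(2) z])
    moreover have "B_form \<Omega> u (\<phi> n) (?d n) = B_form \<Omega> u (\<phi> n) z - B_form \<Omega> u (\<phi> n) (\<phi> n)"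
      by (rule B_form_diff_third[OF H(1) H1(2) z H(2)])
    moreover have "B_form \<Omega> u (\<phi> n) (\<phi> n) = 0"
      by (rule B_form_test_zero[OF space_V_H[OF u] H(1) \<phi>(1)])
    ultimately show ?thesis
      using B_form_bound[OF H1(3)[of n] H(1) z] B_form_bound[OF H1(2)[of n] H(1) H(3)[of n]]
      unfolding b_def by linarith
  qed
  moreover have "b \<longlonglongrightarrow> 0 * sqrt (L4_norm_sq u * L4_norm_sq z) + V_norm \<Omega> z * sqrt (L4_norm_sq u * 0)"
    unfolding b_def
    by (intro tendsto_intros \<phi>(3) V_norm_tendsto[OF H1(2) H10_H1[OF z] \<phi>(3)]
        L4_norm_sq_tendsto_0[OF H(3) \<phi>(2,3)])
  ultimately have "\<bar>B_form \<Omega> u z z\<bar> \<le> 0" by (intro LIMSEQ_le_const[where X = b]) auto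
  then show ?thesis by simp
qed

end


section \<open>Absolutely continuous functions\<close>

definition nonoverlapping :: "real \<Rightarrow> real \<Rightarrow> (real \<times> real) set \<Rightarrow> bool" where
  "nonoverlapping a b I \<longleftrightarrow> finite I \<and> (\<forall>(s, t) \<in> I. a \<le> s \<and> s \<le> t \<and> t \<le> b) \<and>
     pairwise (\<lambda>p q. {fst p<..<snd p} \<inter> {fst q<..<snd q} = {}) I"

text \<open>For \<open>D s t = |F t - F s|\<close> this is the absolute continuity of \<open>F\<close> on \<open>[a, b]\<close>.\<close>

definition ac_increment :: "(real \<Rightarrow> real \<Rightarrow> real) \<Rightarrow> real \<Rightarrow> real \<Rightarrow> bool" where
  "ac_increment D a b \<longleftrightarrow> (\<forall>\<epsilon>>0. \<exists>\<delta>>0. \<forall>I. nonoverlapping a b I \<and> (\<Sum>(s, t) \<in> I. t - s) < \<delta>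
     \<longrightarrow> (\<Sum>(s, t) \<in> I. D s t) < \<epsilon>)"

lemma ac_incrementE:
  assumes "ac_increment D a b" "\<epsilon> > 0"
  obtains \<delta> where "\<delta> > 0"
    "\<forall>I. nonoverlapping a b I \<and> (\<Sum>(s, t) \<in> I. t - s) < \<delta> \<longrightarrow> (\<Sum>(s, t) \<in> I. D s t) < \<epsilon>"
  using assms unfolding ac_increment_def by blast

text \<open>Increments are abstract functions of two times, so passing from curves in V to real
  functions such as the energy is a single comparison of increments.\<close>

lemma ac_increment_mono:
  assumes D: "ac_increment D a b" and "M > 0"
    and le: "\<And>s t. a \<le> s \<Longrightarrow> s \<le> t \<Longrightarrow> t \<le> b \<Longrightarrow> D' s t \<le> M * D s t"
  shows "ac_increment D' a b"
  unfolding ac_increment_def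
proof (intro allI impI)
  fix \<epsilon> :: real assume "\<epsilon> > 0"
  then have "\<epsilon> / M > 0" using \<open>M > 0\<close> by simp
  then obtain \<delta> where \<delta>: "\<delta> > 0"
    "\<forall>I. nonoverlapping a b I \<and> (\<Sum>(s, t) \<in> I. t - s) < \<delta> \<longrightarrow> (\<Sum>(s, t) \<in> I. D s t) < \<epsilon> / M"
    by (rule ac_incrementE[OF D])
  show "\<exists>\<delta>>0. \<forall>I. nonoverlapping a b I \<and> (\<Sum>(s, t) \<in> I. t - s) < \<delta> \<longrightarrow> (\<Sum>(s, t) \<in> I. D' s t) < \<epsilon>"
  proof (intro exI conjI allI impI, rule \<delta>(1))
    fix I assume I: "nonoverlapping a b I \<and> (\<Sum>(s, t) \<in> I. t - s) < \<delta>"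
    have "(\<Sum>(s, t) \<in> I. D' s t) \<le> (\<Sum>(s, t) \<in> I. M * D s t)"
      by (rule sum_mono) (use I le in \<open>auto simp: nonoverlapping_def\<close>)
    also have "\<dots> = M * (\<Sum>(s, t) \<in> I. D s t)" by (simp add: sum_distrib_left case_prod_unfold)
    also have "\<dots> < M * (\<epsilon> / M)"
      using \<open>M > 0\<close> \<delta>(2) I by (intro mult_strict_left_mono) auto
    finally show "(\<Sum>(s, t) \<in> I. D' s t) < \<epsilon>" using \<open>M > 0\<close> by simp
  qed
qed

lemma ac_increment_add:
  assumes D1: "ac_increment D1 a b" and D2: "ac_increment D2 a b"
  shows "ac_increment (\<lambda>s t. D1 s t + D2 s t) a b"
  unfolding ac_increment_def
proof (intro allI impI)
  fix \<epsilon> :: real assume "\<epsilon> > 0"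
  then have e2: "\<epsilon> / 2 > 0" by simp
  obtain \<delta>1 where \<delta>1: "\<delta>1 > 0"
    "\<forall>I. nonoverlapping a b I \<and> (\<Sum>(s, t) \<in> I. t - s) < \<delta>1 \<longrightarrow> (\<Sum>(s, t) \<in> I. D1 s t) < \<epsilon> / 2"
    by (rule ac_incrementE[OF D1 e2])
  obtain \<delta>2 where \<delta>2: "\<delta>2 > 0"
    "\<forall>I. nonoverlapping a b I \<and> (\<Sum>(s, t) \<in> I. t - s) < \<delta>2 \<longrightarrow> (\<Sum>(s, t) \<in> I. D2 s t) < \<epsilon> / 2"
    by (rule ac_incrementE[OF D2 e2])
  show "\<exists>\<delta>>0. \<forall>I. nonoverlapping a b I \<and> (\<Sum>(s, t) \<in> I. t - s) < \<delta>
      \<longrightarrow> (\<Sum>(s, t) \<in> I. D1 s t + D2 s t) < \<epsilon>"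
  proof (intro exI[of _ "min \<delta>1 \<delta>2"] conjI allI impI)
    show "min \<delta>1 \<delta>2 > 0" using \<delta>1(1) \<delta>2(1) by simp
    fix I assume I: "nonoverlapping a b I \<and> (\<Sum>(s, t) \<in> I. t - s) < min \<delta>1 \<delta>2"
    have "(\<Sum>(s, t) \<in> I. D1 s t) < \<epsilon> / 2" "(\<Sum>(s, t) \<in> I. D2 s t) < \<epsilon> / 2"
      using I \<delta>1(2) \<delta>2(2) by auto
    then show "(\<Sum>(s, t) \<in> I. D1 s t + D2 s t) < \<epsilon>" by (simp add: case_prod_unfold sum.distrib)
  qed
qed

lemma ac_increment_length: "ac_increment (\<lambda>s t. t - s) a b"
  unfolding ac_increment_def by blast

lemma ac_increment_subinterval:
  assumes "ac_increment D a b" "a \<le> a'" "b' \<le> b"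
  shows "ac_increment D a' b'"
proof -
  have "nonoverlapping a b I" if "nonoverlapping a' b' I" for I
    using that assms(2,3) unfolding nonoverlapping_def by fastforce
  then show ?thesis using assms(1) unfolding ac_increment_def by meson
qed

text \<open>A single interval is an admissible family; \<open>min\<close> and \<open>max\<close> put
  its endpoints in order.\<close>

lemma ac_increment_continuous_on:
  fixes f :: "real \<Rightarrow> real"
  assumes "ac_increment (\<lambda>s t. \<bar>f t - f s\<bar>) a b"
  shows "continuous_on {a..b} f"
  unfolding continuous_on_iff
proof (intro ballI allI impI)
  fix x \<epsilon> :: real assume x: "x \<in> {a..b}" and "\<epsilon> > 0"
  obtain \<delta> where \<delta>: "\<delta> > 0"
    "\<forall>I. nonoverlapping a b I \<and> (\<Sum>(s, t) \<in> I. t - s) < \<delta> \<longrightarrow> (\<Sum>(s, t) \<in> I. \<bar>f t - f s\<bar>) < \<epsilon>"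
    by (rule ac_incrementE[OF assms \<open>\<epsilon> > 0\<close>])
  show "\<exists>d>0. \<forall>y\<in>{a..b}. dist y x < d \<longrightarrow> dist (f y) (f x) < \<epsilon>"
  proof (intro exI conjI ballI impI, rule \<delta>(1))
    fix y assume y: "y \<in> {a..b}" "dist y x < \<delta>"
    have "\<bar>f (max x y) - f (min x y)\<bar> < \<epsilon>"
      using \<delta>(2)[rule_format, of "{(min x y, max x y)}"] x y
      by (auto simp: dist_real_def nonoverlapping_def min_def max_def split: if_splits)
    then show "dist (f y) (f x) < \<epsilon>" by (auto simp: dist_real_def max_def min_def split: if_splits)
  qed
qed

lemma ac_increment_bounded:
  fixes f :: "real \<Rightarrow> real"
  assumes "ac_increment (\<lambda>s t. \<bar>f t - f s\<bar>) a b"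
  obtains R where "R > 0" "\<And>t. a \<le> t \<Longrightarrow> t \<le> b \<Longrightarrow> \<bar>f t\<bar> \<le> R"
proof -
  have "bounded (f ` {a..b})"
    by (intro compact_imp_bounded compact_continuous_image ac_increment_continuous_on assms) simp
  then obtain R where "R > 0" "\<forall>y\<in>f ` {a..b}. norm y \<le> R" unfolding bounded_pos by blast
  then show ?thesis using that[of R] by auto
qed

text \<open>The increments are summed over a tagged division that is fine for a gauge adapted to the derivative off an exceptional null
  set, and confined to a small open neighbourhood of that set on it.\<close>

lemma ac_nonincreasing:
  fixes F :: "real \<Rightarrow> real"
  assumes ac: "ac_increment (\<lambda>s t. \<bar>F t - F s\<bar>) a b" and "a \<le> b"
    and deriv: "AE t in lebesgue. a < t \<and> t < b \<longrightarrow> (\<exists>d\<le>0. (F has_real_derivative d) (at t))"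
  shows "F b \<le> F a"
proof (rule field_le_epsilon)
  fix e :: real assume "e > 0"
  \<comment> \<open>Half of \<open>e\<close> spread over the length of the interval, with 1 added to
    cover \<open>a = b\<close>; the other half goes to the exceptional set.\<close>
  define \<epsilon> where "\<epsilon> = e / (2 * (b - a + 1))"
  have \<epsilon>: "\<epsilon> > 0" "\<epsilon> * (b - a) \<le> e / 2"
    using \<open>e > 0\<close> \<open>a \<le> b\<close> by (auto simp: \<epsilon>_def field_simps)
  have e2: "e / 2 > 0" using \<open>e > 0\<close> by simp
  obtain \<delta> where \<delta>: "\<delta> > 0"
    "\<forall>I. nonoverlapping a b I \<and> (\<Sum>(s, t) \<in> I. t - s) < \<delta> \<longrightarrow> (\<Sum>(s, t) \<in> I. \<bar>F t - F s\<bar>) < e / 2"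
    by (rule ac_incrementE[OF ac e2])
  obtain N0 where N0: "N0 \<in> null_sets lebesgue"
    "{t \<in> space lebesgue. \<not> (a < t \<and> t < b \<longrightarrow> (\<exists>d\<le>0. (F has_real_derivative d) (at t)))} \<subseteq> N0"
    using deriv unfolding eventually_ae_filter by blast
  \<comment> \<open>The endpoints join the exceptional set because the derivative is controlled only
    in the open interval.\<close>
  define N where "N = N0 \<union> {a, b}"
  have N: "N \<in> null_sets lebesgue"
    unfolding N_def using N0(1) by (intro null_sets.Un) (auto intro: null_sets_completionI finite_imp_null_set_lborel)
  obtain G where G: "open G" "N \<subseteq> G" "emeasure lebesgue (G - N) < ennreal \<delta>"
    using sets_lebesgue_outer_open[of N \<delta>] N \<delta>(1) by (metis null_setsD2)
  have Gm: "G \<in> lmeasurable" "measure lebesgue G < \<delta>"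
  proof -
    have "emeasure lebesgue G = emeasure lebesgue (G - N)"
      using N G(1) by (subst emeasure_Diff_null_set) auto
    then have "emeasure lebesgue G < ennreal \<delta>" using G(3) by simp
    then show "G \<in> lmeasurable"
      using G(1) by (intro fmeasurableI) (auto intro: less_trans)
    then show "measure lebesgue G < \<delta>"
      using \<open>emeasure lebesgue G < ennreal \<delta>\<close> \<delta>(1)
      by (simp add: emeasure_eq_measure2 ennreal_less_iff)
  qed
  have "\<exists>r>0. \<forall>s s'. t \<in> {a..b} \<and> t \<notin> N \<and> s \<le> t \<and> t \<le> s' \<and> \<bar>s - t\<bar> < r \<and> \<bar>s' - t\<bar> < r
      \<longrightarrow> F s' - F s \<le> \<epsilon> * (s' - s)" for t
  proof (cases "t \<in> {a..b} \<and> t \<notin> N")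
    case True
    then have "a < t" "t < b" "t \<notin> N0" by (auto simp: N_def less_le)
    then obtain d where d: "d \<le> 0" "(F has_derivative (\<lambda>h. h * d)) (at t)"
      using N0(2) by (auto simp: has_field_derivative_def mult.commute[of _ "_ :: real"] mult_commute_abs)
    then obtain r where r: "r > 0" "\<And>y. norm (y - t) < r \<Longrightarrow> norm (F y - F t - (y - t) * d) \<le> \<epsilon> * norm (y - t)"
      using \<epsilon>(1) unfolding has_derivative_at_alt by blast
    show ?thesis
    proof (intro exI[of _ r] conjI allI impI r(1))
      fix s s' assume s: "t \<in> {a..b} \<and> t \<notin> N \<and> s \<le> t \<and> t \<le> s' \<and> \<bar>s - t\<bar> < r \<and> \<bar>s' - t\<bar> < r"
      have "F s' - F t \<le> (s' - t) * d + \<epsilon> * (s' - t)" "F t - F s \<le> (t - s) * d + \<epsilon> * (t - s)"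
        using r(2)[of s'] r(2)[of s] s by (auto simp: abs_le_iff algebra_simps)
      moreover have "(s' - t) * d \<le> 0" "(t - s) * d \<le> 0"
        using s d(1) by (auto intro: mult_nonneg_nonpos)
      ultimately show "F s' - F s \<le> \<epsilon> * (s' - s)" by (simp add: algebra_simps)
    qed
  qed (auto intro: exI[of _ 1])
  then obtain r where r: "\<And>t. r t > 0" "\<And>t s s'. \<lbrakk>t \<in> {a..b}; t \<notin> N; s \<le> t; t \<le> s'; \<bar>s - t\<bar> < r t; \<bar>s' - t\<bar> < r t\<rbrakk>
      \<Longrightarrow> F s' - F s \<le> \<epsilon> * (s' - s)"
    by metis
  \<comment> \<open>Intervals tagged off \<open>N\<close> are so short that the nonpositive
    derivative governs the increment up to slope \<open>\<epsilon>\<close>; those tagged in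
    \<open>N\<close> stay inside \<open>G\<close>, whose measure is below the absolute continuity
    threshold \<open>\<delta>\<close>.\<close>
  define \<gamma> where "\<gamma> t = (if t \<in> N then G else ball t (r t))" for t
  have "gauge \<gamma>"
    unfolding gauge_def \<gamma>_def using G(1,2) r(1) by auto
  then obtain p where p: "p tagged_division_of {a..b}" "\<gamma> fine p"
    using fine_division_exists_real by blast
  have fin: "finite p" using p(1) by blast
  have K: "\<exists>c d. K = {c..d} \<and> c \<le> x \<and> x \<le> d \<and> a \<le> c \<and> d \<le> b \<and> Inf K = c \<and> Sup K = d \<and> K \<subseteq> \<gamma> x"
    if xK: "(x, K) \<in> p" for x K
  proof -
    obtain c d where cd: "K = {c..d}" using tagged_division_ofD(4)[OF p(1) xK] by auto
    have x: "x \<in> K" "K \<subseteq> {a..b}" using tagged_division_ofD(2,3)[OF p(1) xK] by auto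
    then have "c \<le> d" using cd by auto
    then show ?thesis using cd x p(2) xK by (auto simp: fine_def)
  qed
  have Inf_le_Sup: "Inf K \<le> Sup K" if "(x, K) \<in> p" for x K
    using K[OF that] by auto
  define inc where "inc = (\<lambda>(x :: real, K). F (Sup K) - F (Inf K))"
  have "F b - F a = sum inc p"
    unfolding inc_def by (rule additive_tagged_division_1[OF \<open>a \<le> b\<close> p(1), symmetric])
  \<comment> \<open>Degenerate intervals are left out: their increments vanish, and distinct tags
    could share one of them, which would spoil the injectivity of \<open>ends\<close>.\<close>
  define p1 where "p1 = {(x, K) \<in> p. x \<in> N \<and> Inf K < Sup K}"
  have finp1: "finite p1" by (rule finite_subset[OF _ fin]) (auto simp: p1_def)
  define p2 where "p2 = {(x, K) \<in> p. x \<notin> N}"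
  have "sum inc p = sum inc p1 + sum inc p2"
  proof -
    have "sum inc p = sum inc (p1 \<union> p2)"
    proof (rule sum.mono_neutral_right[OF fin])
      show "\<forall>y\<in>p - (p1 \<union> p2). inc y = 0"
      proof
        fix y assume "y \<in> p - (p1 \<union> p2)"
        moreover obtain x K where y: "y = (x, K)" by (cases y)
        ultimately have "Inf K = Sup K" using Inf_le_Sup[of x K] by (auto simp: p1_def p2_def)
        then show "inc y = 0" by (simp add: inc_def y)
      qed
    qed (auto simp: p1_def p2_def)
    also have "\<dots> = sum inc p1 + sum inc p2"
      by (rule sum.union_disjoint) (use fin in \<open>auto simp: p1_def p2_def intro: finite_subset\<close>)
    finally show ?thesis .
  qed
  moreover have "sum inc p2 \<le> e / 2"
  proof -
    have "sum inc p2 \<le> (\<Sum>(x, K)\<in>p2. \<epsilon> * (Sup K - Inf K))"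
    proof (rule sum_mono, clarify)
      fix x K assume "(x, K) \<in> p2"
      then have xK: "(x, K) \<in> p" "x \<notin> N" by (auto simp: p2_def)
      obtain c d where cd: "K = {c..d}" "c \<le> x" "x \<le> d" "a \<le> c" "d \<le> b" "Inf K = c" "Sup K = d" "K \<subseteq> \<gamma> x"
        using K[OF xK(1)] by blast
      have "c \<in> K" "d \<in> K" using cd by auto
      then have "c \<in> ball x (r x)" "d \<in> ball x (r x)" using cd(8) xK(2) by (auto simp: \<gamma>_def)
      then show "inc (x, K) \<le> \<epsilon> * (Sup K - Inf K)"
        using r(2)[of x c d] cd xK(2) by (auto simp: inc_def dist_real_def abs_minus_commute)
    qed
    also have "\<dots> \<le> (\<Sum>(x, K)\<in>p. \<epsilon> * (Sup K - Inf K))"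
    proof (rule sum_mono2[OF fin])
      fix y assume "y \<in> p - p2"
      then show "0 \<le> (case y of (x, K) \<Rightarrow> \<epsilon> * (Sup K - Inf K))"
        using Inf_le_Sup \<epsilon>(1) by (cases y) auto
    qed (auto simp: p2_def)
    also have "\<dots> = \<epsilon> * (\<Sum>(x, K)\<in>p. Sup K - Inf K)" by (simp add: sum_distrib_left case_prod_unfold)
    also have "(\<Sum>(x, K)\<in>p. Sup K - Inf K) = b - a"
      using additive_tagged_division_1[OF \<open>a \<le> b\<close> p(1), of "\<lambda>x. x"] by simp
    finally show ?thesis using \<epsilon>(2) by simp
  qed
  moreover have "sum inc p1 \<le> e / 2"
  proof -
    define ends where "ends = (\<lambda>(x :: real, K :: real set). (Inf K, Sup K))"
    have disj: "{Inf K<..<Sup K} \<inter> {Inf K'<..<Sup K'} = {}"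
      if mem: "(x, K) \<in> p" "(x', K') \<in> p" "(x, K) \<noteq> (x', K')" for x K x' K'
    proof -
      obtain c d where "K = {c..d}" "Inf K = c" "Sup K = d" using K[OF mem(1)] by blast
      moreover obtain c' d' where "K' = {c'..d'}" "Inf K' = c'" "Sup K' = d'" using K[OF mem(2)] by blast
      ultimately show ?thesis using tagged_division_ofD(5)[OF p(1) mem] by simp
    qed
    have inj: "inj_on ends p1"
    proof (rule inj_onI, clarify)
      fix x K x' K' assume *: "(x, K) \<in> p1" "(x', K') \<in> p1" "ends (x, K) = ends (x', K')"
      show "x = x' \<and> K = K'"
      proof (rule ccontr)
        assume "\<not> (x = x' \<and> K = K')"
        then have "{Inf K<..<Sup K} \<inter> {Inf K'<..<Sup K'} = {}" using * by (intro disj) (auto simp: p1_def)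
        then have "{Inf K<..<Sup K} = {}" using *(3) by (simp add: ends_def)
        then show False using *(1) by (simp add: p1_def)
      qed
    qed
    have "(\<Sum>(s, t)\<in>ends ` p1. \<bar>F t - F s\<bar>) < e / 2"
    proof (rule \<delta>(2)[rule_format, OF conjI])
      show "nonoverlapping a b (ends ` p1)"
        unfolding nonoverlapping_def
      proof (intro conjI)
        show "finite (ends ` p1)" using finp1 by simp
        show "\<forall>(s, t)\<in>ends ` p1. a \<le> s \<and> s \<le> t \<and> t \<le> b"
          using K by (fastforce simp: ends_def p1_def)
        show "pairwise (\<lambda>p q. {fst p<..<snd p} \<inter> {fst q<..<snd q} = {}) (ends ` p1)"
        proof (rule pairwiseI)
          fix y z assume "y \<in> ends ` p1" "z \<in> ends ` p1" "y \<noteq> z"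
          then obtain x K x' K' where "y = (Inf K, Sup K)" "(x, K) \<in> p"
            "z = (Inf K', Sup K')" "(x', K') \<in> p" "(x, K) \<noteq> (x', K')"
            by (auto simp: ends_def p1_def)
          then show "{fst y<..<snd y} \<inter> {fst z<..<snd z} = {}" using disj by simp
        qed
      qed
      \<comment> \<open>The total length is the measure of a disjoint union inside \<open>G\<close>,
        hence below \<open>\<delta>\<close>.\<close>
      have "(\<Sum>(s, t)\<in>ends ` p1. t - s) = (\<Sum>(x, K)\<in>p1. measure lebesgue {Inf K<..<Sup K})"
        unfolding sum.reindex[OF inj] by (rule sum.cong) (auto simp: ends_def p1_def)
      also have "\<dots> = measure lebesgue (\<Union>(x, K)\<in>p1. {Inf K<..<Sup K})"
        unfolding case_prod_unfold
      proof (rule measure_UNION'[symmetric])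
        show "pairwise (\<lambda>y z. disjnt {Inf (snd y)<..<Sup (snd y)} {Inf (snd z)<..<Sup (snd z)}) p1"
        proof (rule pairwiseI)
          fix y z assume "y \<in> p1" "z \<in> p1" "y \<noteq> z"
          then show "disjnt {Inf (snd y)<..<Sup (snd y)} {Inf (snd z)<..<Sup (snd z)}"
            using disj[of "fst y" "snd y" "fst z" "snd z"] by (auto simp: p1_def disjnt_def)
        qed
      qed (simp_all add: finp1)
      also have "\<dots> \<le> measure lebesgue G"
      proof (rule measure_mono_fmeasurable[OF _ _ Gm(1)])
        show "(\<Union>(x, K)\<in>p1. {Inf K<..<Sup K}) \<subseteq> G"
          using K by (fastforce simp: p1_def \<gamma>_def)
      qed (auto intro!: sets.finite_UN finp1)
      finally show "(\<Sum>(s, t)\<in>ends ` p1. t - s) < \<delta>" using Gm(2) by linarith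
    qed
    moreover have "sum inc p1 \<le> (\<Sum>(s, t)\<in>ends ` p1. \<bar>F t - F s\<bar>)"
      unfolding sum.reindex[OF inj] by (rule sum_mono) (auto simp: ends_def inc_def)
    ultimately show ?thesis by linarith
  qed
  ultimately show "F b \<le> F a + e" using \<open>F b - F a = sum inc p\<close> by linarith
qed


text \<open>The integrating factor exp(c t) makes \<open>F\<close> nonincreasing. Since the
  derivative exists only almost everywhere, \<open>F\<close> must also be shown absolutely
  continuous before monotonicity can be concluded.\<close>

lemma Gronwall:
  fixes f :: "real \<Rightarrow> real"
  assumes ac: "ac_increment (\<lambda>s t. \<bar>f t - f s\<bar>) a b" and "a \<le> b" and "c > 0"
    and deriv: "AE t in lebesgue. a < t \<and> t < b \<longrightarrow> (\<exists>d\<le>k - c * f t. (f has_real_derivative d) (at t))"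
  shows "f b \<le> k / c + (f a - k / c) * exp (- c * (b - a))"
proof -
  define F where "F t = exp (c * t) * (f t - k / c)" for t
  obtain R where R: "R > 0" "\<And>t. a \<le> t \<Longrightarrow> t \<le> b \<Longrightarrow> \<bar>f t\<bar> \<le> R"
    using ac_increment_bounded[OF ac] by blast
  \<comment> \<open>The two constants in the product-rule splitting of \<open>F t - F s\<close>: one
    multiplies the increment of \<open>f\<close>, the other combines the bound on
    \<open>f - k / c\<close> with the Lipschitz constant of the exponential.\<close>
  define M where "M = max (exp (c * b)) ((R + \<bar>k / c\<bar>) * (c * exp (c * b)))"
  have "M > 0" by (simp add: M_def less_max_iff_disj)
  have "ac_increment (\<lambda>s t. \<bar>F t - F s\<bar>) a b"
  proof (rule ac_increment_mono[OF ac_increment_add[OF ac ac_increment_length] \<open>M > 0\<close>])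
    fix s t assume st: "a \<le> s" "s \<le> t" "t \<le> b"
    have "\<bar>exp (c * t) - exp (c * s)\<bar> \<le> (c * exp (c * b)) * \<bar>t - s\<bar>"
    proof -
      have "norm (exp (c * t) - exp (c * s)) \<le> (c * exp (c * b)) * norm (t - s)"
      proof (rule field_differentiable_bound[of "{s..t}"])
        fix x assume x: "x \<in> {s..t}"
        show "((\<lambda>t. exp (c * t)) has_field_derivative c * exp (c * x)) (at x within {s..t})"
          by (auto intro!: derivative_eq_intros)
        show "norm (c * exp (c * x)) \<le> c * exp (c * b)"
          using x st \<open>c > 0\<close> by (simp add: abs_mult)
      qed (use st in auto)
      then show ?thesis by simp
    qed
    moreover have "\<bar>f s - k / c\<bar> \<le> R + \<bar>k / c\<bar>" using R(2)[of s] st by linarith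
    ultimately have 1: "\<bar>(f s - k / c) * (exp (c * t) - exp (c * s))\<bar>
        \<le> (R + \<bar>k / c\<bar>) * ((c * exp (c * b)) * \<bar>t - s\<bar>)"
      unfolding abs_mult using R(1) by (intro mult_mono) auto
    have 2: "\<bar>exp (c * t) * (f t - f s)\<bar> \<le> exp (c * b) * \<bar>f t - f s\<bar>"
      using st \<open>c > 0\<close> by (simp add: abs_mult mult_right_mono)
    have "F t - F s = exp (c * t) * (f t - f s) + (f s - k / c) * (exp (c * t) - exp (c * s))"
      by (simp add: F_def algebra_simps)
    then have "\<bar>F t - F s\<bar> \<le> \<bar>exp (c * t) * (f t - f s)\<bar> + \<bar>(f s - k / c) * (exp (c * t) - exp (c * s))\<bar>"
      by (simp only: abs_triangle_ineq)
    also have "\<dots> \<le> exp (c * b) * \<bar>f t - f s\<bar> + (R + \<bar>k / c\<bar>) * ((c * exp (c * b)) * \<bar>t - s\<bar>)"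
      by (rule add_mono[OF 2 1])
    also have "\<dots> = exp (c * b) * \<bar>f t - f s\<bar> + ((R + \<bar>k / c\<bar>) * (c * exp (c * b))) * \<bar>t - s\<bar>"
      by (simp only: mult.assoc)
    also have "\<dots> \<le> M * \<bar>f t - f s\<bar> + M * \<bar>t - s\<bar>"
      by (intro add_mono mult_right_mono) (auto simp: M_def)
    finally show "\<bar>F t - F s\<bar> \<le> M * (\<bar>f t - f s\<bar> + (t - s))" using st by (simp add: distrib_left)
  qed
  then have "F b \<le> F a"
  proof (rule ac_nonincreasing[OF _ \<open>a \<le> b\<close>])
    show "AE t in lebesgue. a < t \<and> t < b \<longrightarrow> (\<exists>d\<le>0. (F has_real_derivative d) (at t))"
      using deriv
    proof eventually_elim
      case (elim t)
      show ?case
      proof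
        assume "a < t \<and> t < b"
        then obtain d where d: "d \<le> k - c * f t" "(f has_real_derivative d) (at t)" using elim by blast
        have "(F has_real_derivative exp (c * t) * (d - (k - c * f t))) (at t)"
          unfolding F_def using \<open>c > 0\<close>
          by (auto intro!: derivative_eq_intros d(2) simp: algebra_simps)
        moreover have "exp (c * t) * (d - (k - c * f t)) \<le> 0"
          using d(1) by (intro mult_nonneg_nonpos) auto
        ultimately show "\<exists>d\<le>0. (F has_real_derivative d) (at t)" by blast
      qed
    qed
  qed
  then have "exp (- c * b) * F b \<le> exp (- c * b) * F a" by (rule mult_left_mono) simp
  then show ?thesis
    by (simp add: F_def algebra_simps flip: exp_add mult.assoc)
qed

text \<open>The differential inequality is asked for only after some time \<open>a\<close>, because
  forcing differences and low modes are small only eventually; the value at \<open>a\<close> is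
  forgotten exponentially.\<close>

lemma Gronwall_eventually:
  fixes f :: "real \<Rightarrow> real"
  assumes ac: "\<And>T. T > 0 \<Longrightarrow> ac_increment (\<lambda>s t. \<bar>f t - f s\<bar>) 0 T" and "a \<ge> 0" "c > 0" "\<epsilon> > 0"
    and deriv: "AE t in lebesgue. a < t \<longrightarrow> (\<exists>d\<le>k - c * f t. (f has_real_derivative d) (at t))"
  shows "\<forall>\<^sub>F t in at_top. f t < k / c + \<epsilon>"
proof -
  have bound: "f t \<le> k / c + (f a - k / c) * exp (- c * (t - a))" if "t > a" for t
  proof (rule Gronwall)
    show "ac_increment (\<lambda>s t. \<bar>f t - f s\<bar>) a t"
      by (rule ac_increment_subinterval[OF ac[of t]]) (use that assms(2) in auto)
    show "AE x in lebesgue. a < x \<and> x < t \<longrightarrow> (\<exists>d\<le>k - c * f x. (f has_real_derivative d) (at x))"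
      using deriv by eventually_elim simp
  qed (use that \<open>c > 0\<close> in auto)
  have "((\<lambda>t. k / c + (f a - k / c) * exp (- c * (t - a))) \<longlongrightarrow> k / c + (f a - k / c) * 0) at_top"
  proof (intro tendsto_intros filterlim_compose[OF exp_at_bot])
    have "filterlim (\<lambda>t. t + - a) at_top at_top"
      by (rule filterlim_tendsto_add_at_top[OF tendsto_const filterlim_ident, of "- a", simplified add.commute])
    then have "filterlim (\<lambda>t. c * (t - a)) at_top at_top"
      by (intro filterlim_tendsto_pos_mult_at_top[OF tendsto_const \<open>c > 0\<close>]) simp
    then show "filterlim (\<lambda>t. - c * (t - a)) at_bot at_top"
      by (simp add: filterlim_uminus_at_bot)
  qed
  then have "\<forall>\<^sub>F t in at_top. k / c + (f a - k / c) * exp (- c * (t - a)) < k / c + \<epsilon>"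
    using \<open>\<epsilon> > 0\<close> by (intro order_tendstoD(2)) auto
  then show ?thesis
    using eventually_gt_at_top[of a] by eventually_elim (use bound in force)
qed


section \<open>Energy estimates\<close>

lemma V_abs_continuous_ac_increment:
  "V_abs_continuous \<Omega> v \<longleftrightarrow> (\<forall>T>0. ac_increment (\<lambda>s t. V_norm \<Omega> (\<lambda>x. v t x - v s x)) 0 T)"
  unfolding V_abs_continuous_def ac_increment_def nonoverlapping_def by (simp add: conj_assoc)

text \<open>Roles: \<open>n\<close>, \<open>p\<close>, \<open>x\<close> are the norms of z, of its
  low modes and of its gradient, \<open>L\<close> is the squared L4 norm, \<open>V\<close> the
  gradient norm of v. If \<open>p \<le> \<delta> * x\<close>, the low modes merely change the factor
  \<open>1 / \<Lambda>\<close> by \<open>\<delta>\<close>; otherwise \<open>x\<close> is below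
  \<open>p / \<delta>\<close> and everything is a multiple of \<open>p\<^sup>2\<close>. The constant
  in front of \<open>p\<^sup>2\<close> may be large, since \<open>p\<close> tends to zero.\<close>

lemma absorb_low_modes:
  fixes n p x L V W \<delta> \<mu> \<Lambda> :: real
  assumes "x \<ge> 0" "p \<ge> 0" "V \<ge> 0" "\<delta> > 0" "\<mu> \<ge> 0" "\<Lambda> > 0" "W \<ge> 0"
    and n: "n \<le> p + x / \<Lambda>" and L: "L\<^sup>2 \<le> 8 * n * x ^ 3" and V: "V\<^sup>2 \<le> W"
    and \<mu>: "8 * W * (\<delta> + 1 / \<Lambda>) \<le> \<mu>\<^sup>2"
  shows "V * L \<le> \<mu> * x\<^sup>2 + sqrt (8 * W * (1 + 1 / (\<delta> * \<Lambda>)) / \<delta> ^ 3) * p\<^sup>2"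
proof -
  define C where "C = sqrt (8 * W * (1 + 1 / (\<delta> * \<Lambda>)) / \<delta> ^ 3)"
  have C: "C \<ge> 0" "C\<^sup>2 = 8 * W * (1 + 1 / (\<delta> * \<Lambda>)) / \<delta> ^ 3"
    unfolding C_def using assms by simp_all
  have "(V * L)\<^sup>2 \<le> W * (8 * n * x ^ 3)"
    unfolding power_mult_distrib using V L \<open>W \<ge> 0\<close> by (intro mult_mono) auto
  also have "\<dots> \<le> W * (8 * (p + x / \<Lambda>) * x ^ 3)"
    using n assms by (intro mult_left_mono mult_right_mono) auto
  also have "\<dots> = 8 * W * ((p + x / \<Lambda>) * x ^ 3)" by (simp only: mult_ac)
  finally have VL: "(V * L)\<^sup>2 \<le> 8 * W * ((p + x / \<Lambda>) * x ^ 3)" .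
  show ?thesis
  proof (cases "p \<le> \<delta> * x")
    case True
    have "(p + x / \<Lambda>) * x ^ 3 \<le> (\<delta> * x + x / \<Lambda>) * x ^ 3"
      using True assms by (intro mult_right_mono) auto
    also have "\<dots> = (\<delta> + 1 / \<Lambda>) * (x\<^sup>2)\<^sup>2"
      by (simp add: power2_eq_square power3_eq_cube algebra_simps)
    finally have "8 * W * ((p + x / \<Lambda>) * x ^ 3) \<le> 8 * W * ((\<delta> + 1 / \<Lambda>) * (x\<^sup>2)\<^sup>2)"
      using \<open>W \<ge> 0\<close> by (intro mult_left_mono) auto
    also have "\<dots> = (8 * W * (\<delta> + 1 / \<Lambda>)) * (x\<^sup>2)\<^sup>2" by (simp only: mult.assoc)
    also have "\<dots> \<le> \<mu>\<^sup>2 * (x\<^sup>2)\<^sup>2" by (intro mult_right_mono \<mu>) simp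
    finally have "(V * L)\<^sup>2 \<le> (\<mu> * x\<^sup>2)\<^sup>2" using VL by (simp add: power_mult_distrib)
    then have "V * L \<le> \<mu> * x\<^sup>2" by (rule power2_le_imp_le) (use \<open>\<mu> \<ge> 0\<close> in simp)
    then show ?thesis using C(1) unfolding C_def by (simp add: add_increasing2)
  next
    case False
    then have xp: "x \<le> p / \<delta>" using \<open>\<delta> > 0\<close> by (simp add: field_simps)
    have "(p + x / \<Lambda>) * x ^ 3 \<le> (p + (p / \<delta>) / \<Lambda>) * (p / \<delta>) ^ 3"
      using xp assms by (intro mult_mono power_mono add_left_mono divide_right_mono) auto
    also have "\<dots> = (1 + 1 / (\<delta> * \<Lambda>)) / \<delta> ^ 3 * (p\<^sup>2)\<^sup>2"
      by (simp add: power2_eq_square power3_eq_cube field_simps)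
    finally have "8 * W * ((p + x / \<Lambda>) * x ^ 3) \<le> 8 * W * ((1 + 1 / (\<delta> * \<Lambda>)) / \<delta> ^ 3 * (p\<^sup>2)\<^sup>2)"
      using \<open>W \<ge> 0\<close> by (intro mult_left_mono) auto
    also have "\<dots> = C\<^sup>2 * (p\<^sup>2)\<^sup>2" unfolding C(2) by simp
    finally have "(V * L)\<^sup>2 \<le> (C * p\<^sup>2)\<^sup>2" using VL by (simp add: power_mult_distrib)
    then have "V * L \<le> C * p\<^sup>2" by (rule power2_le_imp_le) (use C(1) in simp)
    then show ?thesis using \<open>\<mu> \<ge> 0\<close> unfolding C_def by (simp add: add_increasing)
  qed
qed

context stokes_system
begin

lemma l2_norm_le_V_norm:
  assumes "\<phi> \<in> space_V \<Omega>"
  shows "l2_norm \<Omega> \<phi> \<le> V_norm \<Omega> \<phi> / sqrt (lam 1)"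
proof -
  have "lam 1 > 0" by (rule eigenvalue_pos) simp
  have "sqrt (lam 1 * (l2_norm \<Omega> \<phi>)\<^sup>2) \<le> sqrt ((V_norm \<Omega> \<phi>)\<^sup>2)"
    by (rule real_sqrt_le_mono[OF Poincare[OF assms]])
  then show ?thesis using \<open>lam 1 > 0\<close> by (simp add: real_sqrt_mult field_simps)
qed

definition energy :: "real \<Rightarrow> field \<Rightarrow> real" where
  "energy \<alpha> z = (l2_norm \<Omega> z)\<^sup>2 + \<alpha>\<^sup>2 * (V_norm \<Omega> z)\<^sup>2"

text \<open>Multiplied by the minimum, each of the two summands of the energy is at most the squared
  gradient norm, the first by Poincare's inequality. This explains the factor 1/2 in d1.\<close>

lemma energy_le_V_norm:
  assumes "z \<in> space_V \<Omega>" "\<alpha> > 0"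
  shows "1 / 2 * min (1 / \<alpha>\<^sup>2) (lam 1) * energy \<alpha> z \<le> (V_norm \<Omega> z)\<^sup>2"
proof -
  let ?d = "min (1 / \<alpha>\<^sup>2) (lam 1)"
  have "?d * (l2_norm \<Omega> z)\<^sup>2 \<le> lam 1 * (l2_norm \<Omega> z)\<^sup>2" by (intro mult_right_mono) auto
  also have "\<dots> \<le> (V_norm \<Omega> z)\<^sup>2" by (rule Poincare[OF assms(1)])
  finally have 1: "?d * (l2_norm \<Omega> z)\<^sup>2 \<le> (V_norm \<Omega> z)\<^sup>2" .
  have "?d * \<alpha>\<^sup>2 \<le> (1 / \<alpha>\<^sup>2) * \<alpha>\<^sup>2" by (intro mult_right_mono) auto
  then have "?d * \<alpha>\<^sup>2 * (V_norm \<Omega> z)\<^sup>2 \<le> 1 * (V_norm \<Omega> z)\<^sup>2"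
    using assms(2) by (intro mult_right_mono) auto
  with 1 show ?thesis unfolding energy_def by (simp add: algebra_simps)
qed

text \<open>\<open>has_V_derivative\<close> speaks of gradients only; Poincare's inequality supplies
  the L2 part. For the gradient part, the gradient of the difference quotient is almost everywhere
  the difference quotient of the gradients.\<close>

lemma energy_has_derivative:
  assumes z: "\<And>s. s \<ge> 0 \<Longrightarrow> z s \<in> space_V \<Omega>" and "t > 0" and z': "has_V_derivative \<Omega> z z' t"
  shows "((\<lambda>s. energy \<alpha> (z s)) has_real_derivative
    2 * (l2_inner \<Omega> z' (z t) + \<alpha>\<^sup>2 * stokes_ext \<Omega> z' (z t))) (at t)"
proof -
  have V: "z' \<in> space_V \<Omega>" "z t \<in> space_V \<Omega>" using z' z[of t] \<open>t > 0\<close> by (auto simp: has_V_derivative_def)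
  have lim: "((\<lambda>s. V_norm \<Omega> (\<lambda>x. (z s x - z t x) /\<^sub>R (s - t) - z' x)) \<longlongrightarrow> 0) (at t)"
    using z' by (simp add: has_V_derivative_def)
  have pos: "\<forall>\<^sub>F s in at t. s > 0" using \<open>t > 0\<close> by (intro order_tendstoD(1)[OF tendsto_ident_at])
  then have zV: "\<forall>\<^sub>F s in at t. z s \<in> space_V \<Omega>" by eventually_elim (simp add: z)
  have R: "\<forall>\<^sub>F s in at t. (\<lambda>x. (z s x - z t x) /\<^sub>R (s - t) - z' x) \<in> space_V \<Omega>"
    using zV by eventually_elim (intro space_V_diff space_V_scaleR V)
  have D1: "((\<lambda>s. (l2_norm \<Omega> (z s))\<^sup>2) has_real_derivative 2 * l2_inner \<Omega> z' (z t)) (at t)"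
  proof (rule l2_norm_sq_has_derivative)
    show "\<forall>\<^sub>F s in at t. z s \<in> L2 \<Omega>" using zV by eventually_elim (rule space_V_L2)
    have "((\<lambda>s. V_norm \<Omega> (\<lambda>x. (z s x - z t x) /\<^sub>R (s - t) - z' x) / sqrt (lam 1)) \<longlongrightarrow> 0 / sqrt (lam 1)) (at t)"
      using eigenvalue_pos[of 1] by (intro tendsto_divide lim tendsto_const) auto
    then have "((\<lambda>s. V_norm \<Omega> (\<lambda>x. (z s x - z t x) /\<^sub>R (s - t) - z' x) / sqrt (lam 1)) \<longlongrightarrow> 0) (at t)" by simp
    then show "((\<lambda>s. l2_norm \<Omega> (\<lambda>x. (z s x - z t x) /\<^sub>R (s - t) - z' x)) \<longlongrightarrow> 0) (at t)"
      by (rule Lim_null_comparison[rotated])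
        (use R in eventually_elim, simp only: real_norm_def abs_of_nonneg l2_norm_nonneg l2_norm_le_V_norm)
  qed (use V in \<open>auto intro: space_V_L2\<close>)
  have D2: "((\<lambda>s. (l2_norm \<Omega> (wgrad \<Omega> (z s)))\<^sup>2) has_real_derivative 2 * l2_inner \<Omega> (wgrad \<Omega> z') (wgrad \<Omega> (z t))) (at t)"
  proof (rule l2_norm_sq_has_derivative)
    show "\<forall>\<^sub>F s in at t. wgrad \<Omega> (z s) \<in> L2 \<Omega>" using zV by eventually_elim (intro wgrad_L2 space_V_H1)
    show "((\<lambda>s. l2_norm \<Omega> (\<lambda>x. (wgrad \<Omega> (z s) x - wgrad \<Omega> (z t) x) /\<^sub>R (s - t) - wgrad \<Omega> z' x)) \<longlongrightarrow> 0) (at t)"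
    proof (rule Lim_transform_eventually[OF lim])
      show "\<forall>\<^sub>F s in at t. V_norm \<Omega> (\<lambda>x. (z s x - z t x) /\<^sub>R (s - t) - z' x)
          = l2_norm \<Omega> (\<lambda>x. (wgrad \<Omega> (z s) x - wgrad \<Omega> (z t) x) /\<^sub>R (s - t) - wgrad \<Omega> z' x)"
        using zV
      proof eventually_elim
        case (elim s)
        have H: "z s \<in> H1 \<Omega>" "z t \<in> H1 \<Omega>" "z' \<in> H1 \<Omega>" using elim V by (auto intro: space_V_H1)
        note d = H1_diff[OF H(1,2)]
        note sd = H1_scaleR[OF d, of "inverse (s - t)"]
        show ?case
          unfolding V_norm_def
        proof (rule l2_norm_cong_AE)
          show "AE x in lebesgue_on \<Omega>. wgrad \<Omega> (\<lambda>x. (z s x - z t x) /\<^sub>R (s - t) - z' x) x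
              = (wgrad \<Omega> (z s) x - wgrad \<Omega> (z t) x) /\<^sub>R (s - t) - wgrad \<Omega> z' x"
            using wgrad_diff[OF sd H(3)] wgrad_scaleR[OF d, of "inverse (s - t)"] wgrad_diff[OF H(1,2)]
            by eventually_elim simp
        qed (intro wgrad_L2 H1_diff H1_scaleR L2_diff L2_scaleR H)+
      qed
    qed
  qed (use V in \<open>auto intro: wgrad_L2 space_V_H1\<close>)
  have "((\<lambda>s. (l2_norm \<Omega> (z s))\<^sup>2 + \<alpha>\<^sup>2 * (l2_norm \<Omega> (wgrad \<Omega> (z s)))\<^sup>2) has_real_derivative
      2 * l2_inner \<Omega> z' (z t) + \<alpha>\<^sup>2 * (2 * l2_inner \<Omega> (wgrad \<Omega> z') (wgrad \<Omega> (z t)))) (at t)"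
    by (intro DERIV_add DERIV_cmult D1 D2)
  then show ?thesis unfolding energy_def V_norm_def stokes_ext_def by (simp add: algebra_simps)
qed

text \<open>On a bounded time interval the norms stay bounded, so that increments of their squares
  are dominated by increments in V.\<close>

lemma energy_ac_increment:
  assumes z: "\<And>s. s \<ge> 0 \<Longrightarrow> z s \<in> space_V \<Omega>" and ac: "V_abs_continuous \<Omega> z" and "T > 0"
  shows "ac_increment (\<lambda>s t. \<bar>energy \<alpha> (z t) - energy \<alpha> (z s)\<bar>) 0 T"
proof -
  have ac: "ac_increment (\<lambda>s t. V_norm \<Omega> (\<lambda>x. z t x - z s x)) 0 T"
    using ac \<open>T > 0\<close> by (simp add: V_abs_continuous_ac_increment)
  have "ac_increment (\<lambda>s t. \<bar>V_norm \<Omega> (z t) - V_norm \<Omega> (z s)\<bar>) 0 T"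
  proof (rule ac_increment_mono[OF ac, of 1])
    fix s t :: real assume st: "0 \<le> s" "s \<le> t"
    then have H: "z s \<in> H1 \<Omega>" "z t \<in> H1 \<Omega>" using z by (auto intro: space_V_H1)
    show "\<bar>V_norm \<Omega> (z t) - V_norm \<Omega> (z s)\<bar> \<le> 1 * V_norm \<Omega> (\<lambda>x. z t x - z s x)"
      using V_norm_triangle_sub[OF H(2,1)] V_norm_triangle_sub[OF H] V_norm_diff_commute[OF H] by simp
  qed simp
  then obtain R where R: "R > 0" "\<And>t. 0 \<le> t \<Longrightarrow> t \<le> T \<Longrightarrow> \<bar>V_norm \<Omega> (z t)\<bar> \<le> R"
    by (rule ac_increment_bounded) blast
  have l: "sqrt (lam 1) > 0" using eigenvalue_pos[of 1] by simp
  define M where "M = 2 * R * ((1 / sqrt (lam 1))\<^sup>2 + \<alpha>\<^sup>2)"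
  have "M > 0" using R(1) l by (simp add: M_def add_pos_nonneg)
  then show ?thesis
  proof (rule ac_increment_mono[OF ac])
    fix s t :: real assume st: "0 \<le> s" "s \<le> t" "t \<le> T"
    then have V: "z s \<in> space_V \<Omega>" "z t \<in> space_V \<Omega>" "(\<lambda>x. z t x - z s x) \<in> space_V \<Omega>"
      using z by (auto intro: space_V_diff)
    let ?d = "V_norm \<Omega> (\<lambda>x. z t x - z s x)"
    have Vb: "V_norm \<Omega> (z s) \<le> R" "V_norm \<Omega> (z t) \<le> R" using R(2)[of s] R(2)[of t] st by auto
    have lb: "l2_norm \<Omega> (z r) \<le> R / sqrt (lam 1)" if "z r \<in> space_V \<Omega>" "V_norm \<Omega> (z r) \<le> R" for r
      using l2_norm_le_V_norm[OF that(1)] divide_right_mono[OF that(2), of "sqrt (lam 1)"] l by linarith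
    have "\<bar>(l2_norm \<Omega> (z t))\<^sup>2 - (l2_norm \<Omega> (z s))\<^sup>2\<bar>
        \<le> l2_norm \<Omega> (\<lambda>x. z t x - z s x) * (l2_norm \<Omega> (z t) + l2_norm \<Omega> (z s))"
      by (intro l2_norm_sq_diff_le space_V_L2 V)
    also have "\<dots> \<le> (?d / sqrt (lam 1)) * (R / sqrt (lam 1) + R / sqrt (lam 1))"
      using l by (intro mult_mono add_mono lb l2_norm_le_V_norm V Vb) auto
    finally have 1: "\<bar>(l2_norm \<Omega> (z t))\<^sup>2 - (l2_norm \<Omega> (z s))\<^sup>2\<bar> \<le> (2 * R * (1 / sqrt (lam 1))\<^sup>2) * ?d"
      using l by (simp add: power2_eq_square field_simps)
    have "\<bar>(V_norm \<Omega> (z t))\<^sup>2 - (V_norm \<Omega> (z s))\<^sup>2\<bar> \<le> ?d * (V_norm \<Omega> (z t) + V_norm \<Omega> (z s))"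
      unfolding V_norm_diff_eq[OF space_V_H1[OF V(2)] space_V_H1[OF V(1)]] V_norm_def[of _ "z t"] V_norm_def[of _ "z s"]
      by (intro l2_norm_sq_diff_le wgrad_L2 space_V_H1 V)
    also have "\<dots> \<le> ?d * (R + R)" by (intro mult_left_mono add_mono Vb) simp
    finally have le: "\<alpha>\<^sup>2 * \<bar>(V_norm \<Omega> (z t))\<^sup>2 - (V_norm \<Omega> (z s))\<^sup>2\<bar> \<le> \<alpha>\<^sup>2 * (?d * (R + R))"
      by (intro mult_left_mono) auto
    have 2: "\<bar>\<alpha>\<^sup>2 * (V_norm \<Omega> (z t))\<^sup>2 - \<alpha>\<^sup>2 * (V_norm \<Omega> (z s))\<^sup>2\<bar> \<le> (2 * R * \<alpha>\<^sup>2) * ?d"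
      unfolding right_diff_distrib[symmetric] abs_mult using le by (simp add: mult_ac)
    have "\<bar>energy \<alpha> (z t) - energy \<alpha> (z s)\<bar> \<le> (2 * R * (1 / sqrt (lam 1))\<^sup>2) * ?d + (2 * R * \<alpha>\<^sup>2) * ?d"
      using 1 2 unfolding energy_def by linarith
    also have "\<dots> = M * ?d" by (simp add: M_def algebra_simps)
    finally show "\<bar>energy \<alpha> (z t) - energy \<alpha> (z s)\<bar> \<le> M * ?d" .
  qed
qed

lemma V_abs_continuous_diff:
  assumes v: "\<And>s. s \<ge> 0 \<Longrightarrow> v s \<in> space_V \<Omega>" and u: "\<And>s. s \<ge> 0 \<Longrightarrow> u s \<in> space_V \<Omega>"
    and ac: "V_abs_continuous \<Omega> v" "V_abs_continuous \<Omega> u"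
  shows "V_abs_continuous \<Omega> (\<lambda>s x. v s x - u s x)"
  unfolding V_abs_continuous_ac_increment
proof (intro allI impI)
  fix T :: real assume "T > 0"
  have "ac_increment (\<lambda>s t. V_norm \<Omega> (\<lambda>x. v t x - v s x) + V_norm \<Omega> (\<lambda>x. u t x - u s x)) 0 T"
    using ac \<open>T > 0\<close> by (intro ac_increment_add) (auto simp: V_abs_continuous_ac_increment)
  then show "ac_increment (\<lambda>s t. V_norm \<Omega> (\<lambda>x. v t x - u t x - (v s x - u s x))) 0 T"
  proof (rule ac_increment_mono[of _ _ _ 1])
    fix s t :: real assume st: "0 \<le> s" "s \<le> t"
    have H: "(\<lambda>x. v t x - v s x) \<in> H1 \<Omega>" "(\<lambda>x. u s x - u t x) \<in> H1 \<Omega>" "u t \<in> H1 \<Omega>" "u s \<in> H1 \<Omega>"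
      using st v u by (auto intro!: H1_diff intro: space_V_H1)
    have "(\<lambda>x. v t x - u t x - (v s x - u s x)) = (\<lambda>x. (v t x - v s x) + (u s x - u t x))" by auto
    then show "V_norm \<Omega> (\<lambda>x. v t x - u t x - (v s x - u s x))
        \<le> 1 * (V_norm \<Omega> (\<lambda>x. v t x - v s x) + V_norm \<Omega> (\<lambda>x. u t x - u s x))"
      using V_norm_triangle[OF H(1,2)] V_norm_diff_commute[OF H(3,4)] by simp
  qed simp
qed

lemma has_V_derivative_diff:
  assumes v: "\<And>s. s \<ge> 0 \<Longrightarrow> v s \<in> space_V \<Omega>" and u: "\<And>s. s \<ge> 0 \<Longrightarrow> u s \<in> space_V \<Omega>" and "t > 0"
    and v': "has_V_derivative \<Omega> v v' t" and u': "has_V_derivative \<Omega> u u' t"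
  shows "has_V_derivative \<Omega> (\<lambda>s x. v s x - u s x) (\<lambda>x. v' x - u' x) t"
  unfolding has_V_derivative_def
proof
  let ?r = "\<lambda>v v' s x. (v s x - v t x) /\<^sub>R (s - t) - v' x"
  have V: "v' \<in> space_V \<Omega>" "u' \<in> space_V \<Omega>" "v t \<in> space_V \<Omega>" "u t \<in> space_V \<Omega>"
    using v' u' v[of t] u[of t] \<open>t > 0\<close> by (auto simp: has_V_derivative_def)
  show "(\<lambda>x. v' x - u' x) \<in> space_V \<Omega>" by (intro space_V_diff V)
  have "((\<lambda>s. V_norm \<Omega> (?r v v' s) + V_norm \<Omega> (?r u u' s)) \<longlongrightarrow> 0 + 0) (at t)"
    using v' u' by (intro tendsto_add) (auto simp: has_V_derivative_def)
  then have lim: "((\<lambda>s. V_norm \<Omega> (?r v v' s) + V_norm \<Omega> (?r u u' s)) \<longlongrightarrow> 0) (at t)" by simp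
  have pos: "\<forall>\<^sub>F s in at t. s > 0" using \<open>t > 0\<close> by (intro order_tendstoD(1)[OF tendsto_ident_at])
  show "((\<lambda>s. V_norm \<Omega> (\<lambda>x. (v s x - u s x - (v t x - u t x)) /\<^sub>R (s - t) - (v' x - u' x))) \<longlongrightarrow> 0) (at t)"
  proof (rule Lim_null_comparison[OF _ lim])
    show "\<forall>\<^sub>F s in at t. norm (V_norm \<Omega> (\<lambda>x. (v s x - u s x - (v t x - u t x)) /\<^sub>R (s - t) - (v' x - u' x)))
        \<le> V_norm \<Omega> (?r v v' s) + V_norm \<Omega> (?r u u' s)"
      using pos
    proof eventually_elim
      case (elim s)
      have r: "?r v v' s \<in> H1 \<Omega>" "?r u u' s \<in> H1 \<Omega>"
        by (rule space_V_H1, intro space_V_diff space_V_scaleR V v u, use elim in simp)+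
      have eq: "(\<lambda>x. (v s x - u s x - (v t x - u t x)) /\<^sub>R (s - t) - (v' x - u' x)) = (\<lambda>x. ?r v v' s x - ?r u u' s x)"
        by (rule ext) (simp add: scaleR_diff_right)
      have "V_norm \<Omega> (\<lambda>x. ?r v v' s x - ?r u u' s x) \<le> V_norm \<Omega> (?r v v' s) + V_norm \<Omega> (?r u u' s)"
        unfolding V_norm_diff_eq[OF r] unfolding V_norm_def by (intro l2_norm_triangle_diff wgrad_L2 r)
      then show ?case unfolding eq by simp
    qed
  qed
qed

lemma nsv_solution_D:
  assumes "nsv_solution \<Omega> \<nu> \<alpha> h v0 v"
  shows "\<And>s. s \<ge> 0 \<Longrightarrow> v s \<in> space_V \<Omega>" "V_abs_continuous \<Omega> v"
    "AE t in lebesgue. t > 0 \<longrightarrow> (\<exists>v'. has_V_derivative \<Omega> v v' t \<and>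
        (\<forall>\<phi> \<in> space_V \<Omega>. l2_inner \<Omega> v' \<phi> + \<nu> * stokes_ext \<Omega> (v t) \<phi> + \<alpha>\<^sup>2 * stokes_ext \<Omega> v' \<phi>
             + B_form \<Omega> (v t) (v t) \<phi> = h t \<phi>))"
  using assms by (auto simp: nsv_solution_def)

text \<open>Tested with the solution itself, the convective term vanishes. Half of the viscous term
  pays for the forcing, the other half becomes decay at rate \<open>\<nu> * d1\<close> through
  \<open>energy_le_V_norm\<close>; the quotient of source and rate is the asymptotic level.\<close>

lemma solution_eventually_bounded:
  assumes sol: "nsv_solution \<Omega> \<nu> \<alpha> h v0 v" and "\<nu> > 0" "\<alpha> > 0" "\<delta> > 0"
    and h: "\<And>t. h t \<in> V_dual \<Omega>" "\<And>t. dual_norm w lam (h t) \<le> hb"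
    and d1: "d1 = 1 / 2 * min (1 / \<alpha>\<^sup>2) (lam 1)"
  shows "\<forall>\<^sub>F t in at_top. (V_norm \<Omega> (v t))\<^sup>2 < hb\<^sup>2 / (\<alpha>\<^sup>2 * \<nu>\<^sup>2 * d1) + \<delta>"
proof -
  note vV = nsv_solution_D(1)[OF sol]
  have "d1 > 0" using \<open>\<alpha> > 0\<close> eigenvalue_pos[of 1] by (simp add: d1)
  have c: "\<nu> * d1 > 0" using \<open>\<nu> > 0\<close> \<open>d1 > 0\<close> by simp
  \<comment> \<open>The margin \<open>\<alpha>\<^sup>2 * \<delta>\<close> turns into
    \<open>\<delta>\<close> once the L2 part of the energy is dropped and
    \<open>\<alpha>\<^sup>2\<close> is divided out.\<close>
  have "\<forall>\<^sub>F t in at_top. energy \<alpha> (v t) < (hb\<^sup>2 / \<nu>) / (\<nu> * d1) + \<alpha>\<^sup>2 * \<delta>"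
  proof (rule Gronwall_eventually[where a = 0])
    show "ac_increment (\<lambda>s t. \<bar>energy \<alpha> (v t) - energy \<alpha> (v s)\<bar>) 0 T" if "T > 0" for T
      by (rule energy_ac_increment[OF vV nsv_solution_D(2)[OF sol] that])
    show "AE t in lebesgue. 0 < t \<longrightarrow> (\<exists>d\<le>hb\<^sup>2 / \<nu> - \<nu> * d1 * energy \<alpha> (v t).
        ((\<lambda>t. energy \<alpha> (v t)) has_real_derivative d) (at t))"
      using nsv_solution_D(3)[OF sol]
    proof eventually_elim
      case (elim t)
      show ?case
      proof
        assume "0 < t"
        then obtain v' where v': "has_V_derivative \<Omega> v v' t"
          and eq: "\<And>\<phi>. \<phi> \<in> space_V \<Omega> \<Longrightarrow> l2_inner \<Omega> v' \<phi> + \<nu> * stokes_ext \<Omega> (v t) \<phi>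
            + \<alpha>\<^sup>2 * stokes_ext \<Omega> v' \<phi> + B_form \<Omega> (v t) (v t) \<phi> = h t \<phi>"
          using elim by blast
        have V: "v t \<in> space_V \<Omega>" using vV \<open>0 < t\<close> by simp
        define x where "x = V_norm \<Omega> (v t)"
        have "B_form \<Omega> (v t) (v t) (v t) = 0" by (rule B_form_self_zero[OF V space_V_H10[OF V]])
        then have "2 * (l2_inner \<Omega> v' (v t) + \<alpha>\<^sup>2 * stokes_ext \<Omega> v' (v t)) = 2 * (h t (v t) - \<nu> * x\<^sup>2)"
          using eq[OF V] unfolding x_def V_norm_power2 by simp
        also have "h t (v t) \<le> hb * x"
          using dual_norm_bound[OF h(1) V, of t] mult_right_mono[OF h(2), of x t] by (simp add: x_def)
        also have "2 * (hb * x - \<nu> * x\<^sup>2) \<le> hb\<^sup>2 / \<nu> - \<nu> * x\<^sup>2"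
        proof -
          have "0 \<le> \<nu> * (x - hb / \<nu>)\<^sup>2" using \<open>\<nu> > 0\<close> by simp
          also have "\<dots> = \<nu> * x\<^sup>2 - 2 * (hb * x) + hb\<^sup>2 / \<nu>"
            using \<open>\<nu> > 0\<close> by (simp add: power2_eq_square field_simps)
          finally show ?thesis by simp
        qed
        also have "\<dots> \<le> hb\<^sup>2 / \<nu> - \<nu> * (d1 * energy \<alpha> (v t))"
          using energy_le_V_norm[OF V \<open>\<alpha> > 0\<close>] \<open>\<nu> > 0\<close> unfolding x_def d1
          by (intro diff_left_mono mult_left_mono) auto
        finally have "2 * (l2_inner \<Omega> v' (v t) + \<alpha>\<^sup>2 * stokes_ext \<Omega> v' (v t))
            \<le> hb\<^sup>2 / \<nu> - \<nu> * d1 * energy \<alpha> (v t)" by (simp add: mult.assoc)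
        then show "\<exists>d\<le>hb\<^sup>2 / \<nu> - \<nu> * d1 * energy \<alpha> (v t).
            ((\<lambda>t. energy \<alpha> (v t)) has_real_derivative d) (at t)"
          using energy_has_derivative[OF vV \<open>0 < t\<close> v'] by blast
      qed
    qed
  qed (use c \<open>\<alpha> > 0\<close> \<open>\<delta> > 0\<close> in auto)
  then show ?thesis
  proof eventually_elim
    case (elim t)
    have "\<alpha>\<^sup>2 * (V_norm \<Omega> (v t))\<^sup>2 \<le> energy \<alpha> (v t)" by (simp add: energy_def)
    also note elim
    also have "(hb\<^sup>2 / \<nu>) / (\<nu> * d1) + \<alpha>\<^sup>2 * \<delta> = \<alpha>\<^sup>2 * (hb\<^sup>2 / (\<alpha>\<^sup>2 * \<nu>\<^sup>2 * d1) + \<delta>)"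
      using \<open>\<alpha> > 0\<close> \<open>\<nu> > 0\<close> \<open>d1 > 0\<close> by (simp add: power2_eq_square field_simps)
    finally show ?case using \<open>\<alpha> > 0\<close> by simp
  qed
qed

text \<open>Bilinearity splits the difference into a term with the gradient of \<open>v\<close> and
  one of the form (B(u, z), z), which vanishes. This order of splitting leaves the gradient on
  \<open>v\<close>, the solution with an eventual bound.\<close>

lemma B_form_difference:
  assumes "v \<in> space_V \<Omega>" "u \<in> space_V \<Omega>"
  defines "z \<equiv> \<lambda>x. v x - u x"
  shows "B_form \<Omega> v v z - B_form \<Omega> u u z = B_form \<Omega> z v z"
proof -
  have V: "z \<in> space_V \<Omega>" unfolding z_def by (intro space_V_diff assms)
  note H = assms(1,2)[THEN space_V_H10] V[THEN space_V_H10] assms(1,2)[THEN space_V_H1] V[THEN space_V_H1]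
  have "B_form \<Omega> z v z = B_form \<Omega> v v z - B_form \<Omega> u v z"
    using B_form_diff_first[OF H(1,2,4,3)] by (simp add: z_def)
  moreover have "B_form \<Omega> u z z = B_form \<Omega> u v z - B_form \<Omega> u u z"
    using B_form_diff_second[OF H(2,4,5,3)] by (simp add: z_def)
  moreover have "B_form \<Omega> u z z = 0" by (rule B_form_self_zero[OF assms(2) H(3)])
  ultimately show ?thesis by simp
qed

lemma V_dual_diff:
  assumes f: "f \<in> V_dual \<Omega>" and g: "g \<in> V_dual \<Omega>"
  shows "(\<lambda>\<phi>. f \<phi> - g \<phi>) \<in> V_dual \<Omega>"
proof -
  obtain K1 where K1: "\<forall>\<phi>\<in>space_V \<Omega>. \<bar>f \<phi>\<bar> \<le> K1 * V_norm \<Omega> \<phi>" using f unfolding V_dual_def by blast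
  obtain K2 where K2: "\<forall>\<phi>\<in>space_V \<Omega>. \<bar>g \<phi>\<bar> \<le> K2 * V_norm \<Omega> \<phi>" using g unfolding V_dual_def by blast
  have "\<forall>\<phi>\<in>space_V \<Omega>. \<bar>f \<phi> - g \<phi>\<bar> \<le> (K1 + K2) * V_norm \<Omega> \<phi>"
  proof
    fix \<phi> assume "\<phi> \<in> space_V \<Omega>"
    then have "\<bar>f \<phi>\<bar> \<le> K1 * V_norm \<Omega> \<phi>" "\<bar>g \<phi>\<bar> \<le> K2 * V_norm \<Omega> \<phi>" using K1 K2 by auto
    then show "\<bar>f \<phi> - g \<phi>\<bar> \<le> (K1 + K2) * V_norm \<Omega> \<phi>" unfolding distrib_right by linarith
  qed
  then have "\<exists>K. \<forall>\<phi>\<in>space_V \<Omega>. \<bar>f \<phi> - g \<phi>\<bar> \<le> K * V_norm \<Omega> \<phi>" by blast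
  then show ?thesis
    using V_dual_add[OF f] V_dual_add[OF g] V_dual_scaleR[OF f] V_dual_scaleR[OF g]
    unfolding V_dual_def by (simp add: right_diff_distrib)
qed

lemma determining_modes:
  assumes "\<nu> > 0" "\<alpha> > 0"
    and h: "\<And>t. h t \<in> V_dual \<Omega>" "\<And>t. dual_norm w lam (h t) \<le> hb" and g: "\<And>t. g t \<in> V_dual \<Omega>"
    and v: "nsv_solution \<Omega> \<nu> \<alpha> h v0 v" and u: "nsv_solution \<Omega> \<nu> \<alpha> g u0 u"
    and d1: "d1 = 1 / 2 * min (1 / \<alpha>\<^sup>2) (lam 1)"
    and m: "lam (m + 1) > 64 * (hb ^ 4 / (\<alpha> ^ 4 * \<nu> ^ 8 * d1\<^sup>2))"
    and forces: "((\<lambda>t. dual_norm w lam (\<lambda>\<phi>. h t \<phi> - g t \<phi>)) \<longlongrightarrow> 0) at_top"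
    and modes: "((\<lambda>t. l2_norm \<Omega> (orth_proj \<Omega> (eigenspan w m) (\<lambda>x. v t x - u t x))) \<longlongrightarrow> 0) at_top"
  shows "((\<lambda>t. V_norm \<Omega> (\<lambda>x. v t x - u t x)) \<longlongrightarrow> 0) at_top"
proof -
  define z where "z t = (\<lambda>x. v t x - u t x)" for t
  note vV = nsv_solution_D(1)[OF v] and uV = nsv_solution_D(1)[OF u]
  have zV: "z t \<in> space_V \<Omega>" if "t \<ge> 0" for t unfolding z_def using that by (intro space_V_diff vV uV)
  have "d1 > 0" using \<open>\<alpha> > 0\<close> eigenvalue_pos[of 1] by (simp add: d1)
  have Lpos: "lam (m + 1) > 0" by (rule eigenvalue_pos) simp
  define \<Lambda> where "\<Lambda> = sqrt (lam (m + 1))"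
  have \<Lambda>: "\<Lambda> > 0" "\<Lambda>\<^sup>2 = lam (m + 1)" using Lpos by (simp_all add: \<Lambda>_def)
  define K where "K = hb\<^sup>2 / (\<alpha>\<^sup>2 * \<nu>\<^sup>2 * d1)"
  have "K \<ge> 0" using \<open>d1 > 0\<close> by (simp add: K_def)
  \<comment> \<open>Squared and multiplied by \<open>lam (m + 1)\<close>, this is the eigenvalue
    condition times \<open>\<nu> ^ 4\<close>.\<close>
  have gap: "8 * K * (1 / \<Lambda>) < \<nu>\<^sup>2"
  proof (rule power2_less_imp_less)
    have "64 * K\<^sup>2 = 64 * (hb ^ 4 / (\<alpha> ^ 4 * \<nu> ^ 8 * d1\<^sup>2)) * \<nu> ^ 4"
      using \<open>\<nu> > 0\<close> \<open>\<alpha> > 0\<close> \<open>d1 > 0\<close>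
      by (simp add: K_def power_divide power_mult_distrib field_simps flip: power_mult power_add)
    also have "\<dots> < lam (m + 1) * \<nu> ^ 4" using \<open>\<nu> > 0\<close> by (intro mult_strict_right_mono m) simp
    finally show "(8 * K * (1 / \<Lambda>))\<^sup>2 < (\<nu>\<^sup>2)\<^sup>2"
      using \<Lambda> Lpos by (simp add: power_mult_distrib power_divide field_simps flip: power_mult)
  qed simp
  \<comment> \<open>The strict gap leaves room for one \<open>\<delta>\<close> in two roles: the
    excess of the squared gradient norm of v over \<open>K\<close>, and the ratio of low modes to
    gradient in \<open>absorb_low_modes\<close>.\<close>
  obtain \<delta> where \<delta>: "\<delta> > 0" "8 * (K + \<delta>) * (\<delta> + 1 / \<Lambda>) < \<nu>\<^sup>2"
  proof -
    have "((\<lambda>\<delta>. 8 * (K + \<delta>) * (\<delta> + 1 / \<Lambda>)) \<longlongrightarrow> 8 * (K + 0) * (0 + 1 / \<Lambda>)) (at_right 0)"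
      by (intro tendsto_intros)
    then have "\<forall>\<^sub>F \<delta> in at_right 0. 8 * (K + \<delta>) * (\<delta> + 1 / \<Lambda>) < \<nu>\<^sup>2"
      using gap by (intro order_tendstoD(2)) auto
    then have "\<forall>\<^sub>F \<delta> in at_right 0. \<delta> > 0 \<and> 8 * (K + \<delta>) * (\<delta> + 1 / \<Lambda>) < \<nu>\<^sup>2"
      using eventually_at_right_less by eventually_elim auto
    then show ?thesis using that eventually_happens[of _ "at_right (0 :: real)"] by auto
  qed
  define W where "W = K + \<delta>"
  have "W \<ge> 0" using \<open>K \<ge> 0\<close> \<delta>(1) by (simp add: W_def)
  \<comment> \<open>The share of the viscosity spent on the convective term; the remainder
    \<open>\<kappa>\<close> pays for the forcing and for the decay.\<close>
  define \<mu> where "\<mu> = sqrt (8 * W * (\<delta> + 1 / \<Lambda>))"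
  have nn: "0 \<le> 8 * W * (\<delta> + 1 / \<Lambda>)" using \<open>W \<ge> 0\<close> \<delta>(1) \<Lambda>(1) by simp
  have \<mu>: "\<mu> \<ge> 0" "\<mu>\<^sup>2 = 8 * W * (\<delta> + 1 / \<Lambda>)" using nn by (simp_all add: \<mu>_def)
  have "\<mu>\<^sup>2 < \<nu>\<^sup>2" using \<delta>(2) unfolding \<mu>(2) W_def .
  then have "\<mu> < \<nu>" by (rule power2_less_imp_less) (use \<open>\<nu> > 0\<close> in simp)
  define \<kappa> where "\<kappa> = \<nu> - \<mu>"
  have "\<kappa> > 0" using \<open>\<mu> < \<nu>\<close> by (simp add: \<kappa>_def)
  define C where "C = sqrt (8 * W * (1 + 1 / (\<delta> * \<Lambda>)) / \<delta> ^ 3)"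
  define \<eta> where "\<eta> t = dual_norm w lam (\<lambda>\<phi>. h t \<phi> - g t \<phi>)" for t
  define p where "p t = l2_norm \<Omega> (truncation m (z t))" for t
  have \<eta>0: "(\<eta> \<longlongrightarrow> 0) at_top" unfolding \<eta>_def[abs_def] by (rule forces)
  have p0: "(p \<longlongrightarrow> 0) at_top"
  proof (rule Lim_transform_eventually[OF modes])
    show "\<forall>\<^sub>F t in at_top. l2_norm \<Omega> (orth_proj \<Omega> (eigenspan w m) (\<lambda>x. v t x - u t x)) = p t"
      using eventually_ge_at_top[of 0]
    proof eventually_elim
      case (elim t)
      then show ?case
        using orth_proj_eigenspan[OF space_V_L2[OF zV[OF elim]], of m] by (simp add: p_def z_def)
    qed
  qed
  have diff_dual: "(\<lambda>\<phi>. h t \<phi> - g t \<phi>) \<in> V_dual \<Omega>" for t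
    by (intro V_dual_diff h g)
  have key: "\<forall>\<^sub>F t in at_top. energy \<alpha> (z t) < \<epsilon>" if "\<epsilon> > 0" for \<epsilon>
  proof -
    define c where "c = \<kappa> * d1"
    have "c > 0" using \<open>\<kappa> > 0\<close> \<open>d1 > 0\<close> by (simp add: c_def)
    \<comment> \<open>Makes the asymptotic level \<open>k / c\<close> equal to half of
      \<open>\<epsilon>\<close>; the other half is Gronwall's margin.\<close>
    define k where "k = c * (\<epsilon> / 2)"
    have "k > 0" using \<open>c > 0\<close> that by (simp add: k_def)
    have "((\<lambda>t. (\<eta> t)\<^sup>2 / \<kappa> + 2 * (C * (p t)\<^sup>2)) \<longlongrightarrow> 0\<^sup>2 / \<kappa> + 2 * (C * 0\<^sup>2)) at_top"
      using \<open>\<kappa> > 0\<close> by (intro tendsto_intros \<eta>0 p0) auto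
    then have "\<forall>\<^sub>F t in at_top. (\<eta> t)\<^sup>2 / \<kappa> + 2 * (C * (p t)\<^sup>2) < k"
      using \<open>k > 0\<close> by (intro order_tendstoD(2)) auto
    moreover have "\<forall>\<^sub>F t in at_top. (V_norm \<Omega> (v t))\<^sup>2 < W"
      unfolding W_def K_def by (rule solution_eventually_bounded[OF v \<open>\<nu> > 0\<close> \<open>\<alpha> > 0\<close> \<delta>(1) h d1])
    ultimately have "\<forall>\<^sub>F t in at_top. (\<eta> t)\<^sup>2 / \<kappa> + 2 * (C * (p t)\<^sup>2) < k \<and> (V_norm \<Omega> (v t))\<^sup>2 < W"
      by (rule eventually_conj)
    then obtain T where T: "\<And>t. t \<ge> T \<Longrightarrow> (\<eta> t)\<^sup>2 / \<kappa> + 2 * (C * (p t)\<^sup>2) < k \<and> (V_norm \<Omega> (v t))\<^sup>2 < W"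
      unfolding eventually_at_top_linorder by blast
    have "\<forall>\<^sub>F t in at_top. energy \<alpha> (z t) < k / c + \<epsilon> / 2"
    proof (rule Gronwall_eventually[where a = "max T 0"])
      show "ac_increment (\<lambda>s t. \<bar>energy \<alpha> (z t) - energy \<alpha> (z s)\<bar>) 0 T" if "T > 0" for T
      proof (rule energy_ac_increment[OF zV _ that])
        show "V_abs_continuous \<Omega> z"
          unfolding z_def[abs_def]
          by (rule V_abs_continuous_diff[OF vV uV nsv_solution_D(2)[OF v] nsv_solution_D(2)[OF u]])
      qed
      show "AE t in lebesgue. max T 0 < t \<longrightarrow> (\<exists>d\<le>k - c * energy \<alpha> (z t).
          ((\<lambda>t. energy \<alpha> (z t)) has_real_derivative d) (at t))"
        using nsv_solution_D(3)[OF v] nsv_solution_D(3)[OF u]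
      proof eventually_elim
        case (elim t)
        show ?case
        proof
          assume "max T 0 < t"
          then have t: "t > 0" "t \<ge> T" by auto
          obtain v' where v': "has_V_derivative \<Omega> v v' t"
            and eqv: "\<And>\<phi>. \<phi> \<in> space_V \<Omega> \<Longrightarrow> l2_inner \<Omega> v' \<phi> + \<nu> * stokes_ext \<Omega> (v t) \<phi>
              + \<alpha>\<^sup>2 * stokes_ext \<Omega> v' \<phi> + B_form \<Omega> (v t) (v t) \<phi> = h t \<phi>"
            using elim(1) t(1) by blast
          obtain u' where u': "has_V_derivative \<Omega> u u' t"
            and equ: "\<And>\<phi>. \<phi> \<in> space_V \<Omega> \<Longrightarrow> l2_inner \<Omega> u' \<phi> + \<nu> * stokes_ext \<Omega> (u t) \<phi>
              + \<alpha>\<^sup>2 * stokes_ext \<Omega> u' \<phi> + B_form \<Omega> (u t) (u t) \<phi> = g t \<phi>"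
            using elim(2) t(1) by blast
          define z' where "z' = (\<lambda>x. v' x - u' x)"
          have dz: "has_V_derivative \<Omega> z z' t"
            unfolding z_def[abs_def] z'_def by (rule has_V_derivative_diff[OF vV uV t(1) v' u'])
          have V: "z t \<in> space_V \<Omega>" "v t \<in> space_V \<Omega>" "u t \<in> space_V \<Omega>" "v' \<in> space_V \<Omega>" "u' \<in> space_V \<Omega>"
            using zV vV uV t(1) v' u' by (auto simp: has_V_derivative_def)
          define x where "x = V_norm \<Omega> (z t)"
          have x0: "x \<ge> 0" by (simp add: x_def)
          have "l2_inner \<Omega> z' (z t) = l2_inner \<Omega> v' (z t) - l2_inner \<Omega> u' (z t)"
            unfolding z'_def by (intro l2_inner_diff_left space_V_L2 V)
          moreover have "stokes_ext \<Omega> z' (z t) = stokes_ext \<Omega> v' (z t) - stokes_ext \<Omega> u' (z t)"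
            unfolding z'_def by (intro stokes_ext_diff space_V_H1 V)
          moreover have "x\<^sup>2 = stokes_ext \<Omega> (v t) (z t) - stokes_ext \<Omega> (u t) (z t)"
            unfolding x_def V_norm_power2
            using stokes_ext_diff[OF space_V_H1[OF V(2)] space_V_H1[OF V(3)] space_V_H1[OF V(1)]]
            by (simp add: z_def)
          moreover have "B_form \<Omega> (v t) (v t) (z t) - B_form \<Omega> (u t) (u t) (z t) = B_form \<Omega> (z t) (v t) (z t)"
            unfolding z_def by (rule B_form_difference[OF V(2,3)])
          ultimately have eq: "l2_inner \<Omega> z' (z t) + \<alpha>\<^sup>2 * stokes_ext \<Omega> z' (z t)
              = (h t (z t) - g t (z t)) - \<nu> * x\<^sup>2 - B_form \<Omega> (z t) (v t) (z t)"
            using eqv[OF V(1)] equ[OF V(1)] by (simp add: right_diff_distrib)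
          have hg: "h t (z t) - g t (z t) \<le> \<eta> t * x"
            using dual_norm_bound[OF diff_dual V(1), of t] by (simp add: \<eta>_def x_def)
          have "- B_form \<Omega> (z t) (v t) (z t) \<le> V_norm \<Omega> (v t) * L4_norm_sq (z t)"
            using B_form_bound[OF space_V_H1[OF V(2)] space_V_H10[OF V(1)] space_V_H10[OF V(1)]] by simp
          also have "\<dots> \<le> \<mu> * x\<^sup>2 + C * (p t)\<^sup>2"
            unfolding C_def
          proof (rule absorb_low_modes[OF x0 _ _ \<delta>(1) \<mu>(1) \<Lambda>(1) \<open>W \<ge> 0\<close>])
            show "(L4_norm_sq (z t))\<^sup>2 \<le> 8 * l2_norm \<Omega> (z t) * x ^ 3"
              unfolding x_def by (rule Ladyzhenskaya[OF space_V_H10[OF V(1)]])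
            show "(V_norm \<Omega> (v t))\<^sup>2 \<le> W" using T[OF t(2)] by simp
            have "(\<Lambda> * l2_norm \<Omega> (\<lambda>y. z t y - truncation m (z t) y))\<^sup>2 \<le> x\<^sup>2"
              using truncation_Poincare[OF V(1), of m] by (simp add: power_mult_distrib \<Lambda>(2) x_def)
            then have "\<Lambda> * l2_norm \<Omega> (\<lambda>y. z t y - truncation m (z t) y) \<le> x"
              by (rule power2_le_imp_le[OF _ x0])
            then have "l2_norm \<Omega> (\<lambda>y. z t y - truncation m (z t) y) \<le> x / \<Lambda>"
              using \<Lambda>(1) by (simp add: field_simps)
            then show "l2_norm \<Omega> (z t) \<le> p t + x / \<Lambda>"
              using l2_norm_triangle_sub[OF space_V_L2[OF V(1)] space_V_L2[OF truncation_V[of m "z t"]]]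
              by (simp add: p_def)
          qed (simp_all add: p_def \<mu>(2))
          finally have B: "- B_form \<Omega> (z t) (v t) (z t) \<le> \<mu> * x\<^sup>2 + C * (p t)\<^sup>2" .
          \<comment> \<open>Of the dissipation \<open>2 * \<kappa> * x\<^sup>2\<close>, one half
            absorbs the forcing difference here and one half remains for the decay of the
            energy.\<close>
          have young: "2 * (\<eta> t * x) \<le> (\<eta> t)\<^sup>2 / \<kappa> + \<kappa> * x\<^sup>2"
          proof -
            have "0 \<le> \<kappa> * (x - \<eta> t / \<kappa>)\<^sup>2" using \<open>\<kappa> > 0\<close> by simp
            also have "\<dots> = \<kappa> * x\<^sup>2 - 2 * (\<eta> t * x) + (\<eta> t)\<^sup>2 / \<kappa>"
              using \<open>\<kappa> > 0\<close> by (simp add: power2_eq_square field_simps)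
            finally show ?thesis by simp
          qed
          have "\<kappa> * (d1 * energy \<alpha> (z t)) \<le> \<kappa> * x\<^sup>2"
            using energy_le_V_norm[OF V(1) \<open>\<alpha> > 0\<close>] \<open>\<kappa> > 0\<close> unfolding x_def d1
            by (intro mult_left_mono) auto
          then have ce: "c * energy \<alpha> (z t) \<le> \<kappa> * x\<^sup>2" by (simp add: c_def mult.assoc)
          have split: "\<nu> * x\<^sup>2 = \<kappa> * x\<^sup>2 + \<mu> * x\<^sup>2" by (simp add: \<kappa>_def left_diff_distrib)
          \<comment> \<open>The estimates are added up over fresh real variables, so that linear
            arithmetic meets no products.\<close>
          have combine: "2 * a \<le> k - e"
            if "n = y + q" "a = b - n - w" "b \<le> r" "- w \<le> q + l" "2 * r \<le> s + y" "e \<le> y" "s + 2 * l < k"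
            for a b e l n q r s w y :: real
            using that by linarith
          have "2 * (l2_inner \<Omega> z' (z t) + \<alpha>\<^sup>2 * stokes_ext \<Omega> z' (z t)) \<le> k - c * energy \<alpha> (z t)"
            by (rule combine[OF split eq hg B young ce conjunct1[OF T[OF t(2)]]])
          then show "\<exists>d\<le>k - c * energy \<alpha> (z t). ((\<lambda>t. energy \<alpha> (z t)) has_real_derivative d) (at t)"
            using energy_has_derivative[OF zV t(1) dz] by blast
        qed
      qed
    qed (use \<open>c > 0\<close> that in auto)
    then show ?thesis using \<open>c > 0\<close> by (simp add: k_def)
  qed
  have "((\<lambda>t. V_norm \<Omega> (z t)) \<longlongrightarrow> 0) at_top"
  proof (rule tendstoI)
    fix e :: real assume "e > 0"
    then have "\<alpha>\<^sup>2 * e\<^sup>2 > 0" using \<open>\<alpha> > 0\<close> by simp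
    from key[OF this] show "\<forall>\<^sub>F t in at_top. dist (V_norm \<Omega> (z t)) 0 < e"
    proof eventually_elim
      case (elim t)
      have "\<alpha>\<^sup>2 * (V_norm \<Omega> (z t))\<^sup>2 \<le> energy \<alpha> (z t)" by (simp add: energy_def)
      also note elim
      finally have "(V_norm \<Omega> (z t))\<^sup>2 < e\<^sup>2" using \<open>\<alpha> > 0\<close> by simp
      then have "V_norm \<Omega> (z t) < e" by (rule power2_less_imp_less) (use \<open>e > 0\<close> in simp)
      then show ?case by simp
    qed
  qed
  then show ?thesis by (simp add: z_def)
qed

end

theorem theorem4p2:
  fixes \<Omega>0 :: "(real ^ 3) set"
  assumes "smooth_bounded_domain \<Omega>0"
  shows "\<exists>C>0. \<forall>r>0. \<forall>\<Omega>. \<Omega> = (\<lambda>x. r *\<^sub>R x) ` \<Omega>0 \<longrightarrow>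
    (\<forall>w lam \<nu> \<alpha> hb h g v0 u0 v u m d1.
       stokes_eigensystem \<Omega> w lam \<and>
       \<nu> > 0 \<and> \<alpha> > 0 \<and>
       forcing \<Omega> w lam h \<and>
       forcing \<Omega> w lam g \<and> locally_square_integrable w lam g \<and>
       v0 \<in> space_V \<Omega> \<and> nsv_solution \<Omega> \<nu> \<alpha> h v0 v \<and>
       u0 \<in> space_V \<Omega> \<and> nsv_solution \<Omega> \<nu> \<alpha> g u0 u \<and>
       (\<forall>t. dual_norm w lam (h t) \<le> hb) \<and>
       d1 = 1 / 2 * min (1 / \<alpha>\<^sup>2) (lam 1) \<and>
       lam (m + 1) > C * (hb ^ 4 / (\<alpha> ^ 4 * \<nu> ^ 8 * d1\<^sup>2)) \<and>
       ((\<lambda>t. dual_norm w lam (\<lambda>\<phi>. h t \<phi> - g t \<phi>)) \<longlongrightarrow> 0) at_top \<and>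
       ((\<lambda>t. l2_norm \<Omega> (orth_proj \<Omega> (eigenspan w m) (\<lambda>x. v t x - u t x))) \<longlongrightarrow> 0) at_top
       \<longrightarrow> ((\<lambda>t. V_norm \<Omega> (\<lambda>x. v t x - u t x)) \<longlongrightarrow> 0) at_top)"
\<comment> \<open>The witness is the square of the constant 8 in Ladyzhenskaya's inequality, which
  is the same for every domain, so that the factor \<open>r\<close> does not enter the
  estimates.\<close>
proof (intro exI[of _ "64 :: real"] conjI allI impI)
  fix r :: real and \<Omega> w lam \<nu> \<alpha> hb h g v0 u0 v u m d1
  assume "r > 0" and \<Omega>: "\<Omega> = (\<lambda>x. r *\<^sub>R x) ` \<Omega>0"
    and A: "stokes_eigensystem \<Omega> w lam \<and>
       \<nu> > 0 \<and> \<alpha> > 0 \<and>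
       forcing \<Omega> w lam h \<and>
       forcing \<Omega> w lam g \<and> locally_square_integrable w lam g \<and>
       v0 \<in> space_V \<Omega> \<and> nsv_solution \<Omega> \<nu> \<alpha> h v0 v \<and>
       u0 \<in> space_V \<Omega> \<and> nsv_solution \<Omega> \<nu> \<alpha> g u0 u \<and>
       (\<forall>t. dual_norm w lam (h t) \<le> hb) \<and>
       d1 = 1 / 2 * min (1 / \<alpha>\<^sup>2) (lam 1) \<and>
       lam (m + 1) > 64 * (hb ^ 4 / (\<alpha> ^ 4 * \<nu> ^ 8 * d1\<^sup>2)) \<and>
       ((\<lambda>t. dual_norm w lam (\<lambda>\<phi>. h t \<phi> - g t \<phi>)) \<longlongrightarrow> 0) at_top \<and>
       ((\<lambda>t. l2_norm \<Omega> (orth_proj \<Omega> (eigenspan w m) (\<lambda>x. v t x - u t x))) \<longlongrightarrow> 0) at_top"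
  have "open \<Omega>"
    unfolding \<Omega> using assms \<open>r > 0\<close> by (intro open_scaling) (auto simp: smooth_bounded_domain_def)
  then interpret stokes_system \<Omega> w lam
    by unfold_locales (use A in blast)+
  show "((\<lambda>t. V_norm \<Omega> (\<lambda>x. v t x - u t x)) \<longlongrightarrow> 0) at_top"
    by (rule determining_modes[of \<nu> \<alpha> h hb g v0 v u0 u d1 m]) (use A in \<open>auto simp: forcing_def\<close>)
qed simp

end
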